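(* Let $(F_n)$ be a sequence in the Wiener chaos $\mathcal W_p$. The following are equivalent: (i) $(F_n)$ is asymptotically Gaussian; (ii) $\mathrm{Var}(\Gamma[F_n,F_n])$ converges to $0$; (iii) for $k\ge 2$, $H_k(F_n)$ is asymptotically an eigenfunction of $\mathsf L$ of order $kp$, that is, $(\mathsf L+kp)H_k(F_n)\to 0$ in $L^2(\mathbf P)$ as $n\to\infty$; (iv) for $k\ge 2$, $H_k(F_n)$ has asymptotically no chaos components other than the one of order $kp$, that is, $\mathsf J_qH_k(F_n)\to0$ in $L^2(\mathbf P)$ as $n\to\infty$ for all $q\ne kp$; (v) $\rho_{p-1}(F_n)\to 0$ as $n\to\infty$; (vi) $\rho_{\lfloor p/2\rfloor}(F_n)\to 0$ as $n\to\infty$.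
   Context: Let $(G_i)_{i\in\mathbb N}$ be the coordinate process (independent standard Gaussians) on the probability space $(\mathbb R,\mathcal B(\mathbb R),\mathcal N(0,1))^{\otimes\infty}$, with probability $\mathbf P$ and expectation $\mathbf E$, and let $H_k$ be the Hermite polynomial of degree $k$. For an integer $p$, the Wiener chaos $\mathcal W_p$ is the closed linear span in $L^2(\mathbf P)$ of $\{\prod_iH_{k_i}(G_i):\sum_ik_i=p\}$ (so $\mathcal W_0=\mathbb R$); $\mathcal W_{\le d}=\bigoplus_{m\le d}\mathcal W_m$; $\mathsf J_m$ is the orthogonal projection onto $\mathcal W_m$. A sequence is asymptotically Gaussian if it converges in law to a Gaussian distribution. The Ornstein–Uhlenbeck generator is $\mathsf LF=\sum_{m=0}^d(-m)\mathsf J_mF$ for $F\in\mathcal W_{\le d}$, and the carré du champ is $\Gamma[F,X]=\frac12(\mathsf L(FX)-F\mathsf LX-X\mathsf LF)$; on polynomials in the $G_i$, $\Gamma[F,X]=\sum_i\partial_{G_i}F\,\partial_{G_i}X$. The directional influence of degree $q$ of $F$ is $$\rho_q(F)=\sup\{\|\Gamma[F,X]\|_{L^2(\mathbf P)}:X\in\mathcal W_q,\ \mathbf E[X^2]=1\},$$ so that $\rho_0(F)=0$.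
   Formalization: The formal theorem adds p ≥ 1 (ρ_{p−1} is undefined for p = 0) and the normalization E[F_n²] → 1; without it the claim fails, e.g. F_n = 2G_1 satisfies (i) but J_0H_2(F_n) = 3, so (iv) fails. *)

theory Defs
  imports "HOL-Probability.Probability" "HOL-Computational_Algebra.Polynomial"
begin

definition wiener_space :: "(nat \<Rightarrow> real) measure" where
  "wiener_space = (\<Pi>\<^sub>M i\<in>(UNIV :: nat set). std_normal_distribution)"

global_interpretation wiener: prob_space wiener_space
  unfolding wiener_space_def
  by (intro prob_space_PiM prob_space_normal_density) simp

(* Elements of L^2 are represented by functions; all notions below depend only on
   their almost-everywhere classes, up to almost-everywhere equality. *)

definition L2_space :: "((nat \<Rightarrow> real) \<Rightarrow> real) set" where
  "L2_space = {F \<in> borel_measurable wiener_space. integrable wiener_space (\<lambda>\<omega>. (F \<omega>)\<^sup>2)}"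

definition L2_norm :: "((nat \<Rightarrow> real) \<Rightarrow> real) \<Rightarrow> real" where
  "L2_norm F = sqrt (wiener.expectation (\<lambda>\<omega>. (F \<omega>)\<^sup>2))"

(* Probabilists' (monic) normalisation: 1, x, x^2 - 1, x^3 - 3 x, ... *)
primrec hermite :: "nat \<Rightarrow> real poly" where
  "hermite 0 = 1"
| "hermite (Suc k) = [:0, 1:] * hermite k - pderiv (hermite k)"

definition multi_indices :: "nat \<Rightarrow> (nat \<Rightarrow> nat) set" where
  "multi_indices p = {k. finite {i. k i \<noteq> 0} \<and> (\<Sum>i | k i \<noteq> 0. k i) = p}"

(* The infinite product over i reduces to the support of k, since H_0 = 1. *)
definition hermite_prod :: "(nat \<Rightarrow> nat) \<Rightarrow> (nat \<Rightarrow> real) \<Rightarrow> real" where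
  "hermite_prod k \<omega> = (\<Prod>i | k i \<noteq> 0. poly (hermite (k i)) (\<omega> i))"

definition hermite_span :: "nat \<Rightarrow> ((nat \<Rightarrow> real) \<Rightarrow> real) set" where
  "hermite_span p =
     {(\<lambda>\<omega>. \<Sum>k\<in>A. c k * hermite_prod k \<omega>) | A c. finite A \<and> A \<subseteq> multi_indices p}"

definition chaos :: "nat \<Rightarrow> ((nat \<Rightarrow> real) \<Rightarrow> real) set" where
  "chaos p = {F \<in> L2_space. \<forall>\<epsilon>>0. \<exists>Y\<in>hermite_span p. L2_norm (\<lambda>\<omega>. F \<omega> - Y \<omega>) < \<epsilon>}"

definition chaos_le :: "nat \<Rightarrow> ((nat \<Rightarrow> real) \<Rightarrow> real) set" where
  "chaos_le d = {(\<lambda>\<omega>. \<Sum>m\<le>d. Y m \<omega>) | Y. \<forall>m\<le>d. Y m \<in> chaos m}"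

(* For F in L^2: a representative of the orthogonal projection of F onto the m-th chaos. *)
definition chaos_proj :: "nat \<Rightarrow> ((nat \<Rightarrow> real) \<Rightarrow> real) \<Rightarrow> (nat \<Rightarrow> real) \<Rightarrow> real" where
  "chaos_proj m F =
     (SOME Y. Y \<in> chaos m \<and> (\<forall>Z\<in>chaos m. wiener.expectation (\<lambda>\<omega>. (F \<omega> - Y \<omega>) * Z \<omega>) = 0))"

(* Meaningful for F in some chaos_le d. The least such d is used; a larger d only adds
   terms vanishing almost everywhere. *)
definition OU_gen :: "((nat \<Rightarrow> real) \<Rightarrow> real) \<Rightarrow> (nat \<Rightarrow> real) \<Rightarrow> real" where
  "OU_gen F \<omega> = (\<Sum>m\<le>(LEAST d. F \<in> chaos_le d). - real m * chaos_proj m F \<omega>)"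

definition carre_du_champ ::
    "((nat \<Rightarrow> real) \<Rightarrow> real) \<Rightarrow> ((nat \<Rightarrow> real) \<Rightarrow> real) \<Rightarrow> (nat \<Rightarrow> real) \<Rightarrow> real" where
  "carre_du_champ F X \<omega> =
     (OU_gen (\<lambda>\<omega>. F \<omega> * X \<omega>) \<omega> - F \<omega> * OU_gen X \<omega> - X \<omega> * OU_gen F \<omega>) / 2"

(* Valued in ereal so that the supremum is the true one without a boundedness proof. *)
definition influence :: "nat \<Rightarrow> ((nat \<Rightarrow> real) \<Rightarrow> real) \<Rightarrow> ereal" where
  "influence q F =
     (SUP X \<in> {X \<in> chaos q. wiener.expectation (\<lambda>\<omega>. (X \<omega>)\<^sup>2) = 1}.
        ereal (L2_norm (carre_du_champ F X)))"

(* The law of m + s N with N standard normal; s = 0 gives the Dirac mass at m. *)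
definition gaussian_law :: "real \<Rightarrow> real \<Rightarrow> real measure" where
  "gaussian_law m s = distr std_normal_distribution borel (\<lambda>x. m + s * x)"

definition asymp_gaussian :: "(nat \<Rightarrow> (nat \<Rightarrow> real) \<Rightarrow> real) \<Rightarrow> bool" where
  "asymp_gaussian F \<longleftrightarrow>
     (\<exists>m s. s \<ge> 0 \<and> weak_conv_m (\<lambda>n. distr wiener_space borel (F n)) (gaussian_law m s))"

end

theory Submission
  imports Defs
begin

text \<open>
  Everything reduces to inequalities for polynomials in finitely many coordinates, where
  \<open>L = \<Sum>\<^sub>i (\<partial>\<^sub>i\<^sup>2 - \<omega>\<^sub>i \<partial>\<^sub>i)\<close> and \<open>\<Gamma>[F,X] = \<Sum>\<^sub>i \<partial>\<^sub>iF \<partial>\<^sub>iX = (L + p + q)(FX) / 2\<close> for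
  \<open>F\<close>, \<open>X\<close> of chaos order \<open>p\<close>, \<open>q\<close>; hypercontractivity and density carry them over to the chaoses.

  Hypercontractivity follows by induction on \<open>p\<close> from \<open>p E F\<^sup>4 = 3 \<Sum>\<^sub>i E[F\<^sup>2 (\<partial>\<^sub>iF)\<^sup>2]\<close> and Cauchy-Schwarz.
  Expanding \<open>F\<^sup>2\<close> in chaoses gives \<open>Var \<Gamma>[F,F] \<le> p\<^sup>2/3 (E F\<^sup>4 - 3 (E F\<^sup>2)\<^sup>2)\<close>, hence (i) implies (ii).
  Conversely \<open>p E F\<^bsup>k+2\<^esup> = (k+1) E[F\<^sup>k \<Gamma>[F,F]]\<close> makes all moments converge to the Gaussian ones.
  The identity \<open>(L + kp) H\<^sub>k(F) = H\<^sub>k''(F) (\<Gamma>[F,F] - p)\<close> gives (iii), the spectral decomposition (iv),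
  and \<open>k = 2\<close> in (iv) gives back (ii).

  For \<open>q < p\<close>, \<open>E \<Gamma>[F,X]\<^sup>2\<close> is at most a constant times \<open>E[FX \<Gamma>[F,X]] = E[X\<^sup>2 (pF\<^sup>2 - \<Gamma>[F,F])] / 2\<close>, which only
  sees the components of \<open>F\<^sup>2\<close> of order at most \<open>2q < 2p\<close> and is thus controlled by \<open>Var \<Gamma>[F,F]\<close>.
  Conversely, multiplying \<open>X\<close> by a Hermite polynomial of a fresh coordinate shows that \<open>\<rho>\<^sub>q(F)\<close> is
  monotone in \<open>q\<close>, and iterating \<open>E[\<Gamma>[U,Z] F] = (a + c - p)/2 E[U Z F]\<close> for \<open>U\<close>, \<open>Z\<close> of order \<open>a\<close>, \<open>c\<close> lowers
  the orders until \<open>a + c = p\<close>, where one of them is at most \<open>p/2\<close> and \<open>\<rho>\<close> applies; with \<open>U = F\<close> this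
  bounds every component of \<open>F\<^sup>2\<close> of order strictly between \<open>0\<close> and \<open>2p\<close>.
\<close>

section \<open>Hermite products and polynomials in finitely many coordinates\<close>

text \<open>Write F^2 as the sum of components g_m, 0 <= m <= 2p. Then Gamma[F,F] is the sum of (p -
  m/2) g_m: its order-0 part is its mean p E F^2, and the weight at m = 2p is 0. Hence Var
  Gamma[F,F] and the g_m with 0 < m < 2p control each other; this is the common currency of (ii),
  (iv), (v) and (vi).

  The obstacle is that \<open>OU_gen\<close>, \<open>chaos_proj\<close> and
  \<open>carre_du_champ\<close> rest on a choice and a least degree and are determined only almost
  everywhere, and that FX must be shown to lie in some \<open>chaos_le\<close> at all. So the
  inequalities are proved for polynomials, with constants independent of the number of coordinates,
  and passed to the limit. Approximation in L2 does not survive products; hypercontractivity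
  upgrades it to approximation in all moments, which does.

  The normalization E F_n^2 -> 1 fixes the Gaussian limit as N(0,1), to which the monic Hermite
  polynomials in (iii) and (iv) are adapted, and it supplies uniform moment bounds.\<close>

abbreviation \<E> :: "((nat \<Rightarrow> real) \<Rightarrow> real) \<Rightarrow> real" where
  "\<E> f \<equiv> integral\<^sup>L wiener_space f"

text \<open>Differentiating the defining recursion leaves x H_n' - H_n'', which by the induction
  hypothesis is n times the recursion for H_n itself. At \<open>k = 0\<close> the truncated index
  \<open>k - 1\<close> is harmless because its coefficient is 0.\<close>

lemma pderiv_hermite: "pderiv (hermite k) = smult (real k) (hermite (k - 1))"
proof (induction k rule: less_induct)
  case (less k)
  show ?case
  proof (cases k)
    case (Suc n)
    have IH: "pderiv (hermite n) = smult (real n) (hermite (n - 1))"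
      using less Suc by simp
    have "pderiv (hermite k) = hermite n + [:0, 1:] * pderiv (hermite n) - pderiv (pderiv (hermite n))"
      by (simp add: Suc pderiv_diff pderiv_pCons pderiv_mult)
    also have "[:0, 1:] * pderiv (hermite n) - pderiv (pderiv (hermite n)) = smult (real n) (hermite n)"
    proof (cases n)
      case (Suc m)
      have "[:0, 1:] * pderiv (hermite n) - pderiv (pderiv (hermite n))
         = smult (real n) ([:0, 1:] * hermite m - pderiv (hermite m))"
        unfolding IH by (simp add: Suc pderiv_smult smult_diff_right)
      then show ?thesis using Suc by simp
    qed simp
    then have "hermite n + [:0, 1:] * pderiv (hermite n) - pderiv (pderiv (hermite n))
       = smult (real k) (hermite n)"
      by (simp only: add_diff_eq [symmetric]) (simp add: Suc smult_add_left)
    finally show ?thesis by (simp add: Suc)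
  qed simp
qed

lemma hermite_recurrence:
  "x * poly (hermite n) x = poly (hermite (Suc n)) x + real n * poly (hermite (n - 1)) x"
  by (simp add: pderiv_hermite)

text \<open>The eigenvalue equation of the one-dimensional generator; \<open>LL_hermite_eq\<close>
  uses it to cancel the first-order term of the chain rule.\<close>

lemma hermite_ode:
  "poly (pderiv (pderiv (hermite n))) x - x * poly (pderiv (hermite n)) x = - real n * poly (hermite n) x"
proof (cases n)
  case (Suc m)
  have "pderiv (hermite n) = smult (real n) (hermite m)"
    unfolding pderiv_hermite by (simp only: Suc diff_Suc_1)
  then have "poly (pderiv (pderiv (hermite n))) x - x * poly (pderiv (hermite n)) x
     = real n * (real m * poly (hermite (m - 1)) x - x * poly (hermite m) x)"
    by (simp add: pderiv_hermite pderiv_smult algebra_simps)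
  also have "\<dots> = - real n * poly (hermite n) x"
    using hermite_recurrence[of x m] by (simp add: Suc algebra_simps del: hermite.simps)
  finally show ?thesis .
qed simp

lemma integrable_std_normal_poly: "integrable std_normal_distribution (\<lambda>x. poly q x)"
  unfolding poly_altdef
  by (intro Bochner_Integration.integrable_sum integrable_mult_right integrable_std_normal_distribution_moment)

text \<open>Read off from the closed form of the even moments; for odd exponents both sides vanish.
  The moments of F_n satisfy this recursion in the limit, which is how the Gaussian is
  recognised.\<close>

lemma std_normal_moment_Suc:
  "(LINT x|std_normal_distribution. x ^ (Suc (Suc k)))
     = real (Suc k) * (LINT x|std_normal_distribution. x ^ k)"
proof (cases "even k")
  case True
  then obtain j where k: "k = 2 * j" by (elim evenE)
  have "Suc (Suc k) = 2 * Suc j" by (simp add: k)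
  then have "(LINT x|std_normal_distribution. x ^ (Suc (Suc k))) = fact (2 * Suc j) / (2 ^ Suc j * fact (Suc j))"
    by (simp only: std_normal_distribution_even_moments)
  also have "fact (2 * Suc j) = (2 * real (Suc j)) * (real (Suc k) * fact (2 * j))"
    by (simp add: k)
  also have "2 ^ Suc j * fact (Suc j) = (2 * real (Suc j)) * (2 ^ j * fact j)"
    by simp
  also have "(2 * real (Suc j)) * (real (Suc k) * fact (2 * j)) / ((2 * real (Suc j)) * (2 ^ j * fact j))
     = real (Suc k) * (fact (2 * j) / (2 ^ j * fact j))"
    by (subst mult_divide_mult_cancel_left) auto
  also have "fact (2 * j) / (2 ^ j * fact j) = (LINT x|std_normal_distribution. x ^ k)"
    unfolding k by (simp only: std_normal_distribution_even_moments)
  finally show ?thesis .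
next
  case False
  then show ?thesis by (simp add: integral_std_normal_distribution_moment_odd del: power_Suc)
qed

text \<open>Stein's identity. It is linear in \<open>q\<close>, so monomials suffice, and for them
  it is the moment recursion.\<close>

lemma std_normal_ibp:
  "(LINT x|std_normal_distribution. x * poly q x) = (LINT x|std_normal_distribution. poly (pderiv q) x)"
proof -
  note [simp] = integrable_std_normal_distribution_moment
  have monom: "(LINT x|std_normal_distribution. x * poly (monom c i) x)
      = (LINT x|std_normal_distribution. poly (pderiv (monom c i)) x)" for c i
  proof (cases i)
    case 0
    then show ?thesis
      using integral_std_normal_distribution_moment_odd[of 1] by (simp add: poly_monom pderiv_monom)
  next
    case (Suc j)
    have "(LINT x|std_normal_distribution. x * poly (monom c i) x) = (LINT x|std_normal_distribution. c * x ^ Suc (Suc j))"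
      by (simp add: poly_monom Suc mult_ac)
    also have "\<dots> = c * (real (Suc j) * (LINT x|std_normal_distribution. x ^ j))"
      by (simp only: integral_mult_right_zero std_normal_moment_Suc)
    also have "\<dots> = (LINT x|std_normal_distribution. poly (pderiv (monom c i)) x)"
      by (simp add: poly_monom pderiv_monom Suc)
    finally show ?thesis .
  qed
  have int: "integrable std_normal_distribution (\<lambda>x. x * poly r x)" for r
    using integrable_std_normal_poly[of "[:0, 1:] * r"] by simp
  have pderiv_sum: "pderiv (sum f A) = (\<Sum>i\<in>A. pderiv (f i))" for f :: "nat \<Rightarrow> real poly" and A
    by (induction A rule: infinite_finite_induct) (simp_all add: pderiv_add)
  have poly_sum: "poly (sum f A) = (\<lambda>x. \<Sum>i\<in>A. poly (f i) x)" for f :: "nat \<Rightarrow> real poly" and A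
    by (simp add: fun_eq_iff poly_sum)
  have q: "q = (\<Sum>i\<le>degree q. monom (coeff q i) i)"
    by (simp add: poly_as_sum_of_monoms)
  show ?thesis
    by (subst (1 2) q)
       (simp add: poly_sum pderiv_sum sum_distrib_left int integrable_std_normal_poly monom)
qed

lemma std_normal_hermite_expectation:
  "(LINT x|std_normal_distribution. poly (hermite k) x) = (if k = 0 then 1 else 0)"
proof (cases k)
  case 0
  interpret prob_space std_normal_distribution
    by (rule prob_space_normal_density) simp
  show ?thesis using prob_space 0 by simp
next
  case (Suc n)
  have "integrable std_normal_distribution (\<lambda>x. x * poly (hermite n) x)"
    using integrable_std_normal_poly[of "[:0, 1:] * hermite n"] by simp
  then show ?thesis
    by (simp add: Suc integrable_std_normal_poly std_normal_ibp)
qed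

text \<open>The integrand sees only the coordinates below \<open>N\<close>, and restriction to them
  maps the infinite product measure to the finite one, where expectations of products
  factor.\<close>

lemma
  assumes "\<And>i. i < N \<Longrightarrow> integrable std_normal_distribution (f i)"
  shows integrable_wiener_prod: "integrable wiener_space (\<lambda>w. \<Prod>i<N. f i (w i))"
    and expectation_wiener_prod:
      "\<E> (\<lambda>w. \<Prod>i<N. f i (w i)) = (\<Prod>i<N. integral\<^sup>L std_normal_distribution (f i))"
proof -
  interpret product_prob_space "\<lambda>_. std_normal_distribution" "UNIV :: nat set"
    by (intro product_prob_spaceI prob_space_normal_density) simp
  let ?M = "\<lambda>_. std_normal_distribution"
  let ?g = "\<lambda>w. \<Prod>i<N. f i (w i)"
  have d: "distr wiener_space (PiM {..<N} ?M) (\<lambda>x. restrict x {..<N}) = PiM {..<N} ?M"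
    unfolding wiener_space_def by (rule distr_PiM_restrict_finite) auto
  have m: "(\<lambda>x. restrict x {..<N}) \<in> measurable wiener_space (PiM {..<N} ?M)"
    unfolding wiener_space_def by (rule measurable_restrict_subset) auto
  have i: "integrable (PiM {..<N} ?M) ?g"
    by (rule product_integrable_prod) (use assms in auto)
  have e: "integral\<^sup>L (PiM {..<N} ?M) ?g = (\<Prod>i<N. integral\<^sup>L std_normal_distribution (f i))"
    by (rule product_integral_prod) (use assms in auto)
  have r: "?g (restrict w {..<N}) = ?g w" for w
    by (intro prod.cong) auto
  show "integrable wiener_space ?g"
    using integrable_distr[OF m, of ?g] i unfolding d r by simp
  have "integral\<^sup>L (distr wiener_space (PiM {..<N} ?M) (\<lambda>x. restrict x {..<N})) ?g = \<E> ?g"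
    by (subst integral_distr[OF m]) (use i in \<open>auto simp: r borel_measurable_integrable\<close>)
  then show "\<E> ?g = (\<Prod>i<N. integral\<^sup>L std_normal_distribution (f i))"
    unfolding d e by simp
qed

text \<open>A fixed range \<open>{..<N}\<close> replaces the support used by
  \<open>hermite_prod\<close>: changing one entry of \<open>k\<close> then never changes the index
  set.\<close>

definition hp :: "nat \<Rightarrow> (nat \<Rightarrow> nat) \<Rightarrow> (nat \<Rightarrow> real) \<Rightarrow> real" where
  "hp N k w = (\<Prod>i<N. poly (hermite (k i)) (w i))"

lemma integrable_hp: "integrable wiener_space (hp N k)"
  unfolding hp_def[abs_def] by (intro integrable_wiener_prod integrable_std_normal_poly)

lemma expectation_hp: "\<E> (hp N k) = (if \<forall>i<N. k i = 0 then 1 else 0)"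
  unfolding hp_def[abs_def]
  by (subst expectation_wiener_prod)
     (auto simp: integrable_std_normal_poly std_normal_hermite_expectation)

lemma hp_split: "i < N \<Longrightarrow> hp N k w = poly (hermite (k i)) (w i) * (\<Prod>j\<in>{..<N} - {i}. poly (hermite (k j)) (w j))"
  unfolding hp_def by (subst prod.remove[of _ i]) auto

text \<open>Updating \<open>k\<close> and \<open>w\<close> together serves two purposes: with
  \<open>x = w i\<close> it changes one degree, with \<open>n = k i\<close> it exhibits the product
  as a polynomial in the single coordinate \<open>i\<close>.\<close>

lemma hp_upd: "i < N \<Longrightarrow> hp N (k(i := n)) (fun_upd w i x) = poly (hermite n) x * (\<Prod>j\<in>{..<N} - {i}. poly (hermite (k j)) (w j))"
  by (subst hp_split[of i]) (auto intro!: prod.cong)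

lemma coord_hp:
  assumes "i < N"
  shows "w i * hp N k w = hp N (k(i := Suc (k i))) w + real (k i) * hp N (k(i := k i - 1)) w"
proof -
  let ?R = "\<Prod>j\<in>{..<N} - {i}. poly (hermite (k j)) (w j)"
  have u: "hp N (k(i := n)) w = poly (hermite n) (w i) * ?R" for n
    using hp_upd[OF assms, of k n w "w i"] by simp
  have "w i * hp N k w = (w i * poly (hermite (k i)) (w i)) * ?R"
    using u[of "k i"] by simp
  then show ?thesis
    unfolding u hermite_recurrence by (simp only: distrib_right mult.assoc)
qed

text \<open>Span of the Hermite products in the coordinates below \<open>N\<close> whose total degree lies in \<open>S\<close>:
  \<open>S = {m}\<close> gives the polynomials in the \<open>m\<close>-th chaos, \<open>S = UNIV\<close> all polynomials. Entries of the
  multi-index beyond \<open>N\<close> are ignored.\<close>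

inductive_set HP :: "nat \<Rightarrow> nat set \<Rightarrow> ((nat \<Rightarrow> real) \<Rightarrow> real) set" for N S where
  zero: "(\<lambda>w. 0) \<in> HP N S"
| step: "(\<Sum>i<N. k i) \<in> S \<Longrightarrow> F \<in> HP N S \<Longrightarrow> (\<lambda>w. c * hp N k w + F w) \<in> HP N S"

lemma HP_mono: "F \<in> HP N S \<Longrightarrow> S \<subseteq> T \<Longrightarrow> F \<in> HP N T"
  by (induction rule: HP.induct) (auto intro: HP.intros)

lemma HP_UNIV: "F \<in> HP N S \<Longrightarrow> F \<in> HP N UNIV"
  by (erule HP_mono) simp

lemma HP_add: "F \<in> HP N S \<Longrightarrow> G \<in> HP N S \<Longrightarrow> (\<lambda>w. F w + G w) \<in> HP N S"
proof (induction rule: HP.induct)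
  case (step k F c)
  then have "(\<lambda>w. c * hp N k w + (F w + G w)) \<in> HP N S"
    by (intro HP.step) auto
  then show ?case by (simp add: add.assoc)
qed simp

lemma HP_cmult: "F \<in> HP N S \<Longrightarrow> (\<lambda>w. a * F w) \<in> HP N S"
proof (induction rule: HP.induct)
  case zero
  show ?case using HP.zero by simp
next
  case (step k F c)
  then have "(\<lambda>w. (a * c) * hp N k w + a * F w) \<in> HP N S"
    by (intro HP.step) auto
  then show ?case by (simp add: algebra_simps)
qed

lemma HP_uminus: "F \<in> HP N S \<Longrightarrow> (\<lambda>w. - F w) \<in> HP N S"
  using HP_cmult[of F N S "-1"] by simp

lemma HP_diff: "F \<in> HP N S \<Longrightarrow> G \<in> HP N S \<Longrightarrow> (\<lambda>w. F w - G w) \<in> HP N S"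
  using HP_add[OF _ HP_uminus, of F N S G] by simp

lemma HP_sum: "(\<And>i. i \<in> A \<Longrightarrow> F i \<in> HP N S) \<Longrightarrow> (\<lambda>w. \<Sum>i\<in>A. F i w) \<in> HP N S"
  by (induction A rule: infinite_finite_induct) (auto intro: HP.zero HP_add)

lemma HP_hp: "(\<Sum>i<N. k i) \<in> S \<Longrightarrow> hp N k \<in> HP N S"
  using HP.step[OF _ HP.zero, of k N S 1] by simp

lemma HP_const: "0 \<in> S \<Longrightarrow> (\<lambda>w. a) \<in> HP N S"
  using HP_cmult[OF HP_hp[of "\<lambda>_. 0" N S], of a] by (simp add: hp_def)

lemma sum_fun_upd_Suc: "i < (N::nat) \<Longrightarrow> (\<Sum>j<N. (k(i := Suc (k i))) j) = Suc (\<Sum>j<N. k j)"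
  by (simp add: sum.remove[of "{..<N}" i])

lemma sum_fun_upd_pred: "i < (N::nat) \<Longrightarrow> (\<Sum>j<N. (k(i := k i - 1)) j) = (\<Sum>j<N. k j) - (if k i = 0 then 0 else 1 :: nat)"
  by (simp add: sum.remove[of "{..<N}" i] fun_upd_idem)

lemma HP_coord:
  assumes "F \<in> HP N {..d}" "i < N"
  shows "(\<lambda>w. w i * F w) \<in> HP N {..Suc d}"
  using assms(1)
proof (induction rule: HP.induct)
  case zero
  show ?case using HP.zero by simp
next
  case (step k F c)
  have "(\<lambda>w. c * hp N (k(i := Suc (k i))) w + (c * real (k i) * hp N (k(i := k i - 1)) w + w i * F w)) \<in> HP N {..Suc d}"
    using step assms(2) sum_fun_upd_pred[of i N k]
    by (intro HP.step) (auto simp: sum_fun_upd_Suc simp del: fun_upd_apply)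
  moreover have "c * hp N (k(i := Suc (k i))) w + (c * real (k i) * hp N (k(i := k i - 1)) w + w i * F w)
     = w i * (c * hp N k w + F w)" for w
    using coord_hp[OF assms(2), of w k] by (simp add: algebra_simps del: fun_upd_apply)
  ultimately show ?case by simp
qed

text \<open>Induction on the total degree, solving the three-term recurrence for its top term: H_k =
  x_i H_k1 - j H_k2. Thus only multiplication by a coordinate is needed, and no linearization
  formula for products of Hermite polynomials.\<close>

lemma HP_hp_mult:
  "X \<in> HP N {..b} \<Longrightarrow> (\<lambda>w. hp N k w * X w) \<in> HP N {..(\<Sum>i<N. k i) + b}"
proof (induction "\<Sum>i<N. k i" arbitrary: k rule: less_induct)
  case less
  show ?case
  proof (cases "\<exists>i<N. k i \<noteq> 0")
    case False
    then have "hp N k = (\<lambda>w. 1)" by (auto simp: hp_def)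
    with less.prems show ?thesis by (auto elim: HP_mono)
  next
    case True
    then obtain i j where i: "i < N" "k i = Suc j" using not0_implies_Suc by blast
    let ?n = "\<Sum>i<N. k i"
    define k1 where "k1 = k(i := j)"
    \<comment> \<open>For \<open>j = 0\<close> truncated subtraction makes this equal to
      \<open>k1\<close>; the corresponding term has coefficient 0, and a weak inequality between the
      degrees is enough.\<close>
    define k2 where "k2 = k(i := j - 1)"
    have n: "?n = Suc (\<Sum>i<N. k1 i)"
      using sum_fun_upd_Suc[OF i(1), of k1] i by (simp add: k1_def fun_upd_idem)
    have n2: "(\<Sum>i<N. k2 i) \<le> (\<Sum>i<N. k1 i)"
      by (intro sum_mono) (simp add: k1_def k2_def)
    have 1: "(\<lambda>w. hp N k1 w * X w) \<in> HP N {..(\<Sum>i<N. k1 i) + b}"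
      using n less.prems by (intro less.hyps) auto
    have 2: "(\<lambda>w. hp N k2 w * X w) \<in> HP N {..(\<Sum>i<N. k2 i) + b}"
      using n n2 less.prems by (intro less.hyps) auto
    have "(\<lambda>w. w i * (hp N k1 w * X w) - real j * (hp N k2 w * X w)) \<in> HP N {..?n + b}"
      using HP_coord[OF 1 i(1)] HP_mono[OF 2, of "{..?n + b}"] n n2 by (intro HP_diff HP_cmult) auto
    moreover have "w i * hp N k1 w = hp N k w + real j * hp N k2 w" for w
      using coord_hp[OF i(1), of w k1] i(2) by (simp add: k1_def k2_def fun_upd_idem)
    then have "w i * (hp N k1 w * X w) - real j * (hp N k2 w * X w) = hp N k w * X w" for w
      by (simp add: mult.assoc[symmetric] distrib_right)
    ultimately show ?thesis by simp
  qed
qed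

lemma HP_mult_le:
  assumes "F \<in> HP N {..a}" "X \<in> HP N {..b}"
  shows "(\<lambda>w. F w * X w) \<in> HP N {..a + b}"
  using assms(1)
proof (induction rule: HP.induct)
  case zero
  show ?case using HP.zero by simp
next
  case (step k F c)
  have "(\<lambda>w. c * (hp N k w * X w) + F w * X w) \<in> HP N {..a + b}"
    using step HP_mono[OF HP_hp_mult[OF assms(2), of k], of "{..a + b}"]
    by (intro HP_add HP_cmult) auto
  then show ?case by (simp add: algebra_simps)
qed

lemma HP_bounded_degree: "F \<in> HP N S \<Longrightarrow> \<exists>d. F \<in> HP N {..d}"
proof (induction rule: HP.induct)
  case (step k F c)
  then obtain d where "F \<in> HP N {..d}" by blast
  then have "(\<lambda>w. c * hp N k w + F w) \<in> HP N {..max d (\<Sum>i<N. k i)}"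
    by (intro HP.step) (auto elim: HP_mono)
  then show ?case by blast
qed (auto intro: HP.zero)

lemma HP_mult:
  assumes "F \<in> HP N S" "X \<in> HP N T"
  shows "(\<lambda>w. F w * X w) \<in> HP N UNIV"
proof -
  obtain a b where "F \<in> HP N {..a}" "X \<in> HP N {..b}"
    using assms HP_bounded_degree by blast
  from HP_mult_le[OF this] show ?thesis by (rule HP_UNIV)
qed

lemma HP_power: "F \<in> HP N {..d} \<Longrightarrow> (\<lambda>w. F w ^ n) \<in> HP N {..n * d}"
proof (induction n)
  case (Suc n)
  then show ?case using HP_mult_le[of F N d "\<lambda>w. F w ^ n" "n * d"] by simp
qed (simp add: HP_const)

lemma HP_power_UNIV: "F \<in> HP N S \<Longrightarrow> (\<lambda>w. F w ^ n) \<in> HP N UNIV"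
  using HP_bounded_degree HP_power HP_UNIV by blast

lemma HP_poly:
  assumes "F \<in> HP N {..d}"
  shows "(\<lambda>w. poly q (F w)) \<in> HP N {..degree q * d}"
  unfolding poly_altdef
  by (intro HP_sum HP_cmult HP_mono[OF HP_power[OF assms]]) auto

lemma HP_poly_UNIV: "F \<in> HP N S \<Longrightarrow> (\<lambda>w. poly q (F w)) \<in> HP N UNIV"
  using HP_bounded_degree HP_poly HP_UNIV by blast

lemma HP_coord_UNIV: "F \<in> HP N S \<Longrightarrow> i < N \<Longrightarrow> (\<lambda>w. w i * F w) \<in> HP N UNIV"
  using HP_bounded_degree HP_coord HP_UNIV by blast

lemma HP_integrable: "F \<in> HP N S \<Longrightarrow> integrable wiener_space F"
  by (induction rule: HP.induct)
     (auto intro!: Bochner_Integration.integrable_add integrable_mult_right integrable_hp)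

section \<open>Partial derivatives and Gaussian integration by parts\<close>

definition pd :: "nat \<Rightarrow> ((nat \<Rightarrow> real) \<Rightarrow> real) \<Rightarrow> (nat \<Rightarrow> real) \<Rightarrow> real" where
  "pd i F w = deriv (\<lambda>x. F (fun_upd w i x)) (w i)"

lemma has_pd_hp:
  assumes "i < N"
  shows "((\<lambda>x. hp N k (fun_upd w i x)) has_field_derivative real (k i) * hp N (k(i := k i - 1)) w) (at (w i))"
proof -
  let ?R = "\<Prod>j\<in>{..<N} - {i}. poly (hermite (k j)) (w j)"
  have "hp N (k(i := k i - 1)) w = poly (hermite (k i - 1)) (w i) * ?R"
    using hp_upd[OF assms, of k "k i - 1" w "w i"] by simp
  moreover have "(\<lambda>x. hp N k (fun_upd w i x)) = (\<lambda>x. poly (hermite (k i)) x * ?R)"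
    using hp_upd[OF assms, of k "k i" w] by (simp only: fun_upd_triv)
  moreover have "((\<lambda>x. poly (hermite (k i)) x * ?R) has_field_derivative
      poly (pderiv (hermite (k i))) (w i) * ?R) (at (w i))"
    by (intro DERIV_cmult_right poly_DERIV)
  ultimately show ?thesis by (simp add: pderiv_hermite mult.assoc)
qed

lemma pd_hp: "i < N \<Longrightarrow> pd i (hp N k) = (\<lambda>w. real (k i) * hp N (k(i := k i - 1)) w)"
  unfolding pd_def by (intro ext DERIV_imp_deriv has_pd_hp)

lemma pd_zero: "pd i (\<lambda>w. c) = (\<lambda>w. 0)"
  by (simp add: pd_def fun_eq_iff)

text \<open>\<open>pd\<close> is built on the total function \<open>deriv\<close>, so membership in
  \<open>HP\<close> has to supply differentiability; the product and chain rules rest on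
  this.\<close>

lemma HP_has_pd:
  assumes "F \<in> HP N S" "i < N"
  shows "((\<lambda>x. F (fun_upd w i x)) has_field_derivative pd i F w) (at (w i))"
  using assms(1)
proof (induction rule: HP.induct)
  case (step k F c)
  have "((\<lambda>x. c * hp N k (fun_upd w i x) + F (fun_upd w i x)) has_field_derivative
     c * pd i (hp N k) w + pd i F w) (at (w i))"
    unfolding pd_hp[OF assms(2)] by (intro DERIV_add DERIV_cmult has_pd_hp assms(2) step.IH)
  then show ?case
    unfolding pd_def by (subst DERIV_imp_deriv) auto
qed (simp add: pd_zero)

lemma pd_add: "F \<in> HP N S \<Longrightarrow> G \<in> HP N T \<Longrightarrow> i < N \<Longrightarrow> pd i (\<lambda>w. F w + G w) = (\<lambda>w. pd i F w + pd i G w)"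
  by (intro ext, unfold pd_def[of i "\<lambda>w. F w + G w"], rule DERIV_imp_deriv)
     (intro DERIV_add HP_has_pd)

lemma pd_mult: "F \<in> HP N S \<Longrightarrow> G \<in> HP N T \<Longrightarrow> i < N \<Longrightarrow>
    pd i (\<lambda>w. F w * G w) = (\<lambda>w. pd i F w * G w + F w * pd i G w)"
proof (intro ext)
  fix w
  assume "F \<in> HP N S" "G \<in> HP N T" "i < N"
  from DERIV_mult[OF HP_has_pd[OF this(1,3), of w] HP_has_pd[OF this(2,3), of w]]
  show "pd i (\<lambda>w. F w * G w) w = pd i F w * G w + F w * pd i G w"
    unfolding pd_def[of i "\<lambda>w. F w * G w"] by (subst DERIV_imp_deriv) (auto simp: mult.commute)
qed

lemma pd_cmult: "F \<in> HP N S \<Longrightarrow> i < N \<Longrightarrow> pd i (\<lambda>w. c * F w) = (\<lambda>w. c * pd i F w)"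
  using pd_mult[where F = "\<lambda>w. c" and S = UNIV and N = N, OF HP_const] by (simp add: pd_zero)

lemma pd_poly:
  assumes "F \<in> HP N S" "i < N"
  shows "pd i (\<lambda>w. poly q (F w)) = (\<lambda>w. poly (pderiv q) (F w) * pd i F w)"
proof (intro ext)
  fix w
  have "((\<lambda>x. poly q (F (fun_upd w i x))) has_field_derivative
      poly (pderiv q) (F (fun_upd w i (w i))) * pd i F w) (at (w i))"
    by (rule DERIV_chain2[OF poly_DERIV HP_has_pd[OF assms]])
  then show "pd i (\<lambda>w. poly q (F w)) w = poly (pderiv q) (F w) * pd i F w"
    unfolding pd_def[of i "\<lambda>w. poly q (F w)"] by (subst DERIV_imp_deriv) auto
qed

lemma pd_step:
  assumes "F \<in> HP N S" "i < N"
  shows "pd i (\<lambda>w. c * hp N k w + F w) = (\<lambda>w. c * pd i (hp N k) w + pd i F w)"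
proof -
  have "hp N k \<in> HP N UNIV" by (rule HP_hp) simp
  then show ?thesis
    using pd_add[OF HP_cmult assms, of "hp N k" UNIV c] pd_cmult[OF _ assms(2), of "hp N k" UNIV c] by simp
qed

text \<open>A derivative in one coordinate lowers the Hermite degree of a product by exactly one or
  kills the product. The free target \<open>T\<close> covers both the passage from
  \<open>{Suc n}\<close> to \<open>{n}\<close> and the case \<open>UNIV\<close>.\<close>

lemma HP_pd_gen:
  assumes "F \<in> HP N S" "i < N" and T: "\<And>n. Suc n \<in> S \<Longrightarrow> n \<in> T"
  shows "pd i F \<in> HP N T"
  using assms(1)
proof (induction rule: HP.induct)
  case zero
  show ?case by (simp add: pd_zero HP.zero)
next
  case (step k F c)
  have "pd i (hp N k) \<in> HP N T"
  proof (cases "k i = 0")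
    case True
    then show ?thesis by (simp add: pd_hp[OF assms(2)] HP.zero)
  next
    case False
    then have "(\<Sum>j<N. k j) = Suc (\<Sum>j<N. (k(i := k i - 1)) j)"
      using sum_fun_upd_pred[OF assms(2), of k] sum_fun_upd_Suc[OF assms(2), of "k(i := k i - 1)"]
      by (simp add: fun_upd_idem del: fun_upd_apply) (simp add: fun_upd_idem)
    then show ?thesis
      using step T unfolding pd_hp[OF assms(2)] by (intro HP_cmult HP_hp) metis
  qed
  then have "(\<lambda>w. c * pd i (hp N k) w + pd i F w) \<in> HP N T"
    using step by (intro HP_add HP_cmult)
  moreover have "pd i (\<lambda>w. c * hp N k w + F w) = (\<lambda>w. c * pd i (hp N k) w + pd i F w)"
    by (rule pd_step[OF step.hyps(2) assms(2)])
  ultimately show ?case by simp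
qed

lemma HP_pd: "F \<in> HP N S \<Longrightarrow> i < N \<Longrightarrow> pd i F \<in> HP N UNIV"
  by (rule HP_pd_gen) auto

text \<open>By linearity Hermite products suffice: in the three-term recurrence the raised term has
  mean 0 and the lowered term is exactly the derivative.\<close>

lemma expectation_pd:
  assumes "F \<in> HP N S" "i < N"
  shows "\<E> (pd i F) = \<E> (\<lambda>w. w i * F w)"
  using assms(1)
proof (induction rule: HP.induct)
  case zero
  show ?case by (simp add: pd_zero)
next
  case (step k F c)
  have i: "integrable wiener_space (pd i F)" "integrable wiener_space (\<lambda>w. w i * F w)"
    using step.hyps HP_pd HP_coord_UNIV assms(2) by (blast intro: HP_integrable)+
  have "\<E> (hp N (k(i := Suc (k i)))) = 0"
    unfolding expectation_hp using assms(2) by auto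
  then have "\<E> (\<lambda>w. w i * hp N k w) = \<E> (pd i (hp N k))"
    unfolding coord_hp[OF assms(2)] pd_hp[OF assms(2)] by (simp add: integrable_hp)
  moreover have "integrable wiener_space (pd i (hp N k))" "integrable wiener_space (\<lambda>w. w i * hp N k w)"
    unfolding coord_hp[OF assms(2)] pd_hp[OF assms(2)]
    by (auto intro!: Bochner_Integration.integrable_add integrable_mult_right integrable_hp)
  moreover have "w i * (c * hp N k w + F w) = c * (w i * hp N k w) + w i * F w" for w
    by (simp add: algebra_simps)
  ultimately show ?case
    using step.IH i by (simp add: pd_step[OF step.hyps(2) assms(2)])
qed

section \<open>The space \<open>L\<^sup>2\<close> and the generator on polynomials\<close>

lemma L2_spaceI: "F \<in> borel_measurable wiener_space \<Longrightarrow> integrable wiener_space (\<lambda>w. (F w)\<^sup>2) \<Longrightarrow> F \<in> L2_space"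
  by (simp add: L2_space_def)

lemma L2_space_measurable [measurable_dest]: "F \<in> L2_space \<Longrightarrow> F \<in> borel_measurable wiener_space"
  by (simp add: L2_space_def)

lemma L2_space_integrable_square: "F \<in> L2_space \<Longrightarrow> integrable wiener_space (\<lambda>w. (F w)\<^sup>2)"
  by (simp add: L2_space_def)

lemma L2_integrable_mult:
  assumes "F \<in> L2_space" "G \<in> L2_space"
  shows "integrable wiener_space (\<lambda>w. F w * G w)"
proof (rule Bochner_Integration.integrable_bound)
  show "integrable wiener_space (\<lambda>w. (F w)\<^sup>2 + (G w)\<^sup>2)"
    using assms by (intro Bochner_Integration.integrable_add L2_space_integrable_square)
  show "(\<lambda>w. F w * G w) \<in> borel_measurable wiener_space"
    using assms by measurable
  show "AE w in wiener_space. norm (F w * G w) \<le> norm ((F w)\<^sup>2 + (G w)\<^sup>2)"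
  proof (rule AE_I2)
    fix w
    have "0 \<le> (\<bar>F w\<bar> - \<bar>G w\<bar>)\<^sup>2" by simp
    then have "2 * (\<bar>F w\<bar> * \<bar>G w\<bar>) \<le> (F w)\<^sup>2 + (G w)\<^sup>2" by (simp add: power2_diff)
    moreover have "0 \<le> \<bar>F w\<bar> * \<bar>G w\<bar>" by simp
    ultimately show "norm (F w * G w) \<le> norm ((F w)\<^sup>2 + (G w)\<^sup>2)"
      using abs_ge_self[of "(F w)\<^sup>2 + (G w)\<^sup>2"] unfolding real_norm_def abs_mult by linarith
  qed
qed

lemma L2_const: "(\<lambda>w. c) \<in> L2_space"
  by (auto intro!: L2_spaceI)

lemma L2_integrable: "F \<in> L2_space \<Longrightarrow> integrable wiener_space F"
  using L2_integrable_mult[OF _ L2_const[of 1]] by simp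

lemma L2_cmult: "F \<in> L2_space \<Longrightarrow> (\<lambda>w. c * F w) \<in> L2_space"
  by (auto intro!: L2_spaceI simp: power_mult_distrib dest: L2_space_integrable_square)

lemma L2_add:
  assumes "F \<in> L2_space" "G \<in> L2_space"
  shows "(\<lambda>w. F w + G w) \<in> L2_space"
  using assms L2_integrable_mult[OF assms]
  by (auto intro!: L2_spaceI Bochner_Integration.integrable_add
      simp: power2_sum mult.assoc dest: L2_space_integrable_square)

lemma L2_diff: "F \<in> L2_space \<Longrightarrow> G \<in> L2_space \<Longrightarrow> (\<lambda>w. F w - G w) \<in> L2_space"
  using L2_add[OF _ L2_cmult[of G "-1"]] by simp

lemma L2_sum: "(\<And>i. i \<in> A \<Longrightarrow> F i \<in> L2_space) \<Longrightarrow> (\<lambda>w. \<Sum>i\<in>A. F i w) \<in> L2_space"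
  by (induction A rule: infinite_finite_induct) (auto intro: L2_const L2_add)

lemma L2_norm_nonneg: "0 \<le> L2_norm F"
  by (simp add: L2_norm_def)

lemma L2_norm_square: "(L2_norm F)\<^sup>2 = \<E> (\<lambda>w. (F w)\<^sup>2)"
  by (simp add: L2_norm_def)

lemma L2_norm_cmult: "L2_norm (\<lambda>w. c * F w) = \<bar>c\<bar> * L2_norm F"
  by (simp add: L2_norm_def power_mult_distrib real_sqrt_mult)

lemma L2_norm_minus_commute: "L2_norm (\<lambda>w. F w - G w) = L2_norm (\<lambda>w. G w - F w)"
  by (simp add: L2_norm_def power2_commute)

lemma L2_norm_zero [simp]: "L2_norm (\<lambda>w. 0) = 0"
  by (simp add: L2_norm_def)

lemma L2_Cauchy_Schwarz:
  assumes "F \<in> L2_space" "G \<in> L2_space"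
  shows "\<bar>\<E> (\<lambda>w. F w * G w)\<bar> \<le> L2_norm F * L2_norm G"
proof -
  let ?a = "\<E> (\<lambda>w. (F w)\<^sup>2)" and ?b = "\<E> (\<lambda>w. F w * G w)" and ?c = "\<E> (\<lambda>w. (G w)\<^sup>2)"
  note i = L2_space_integrable_square[OF assms(1)] L2_space_integrable_square[OF assms(2)] L2_integrable_mult[OF assms]
  have q: "0 \<le> x\<^sup>2 * ?a + 2 * x * y * ?b + y\<^sup>2 * ?c" for x y
  proof -
    have "0 \<le> \<E> (\<lambda>w. (x * F w + y * G w)\<^sup>2)" by simp
    also have "(\<lambda>w. (x * F w + y * G w)\<^sup>2) = (\<lambda>w. x\<^sup>2 * (F w)\<^sup>2 + 2 * x * y * (F w * G w) + y\<^sup>2 * (G w)\<^sup>2)"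
      by (simp add: fun_eq_iff power2_eq_square algebra_simps)
    finally show ?thesis using i by simp
  qed
  have "?b\<^sup>2 \<le> ?a * ?c"
  proof (cases "?a = 0")
    case True
    have "?b = 0"
    proof (rule ccontr)
      assume "?b \<noteq> 0"
      \<comment> \<open>With \<open>?a = 0\<close> the quadratic form takes the value -1 at this
        point.\<close>
      with q[of "- (?c + 1) / (2 * ?b)" 1] True show False by (simp add: field_simps)
    qed
    then show ?thesis by (simp add: True)
  next
    case False
    then have "?a > 0" by (simp add: less_le)
    moreover have "0 \<le> ?a * (?a * ?c - ?b\<^sup>2)"
      using q[of "- ?b" ?a] by (simp add: power2_eq_square algebra_simps)
    ultimately show ?thesis by (simp add: zero_le_mult_iff)
  qed
  then have "sqrt (?b\<^sup>2) \<le> sqrt (?a * ?c)" by (rule real_sqrt_le_mono)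
  then show ?thesis by (simp add: L2_norm_def real_sqrt_mult)
qed

lemma L2_norm_triangle:
  assumes "F \<in> L2_space" "G \<in> L2_space"
  shows "L2_norm (\<lambda>w. F w + G w) \<le> L2_norm F + L2_norm G"
proof (rule power2_le_imp_le)
  note i = L2_space_integrable_square[OF assms(1)] L2_space_integrable_square[OF assms(2)] L2_integrable_mult[OF assms]
  have "(L2_norm (\<lambda>w. F w + G w))\<^sup>2 = \<E> (\<lambda>w. (F w)\<^sup>2 + (G w)\<^sup>2 + 2 * (F w * G w))"
    by (simp add: L2_norm_square power2_sum mult.assoc)
  also have "\<dots> = (L2_norm F)\<^sup>2 + (L2_norm G)\<^sup>2 + 2 * \<E> (\<lambda>w. F w * G w)"
    using i by (simp add: L2_norm_square)
  also have "\<dots> \<le> (L2_norm F + L2_norm G)\<^sup>2"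
    using L2_Cauchy_Schwarz[OF assms] by (simp add: power2_sum)
  finally show "(L2_norm (\<lambda>w. F w + G w))\<^sup>2 \<le> (L2_norm F + L2_norm G)\<^sup>2" .
qed (simp add: L2_norm_nonneg)

lemma L2_norm_triangle_diff:
  assumes "F \<in> L2_space" "G \<in> L2_space"
  shows "L2_norm (\<lambda>w. F w - G w) \<le> L2_norm F + L2_norm G"
  using L2_norm_triangle[OF assms(1) L2_cmult[OF assms(2), of "-1"]] L2_norm_cmult[of "-1" G] by simp

lemma L2_norm_triangle3:
  assumes "F \<in> L2_space" "G \<in> L2_space" "K \<in> L2_space"
  shows "L2_norm (\<lambda>w. F w - K w) \<le> L2_norm (\<lambda>w. F w - G w) + L2_norm (\<lambda>w. G w - K w)"
  using L2_norm_triangle[OF L2_diff[OF assms(1,2)] L2_diff[OF assms(2,3)]] by simp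

lemma L2_norm_sum:
  assumes "\<And>i. i \<in> A \<Longrightarrow> F i \<in> L2_space"
  shows "L2_norm (\<lambda>w. \<Sum>i\<in>A. F i w) \<le> (\<Sum>i\<in>A. L2_norm (F i))"
  using assms
proof (induction A rule: infinite_finite_induct)
  case (insert i A)
  then have "L2_norm (\<lambda>w. F i w + (\<Sum>i\<in>A. F i w)) \<le> L2_norm (F i) + L2_norm (\<lambda>w. \<Sum>i\<in>A. F i w)"
    by (intro L2_norm_triangle L2_sum) auto
  with insert show ?case by simp
qed auto

lemma L2_norm_cong_AE:
  assumes "AE w in wiener_space. F w = G w" "F \<in> borel_measurable wiener_space" "G \<in> borel_measurable wiener_space"
  shows "L2_norm F = L2_norm G"
proof -
  have "\<E> (\<lambda>w. (F w)\<^sup>2) = \<E> (\<lambda>w. (G w)\<^sup>2)"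
    using assms by (intro integral_cong_AE) auto
  then show ?thesis by (simp add: L2_norm_def)
qed

lemma L2_norm_eq_0_iff:
  assumes "F \<in> L2_space"
  shows "L2_norm F = 0 \<longleftrightarrow> (AE w in wiener_space. F w = 0)"
  using integral_nonneg_eq_0_iff_AE[OF L2_space_integrable_square[OF assms]]
  by (simp add: L2_norm_def)

lemma HP_L2: "F \<in> HP N S \<Longrightarrow> F \<in> L2_space"
  using HP_integrable[OF HP_mult[of F N S F S]] HP_integrable[of F N S]
  by (auto intro!: L2_spaceI simp: power2_eq_square)

text \<open>Written as a differential operator, so that product and chain rules are plain calculus;
  the spectral form used by \<open>OU_gen\<close> is recovered through
  \<open>LL_eigen\<close>.\<close>

definition LL :: "nat \<Rightarrow> ((nat \<Rightarrow> real) \<Rightarrow> real) \<Rightarrow> (nat \<Rightarrow> real) \<Rightarrow> real" where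
  "LL N F w = (\<Sum>i<N. pd i (pd i F) w - w i * pd i F w)"

definition Gm :: "nat \<Rightarrow> ((nat \<Rightarrow> real) \<Rightarrow> real) \<Rightarrow> ((nat \<Rightarrow> real) \<Rightarrow> real) \<Rightarrow> (nat \<Rightarrow> real) \<Rightarrow> real" where
  "Gm N F X w = (\<Sum>i<N. pd i F w * pd i X w)"

lemma HP_LL: "F \<in> HP N S \<Longrightarrow> LL N F \<in> HP N UNIV"
  unfolding LL_def[abs_def] by (intro HP_sum HP_diff HP_coord_UNIV[where S = UNIV] HP_pd[where S = UNIV]) (auto intro: HP_UNIV)

lemma HP_Gm: "F \<in> HP N S \<Longrightarrow> X \<in> HP N T \<Longrightarrow> Gm N F X \<in> HP N UNIV"
  unfolding Gm_def[abs_def] by (intro HP_sum HP_mult[where S = UNIV and T = UNIV] HP_pd[where S = UNIV]) (auto intro: HP_UNIV)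

lemmas PA_intros = HP_add[of _ _ UNIV] HP_diff[of _ _ UNIV] HP_mult[of _ _ UNIV _ UNIV]
  HP_power_UNIV[of _ _ UNIV] HP_poly_UNIV[of _ _ UNIV] HP_pd[of _ _ UNIV]
  HP_const[of UNIV, OF UNIV_I] HP_sum[of _ _ _ UNIV] HP_LL[of _ _ UNIV] HP_Gm[of _ _ UNIV _ UNIV]

lemma Gm_commute: "Gm N F X = Gm N X F"
  by (simp add: Gm_def fun_eq_iff mult.commute)

lemma LL_step:
  assumes "F \<in> HP N S"
  shows "LL N (\<lambda>w. c * hp N k w + F w) = (\<lambda>w. c * LL N (hp N k) w + LL N F w)"
proof
  fix w
  have h: "hp N k \<in> HP N UNIV" by (rule HP_hp) simp
  have "pd i (\<lambda>w. c * pd i (hp N k) w + pd i F w) = (\<lambda>w. c * pd i (pd i (hp N k)) w + pd i (pd i F) w)" if "i < N" for i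
    using pd_add[OF HP_cmult[OF HP_pd[OF h that]] HP_pd[OF assms that] that]
        pd_cmult[OF HP_pd[OF h that] that] by simp
  then have "LL N (\<lambda>w. c * hp N k w + F w) w
     = (\<Sum>i<N. c * (pd i (pd i (hp N k)) w - w i * pd i (hp N k) w) + (pd i (pd i F) w - w i * pd i F w))"
    unfolding LL_def by (intro sum.cong refl) (simp only: lessThan_iff pd_step[OF assms], simp add: algebra_simps)
  then show "LL N (\<lambda>w. c * hp N k w + F w) w = c * LL N (hp N k) w + LL N F w"
    by (simp add: LL_def sum.distrib sum_distrib_left)
qed

text \<open>Each coordinate contributes the eigenvalue \<open>- real (k i)\<close> of the
  one-dimensional operator, and the eigenvalues add up.\<close>

lemma LL_hp: "LL N (hp N k) w = - real (\<Sum>i<N. k i) * hp N k w"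
proof -
  have "pd i (pd i (hp N k)) w - w i * pd i (hp N k) w = - real (k i) * hp N k w" if i: "i < N" for i
  proof (cases "k i")
    case 0
    then show ?thesis by (simp add: pd_hp[OF i] pd_zero)
  next
    case (Suc n)
    have h: "hp N k' \<in> HP N UNIV" for k' by (rule HP_hp) simp
    have "w i * hp N (k(i := n)) w = hp N k w + real n * hp N (k(i := n - 1)) w"
      using coord_hp[OF i, of w "k(i := n)"] Suc by (simp add: fun_upd_idem)
    then have "w i * ((1 + real n) * hp N (k(i := n)) w)
       = (1 + real n) * (hp N k w + real n * hp N (k(i := n - 1)) w)"
      by (metis mult.left_commute)
    then show ?thesis by (simp only: pd_hp[OF i] pd_cmult[OF h i]) (simp add: Suc algebra_simps)
  qed
  then have "LL N (hp N k) w = (\<Sum>i<N. - real (k i) * hp N k w)"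
    unfolding LL_def by (intro sum.cong) auto
  then show ?thesis by (simp add: sum_distrib_right sum_negf)
qed

lemma LL_eigen: "F \<in> HP N {m} \<Longrightarrow> LL N F = (\<lambda>w. - real m * F w)"
proof (induction rule: HP.induct)
  case zero
  show ?case by (simp add: LL_def pd_zero)
next
  case (step k F c)
  have "LL N (hp N k) = (\<lambda>w. - real m * hp N k w)"
    using LL_hp step.hyps(1) by (simp add: fun_eq_iff del: of_nat_sum)
  then show ?case by (simp only: LL_step[OF step.hyps(2)] step.IH) (simp add: algebra_simps)
qed

lemma LL_mult:
  assumes "F \<in> HP N S" "X \<in> HP N T"
  shows "LL N (\<lambda>w. F w * X w) = (\<lambda>w. F w * LL N X w + X w * LL N F w + 2 * Gm N F X w)"
proof
  fix w
  have 2: "pd i (pd i (\<lambda>w. F w * X w)) w = pd i (pd i F) w * X w + 2 * (pd i F w * pd i X w) + F w * pd i (pd i X) w"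
    if i: "i < N" for i
    unfolding pd_mult[OF assms i] pd_add[OF HP_mult[OF HP_pd[OF assms(1) i] assms(2)] HP_mult[OF assms(1) HP_pd[OF assms(2) i]] i]
      pd_mult[OF HP_pd[OF assms(1) i] assms(2) i] pd_mult[OF assms(1) HP_pd[OF assms(2) i] i]
    by simp
  have "LL N (\<lambda>w. F w * X w) w = (\<Sum>i<N. F w * (pd i (pd i X) w - w i * pd i X w) +
      X w * (pd i (pd i F) w - w i * pd i F w) + 2 * (pd i F w * pd i X w))"
    unfolding LL_def by (intro sum.cong refl) (simp only: lessThan_iff 2, simp only: pd_mult[OF assms], simp add: algebra_simps)
  then show "LL N (\<lambda>w. F w * X w) w = F w * LL N X w + X w * LL N F w + 2 * Gm N F X w"
    by (simp add: LL_def Gm_def sum.distrib sum_distrib_left)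
qed

text \<open>Chain rule for a second-order operator: the squares of first derivatives assemble into
  \<open>Gm\<close>. This is the origin of the factor H_k''(F).\<close>

lemma LL_poly:
  assumes "F \<in> HP N S"
  shows "LL N (\<lambda>w. poly q (F w)) = (\<lambda>w. poly (pderiv q) (F w) * LL N F w + poly (pderiv (pderiv q)) (F w) * Gm N F F w)"
proof
  fix w
  have 2: "pd i (pd i (\<lambda>w. poly q (F w))) w = poly (pderiv (pderiv q)) (F w) * (pd i F w * pd i F w) + poly (pderiv q) (F w) * pd i (pd i F) w"
    if i: "i < N" for i
    unfolding pd_poly[OF assms i] pd_mult[OF HP_poly_UNIV[OF assms] HP_pd[OF assms i] i]
    by simp
  have "LL N (\<lambda>w. poly q (F w)) w = (\<Sum>i<N. poly (pderiv q) (F w) * (pd i (pd i F) w - w i * pd i F w) +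
      poly (pderiv (pderiv q)) (F w) * (pd i F w * pd i F w))"
    unfolding LL_def by (intro sum.cong refl) (simp only: lessThan_iff 2, simp only: pd_poly[OF assms], simp add: algebra_simps)
  then show "LL N (\<lambda>w. poly q (F w)) w = poly (pderiv q) (F w) * LL N F w + poly (pderiv (pderiv q)) (F w) * Gm N F F w"
    by (simp add: LL_def Gm_def sum.distrib sum_distrib_left)
qed

lemma Gm_poly:
  assumes "F \<in> HP N S"
  shows "Gm N F (\<lambda>w. poly q (F w)) = (\<lambda>w. poly (pderiv q) (F w) * Gm N F F w)"
  by (auto simp: Gm_def fun_eq_iff pd_poly[OF assms] sum_distrib_left mult_ac)

lemma Gm_mult:
  assumes "F \<in> HP N S" "X \<in> HP N T"
  shows "Gm N G (\<lambda>w. F w * X w) = (\<lambda>w. F w * Gm N G X w + X w * Gm N G F w)"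
proof
  fix w
  have "Gm N G (\<lambda>w. F w * X w) w = (\<Sum>i<N. F w * (pd i G w * pd i X w) + X w * (pd i G w * pd i F w))"
    unfolding Gm_def by (intro sum.cong refl) (simp only: lessThan_iff pd_mult[OF assms], simp add: algebra_simps)
  then show "Gm N G (\<lambda>w. F w * X w) w = F w * Gm N G X w + X w * Gm N G F w"
    by (simp add: Gm_def sum.distrib sum_distrib_left)
qed

text \<open>\<open>expectation_pd\<close> applied to \<open>X * pd i F\<close>, coordinate by
  coordinate. It makes \<open>LL\<close> symmetric, with \<open>Gm\<close> as the density of its
  Dirichlet form.\<close>

lemma expectation_LL:
  assumes "F \<in> HP N S" "X \<in> HP N T"
  shows "\<E> (\<lambda>w. X w * LL N F w) = - \<E> (Gm N X F)"
proof -
  note F = HP_UNIV[OF assms(1)] and X = HP_UNIV[OF assms(2)]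
  have e: "\<E> (\<lambda>w. X w * (pd i (pd i F) w - w i * pd i F w)) = - \<E> (\<lambda>w. pd i X w * pd i F w)" if i: "i < N" for i
  proof -
    have "\<E> (pd i (\<lambda>w. X w * pd i F w)) = \<E> (\<lambda>w. w i * (X w * pd i F w))"
      by (intro expectation_pd[where N = N and S = UNIV] PA_intros F X i)
    also have "pd i (\<lambda>w. X w * pd i F w) = (\<lambda>w. pd i X w * pd i F w + X w * pd i (pd i F) w)"
      by (rule pd_mult[OF X HP_pd[OF F i] i])
    also have "\<E> \<dots> = \<E> (\<lambda>w. pd i X w * pd i F w) + \<E> (\<lambda>w. X w * pd i (pd i F) w)"
      by (intro Bochner_Integration.integral_add HP_integrable[where N = N and S = UNIV] PA_intros F X i)
    finally have 1: "\<E> (\<lambda>w. w i * (X w * pd i F w)) = \<E> (\<lambda>w. pd i X w * pd i F w) + \<E> (\<lambda>w. X w * pd i (pd i F) w)" ..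
    have "\<E> (\<lambda>w. X w * (pd i (pd i F) w - w i * pd i F w)) = \<E> (\<lambda>w. X w * pd i (pd i F) w - w i * (X w * pd i F w))"
      by (simp add: algebra_simps)
    also have "\<dots> = \<E> (\<lambda>w. X w * pd i (pd i F) w) - \<E> (\<lambda>w. w i * (X w * pd i F w))"
      by (intro Bochner_Integration.integral_diff HP_integrable[where N = N and S = UNIV]
          HP_coord_UNIV[where S = UNIV] PA_intros F X i)
    finally show ?thesis using 1 by simp
  qed
  have "\<E> (\<lambda>w. X w * LL N F w) = \<E> (\<lambda>w. \<Sum>i<N. X w * (pd i (pd i F) w - w i * pd i F w))"
    by (simp add: LL_def sum_distrib_left)
  also have "\<dots> = (\<Sum>i<N. \<E> (\<lambda>w. X w * (pd i (pd i F) w - w i * pd i F w)))"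
    by (intro Bochner_Integration.integral_sum HP_integrable[where N = N and S = UNIV]
          HP_coord_UNIV[where S = UNIV] PA_intros F X) auto
  also have "\<dots> = - (\<Sum>i<N. \<E> (\<lambda>w. pd i X w * pd i F w))"
    by (simp add: e sum_negf)
  also have "(\<Sum>i<N. \<E> (\<lambda>w. pd i X w * pd i F w)) = \<E> (\<lambda>w. \<Sum>i<N. pd i X w * pd i F w)"
    by (intro Bochner_Integration.integral_sum[symmetric] HP_integrable[where N = N and S = UNIV]
          HP_coord_UNIV[where S = UNIV] PA_intros F X) auto
  finally show ?thesis by (simp add: Gm_def[abs_def])
qed

lemma LL_symmetric:
  assumes "F \<in> HP N S" "X \<in> HP N T"
  shows "\<E> (\<lambda>w. X w * LL N F w) = \<E> (\<lambda>w. F w * LL N X w)"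
  using expectation_LL[OF assms] expectation_LL[OF assms(2,1)] by (simp add: Gm_commute)

text \<open>Eigenvectors of a symmetric operator for different eigenvalues.\<close>

lemma HP_orthogonal:
  assumes "F \<in> HP N {m}" "X \<in> HP N {n}" "m \<noteq> n"
  shows "\<E> (\<lambda>w. F w * X w) = 0"
proof -
  have "\<E> (\<lambda>w. X w * LL N F w) = - real m * \<E> (\<lambda>w. F w * X w)"
    unfolding LL_eigen[OF assms(1)] by (subst integral_mult_right_zero[symmetric]) (simp add: mult_ac)
  moreover have "\<E> (\<lambda>w. F w * LL N X w) = - real n * \<E> (\<lambda>w. F w * X w)"
    unfolding LL_eigen[OF assms(2)] by (subst integral_mult_right_zero[symmetric]) (simp add: mult_ac)
  ultimately show ?thesis
    using LL_symmetric[OF assms(1,2)] assms(3) by simp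
qed

lemma HP_decomposition:
  "F \<in> HP N {..d} \<Longrightarrow> \<exists>f. (\<forall>m. f m \<in> HP N {m}) \<and> F = (\<lambda>w. \<Sum>m\<le>d. f m w)"
proof (induction rule: HP.induct)
  case zero
  show ?case by (intro exI[of _ "\<lambda>m w. 0"]) (auto intro: HP.zero)
next
  case (step k F c)
  then obtain f where f: "\<And>m. f m \<in> HP N {m}" "F = (\<lambda>w. \<Sum>m\<le>d. f m w)" by auto
  let ?n = "\<Sum>i<N. k i"
  define g where "g m w = (if m = ?n then c * hp N k w else 0) + f m w" for m w
  have "g m \<in> HP N {m}" for m
    unfolding g_def[abs_def] by (cases "m = ?n") (auto intro!: HP_add HP_cmult HP_hp f)
  moreover have "(\<Sum>m\<le>d. g m w) = c * hp N k w + F w" for w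
    using step.hyps(1) by (simp add: g_def f sum.distrib)
  ultimately show ?case by (intro exI[of _ g]) auto
qed

lemma LL_sum_components:
  assumes "\<And>m. f m \<in> HP N {m}"
  shows "LL N (\<lambda>w. \<Sum>m\<le>d. f m w) = (\<lambda>w. \<Sum>m\<le>d. - real m * f m w)"
proof -
  have f: "f m \<in> HP N UNIV" for m using assms HP_UNIV by blast
  have "LL N (\<lambda>w. F w + X w) = (\<lambda>w. LL N F w + LL N X w)" if F: "F \<in> HP N UNIV" and X: "X \<in> HP N UNIV" for F X
  proof
    fix w
    have "LL N (\<lambda>w. F w + X w) w = (\<Sum>i<N. (pd i (pd i F) w - w i * pd i F w) + (pd i (pd i X) w - w i * pd i X w))"
      unfolding LL_def by (intro sum.cong refl) (simp only: lessThan_iff pd_add[OF F X] pd_add[OF HP_pd[OF F] HP_pd[OF X]], simp add: algebra_simps)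
    then show "LL N (\<lambda>w. F w + X w) w = LL N F w + LL N X w"
      by (simp add: LL_def sum.distrib)
  qed
  note add = this
  show ?thesis
  proof (induction d)
    case 0
    show ?case by (simp add: LL_eigen[OF assms])
  next
    case (Suc d)
    have "(\<lambda>w. \<Sum>m\<le>d. f m w) \<in> HP N UNIV" by (intro HP_sum f)
    from add[OF this f[of "Suc d"]] Suc show ?case by (simp add: LL_eigen[OF assms] fun_eq_iff algebra_simps)
  qed
qed

text \<open>Free weights \<open>a\<close> and \<open>b\<close> let one family of components
  represent a product, its image under \<open>LL\<close> and the carre du champ at the same
  time.\<close>

lemma expectation_components_mult:
  assumes "\<And>m. f m \<in> HP N {m}" "\<And>m. g m \<in> HP N {m}"
  shows "\<E> (\<lambda>w. (\<Sum>m\<le>d. a m * f m w) * (\<Sum>m\<le>e. b m * g m w)) = (\<Sum>m\<le>min d e. a m * b m * \<E> (\<lambda>w. f m w * g m w))"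
proof -
  have f: "f m \<in> HP N UNIV" and g: "g m \<in> HP N UNIV" for m using assms HP_UNIV by blast+
  have i: "integrable wiener_space (\<lambda>w. f m w * g n w)" for m n
    by (intro HP_integrable[where N = N and S = UNIV] PA_intros f g)
  have "\<E> (\<lambda>w. (\<Sum>m\<le>d. a m * f m w) * (\<Sum>m\<le>e. b m * g m w))
     = \<E> (\<lambda>w. \<Sum>m\<le>d. \<Sum>n\<le>e. (a m * b n) * (f m w * g n w))"
    by (simp add: sum_product mult_ac)
  also have "\<dots> = (\<Sum>m\<le>d. \<Sum>n\<le>e. (a m * b n) * \<E> (\<lambda>w. f m w * g n w))"
    using i by (simp add: Bochner_Integration.integral_sum)
  also have "\<dots> = (\<Sum>m\<le>d. \<Sum>n\<le>e. if n = m then a m * b m * \<E> (\<lambda>w. f m w * g m w) else 0)"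
    by (intro sum.cong) (auto simp: HP_orthogonal[OF assms])
  also have "\<dots> = (\<Sum>m\<le>d. if m \<le> e then a m * b m * \<E> (\<lambda>w. f m w * g m w) else 0)"
    by (intro sum.cong) auto
  also have "\<dots> = (\<Sum>m\<in>{m\<in>{..d}. m \<le> e}. a m * b m * \<E> (\<lambda>w. f m w * g m w))"
    by (subst sum.inter_filter[symmetric]) auto
  also have "{m\<in>{..d}. m \<le> e} = {..min d e}" by auto
  finally show ?thesis .
qed

lemma expectation_components_square:
  assumes "\<And>m. f m \<in> HP N {m}"
  shows "\<E> (\<lambda>w. (\<Sum>m\<le>d. a m * f m w)\<^sup>2) = (\<Sum>m\<le>d. (a m)\<^sup>2 * \<E> (\<lambda>w. (f m w)\<^sup>2))"
  using expectation_components_mult[OF assms assms, where d = d and e = d and a = a and b = a] by (simp add: power2_eq_square)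

lemma HP_0_const: "F \<in> HP N {0} \<Longrightarrow> \<exists>c. F = (\<lambda>w. c)"
proof (induction rule: HP.induct)
  case (step k F c)
  then obtain a where "F = (\<lambda>w. a)" by blast
  moreover have "hp N k = (\<lambda>w. 1)" using step.hyps(1) by (auto simp: hp_def)
  ultimately show ?case by auto
qed auto

lemma HP_expectation_0: "F \<in> HP N {m} \<Longrightarrow> m \<noteq> 0 \<Longrightarrow> \<E> F = 0"
  using HP_orthogonal[of F N m "\<lambda>w. 1" 0] HP_const[of "{0}" 1 N] by simp

section \<open>Hypercontractivity and chaos components of products\<close>

lemma L2_norm_mono:
  assumes "\<And>w. \<bar>F w\<bar> \<le> \<bar>G w\<bar>" "F \<in> L2_space" "G \<in> L2_space"
  shows "L2_norm F \<le> L2_norm G"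
  unfolding L2_norm_def using assms
  by (intro real_sqrt_le_mono integral_mono L2_space_integrable_square) (simp_all add: abs_le_square_iff)

lemma Gm_eigen:
  assumes "U \<in> HP N {a}" "W \<in> HP N {c}"
  shows "2 * Gm N U W w = LL N (\<lambda>w. U w * W w) w + (real a + real c) * (U w * W w)"
  unfolding LL_mult[OF assms] LL_eigen[OF assms(1)] LL_eigen[OF assms(2)] by (simp add: algebra_simps)

text \<open>\<open>Gm N U W\<close> is half of (L + a + c)(UW), and by symmetry L may act on
  \<open>F\<close> instead, as -b. The factor degenerates exactly at a + c = b, which dictates the
  base case of \<open>triple_bound\<close>.\<close>

lemma expectation_triple:
  assumes U: "U \<in> HP N {a}" and W: "W \<in> HP N {c}" and F: "F \<in> HP N {b}"
  shows "2 * \<E> (\<lambda>w. Gm N U W w * F w) = (real a + real c - real b) * \<E> (\<lambda>w. U w * W w * F w)"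
proof -
  note UNIV = HP_UNIV[OF U] HP_UNIV[OF W] HP_UNIV[OF F]
  have "2 * \<E> (\<lambda>w. Gm N U W w * F w) = \<E> (\<lambda>w. 2 * Gm N U W w * F w)"
    by (subst integral_mult_right_zero[symmetric]) (simp add: mult.assoc)
  also have "\<dots> = \<E> (\<lambda>w. F w * LL N (\<lambda>w. U w * W w) w + (real a + real c) * (U w * W w * F w))"
    unfolding Gm_eigen[OF U W] by (simp add: algebra_simps)
  also have "\<dots> = \<E> (\<lambda>w. F w * LL N (\<lambda>w. U w * W w) w) + \<E> (\<lambda>w. (real a + real c) * (U w * W w * F w))"
    by (intro Bochner_Integration.integral_add HP_integrable[where N = N and S = UNIV] PA_intros UNIV)
  also have "\<E> (\<lambda>w. F w * LL N (\<lambda>w. U w * W w) w) = \<E> (\<lambda>w. U w * W w * LL N F w)"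
    by (rule LL_symmetric[OF HP_mult[OF U W] F])
  also have "\<dots> = \<E> (\<lambda>w. - real b * (U w * W w * F w))"
    by (simp add: LL_eigen[OF F] mult_ac)
  finally have "2 * \<E> (\<lambda>w. Gm N U W w * F w) = - real b * \<E> (\<lambda>w. U w * W w * F w)
      + (real a + real c) * \<E> (\<lambda>w. U w * W w * F w)"
    by (simp only: integral_mult_right_zero)
  then show ?thesis by (simp add: left_diff_distrib distrib_right)
qed

lemma Gm_power:
  assumes "F \<in> HP N S"
  shows "Gm N F (\<lambda>w. F w ^ Suc n) = (\<lambda>w. real (Suc n) * F w ^ n * Gm N F F w)"
  using Gm_poly[OF assms, of "monom 1 (Suc n)"] by (simp add: poly_monom pderiv_monom)

lemma expectation_Gm_mult:
  assumes F: "F \<in> HP N {p}" and X: "X \<in> HP N S"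
  shows "real p * \<E> (\<lambda>w. X w * F w) = \<E> (Gm N F X)"
proof -
  have "\<E> (\<lambda>w. X w * LL N F w) = - \<E> (Gm N X F)"
    by (rule expectation_LL[OF F X])
  moreover have "\<E> (\<lambda>w. X w * LL N F w) = - real p * \<E> (\<lambda>w. X w * F w)"
    unfolding LL_eigen[OF F] by (subst integral_mult_right_zero[symmetric]) (simp add: mult_ac)
  ultimately show ?thesis by (simp add: Gm_commute)
qed

text \<open>Integration by parts against F^(k+1). If \<open>Gm N F F\<close> were constant, this
  would be the recursion of Gaussian moments.\<close>

lemma moment_recursion:
  assumes F: "F \<in> HP N {p}"
  shows "real p * \<E> (\<lambda>w. F w ^ (k + 2)) = real (k + 1) * \<E> (\<lambda>w. F w ^ k * Gm N F F w)"
  using expectation_Gm_mult[OF F HP_power_UNIV[OF F, of "Suc k"]] Gm_power[OF F, of k]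
  by (simp add: mult_ac)

lemma expectation_Gm_self: "F \<in> HP N {p} \<Longrightarrow> \<E> (Gm N F F) = real p * \<E> (\<lambda>w. (F w)\<^sup>2)"
  using moment_recursion[of F N p 0] by (simp add: power2_eq_square)

lemma sum_expectation_pd_square:
  assumes F: "F \<in> HP N {p}"
  shows "(\<Sum>i<N. \<E> (\<lambda>w. (pd i F w)\<^sup>2)) = real p * \<E> (\<lambda>w. (F w)\<^sup>2)"
proof -
  have "\<E> (Gm N F F) = (\<Sum>i<N. \<E> (\<lambda>w. (pd i F w)\<^sup>2))"
    unfolding Gm_def[abs_def] power2_eq_square
    by (intro Bochner_Integration.integral_sum HP_integrable[where N = N and S = UNIV] PA_intros HP_UNIV[OF F]) auto
  then show ?thesis using expectation_Gm_self[OF F] by simp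
qed

lemma HP_pd_Suc: "F \<in> HP N {Suc n} \<Longrightarrow> i < N \<Longrightarrow> pd i F \<in> HP N {n}"
  by (rule HP_pd_gen) auto

text \<open>The derivatives have order one less, so the induction hypothesis supplies 3^n; the
  fourth moment recursion adds one more 3, and its degree factor cancels against
  \<open>sum_expectation_pd_square\<close>. In terms of E F^4 the constant is 9^p, as in Nelson's
  theorem.\<close>

lemma hypercontractive:
  "F \<in> HP N {p} \<Longrightarrow> L2_norm (\<lambda>w. (F w)\<^sup>2) \<le> 3 ^ p * \<E> (\<lambda>w. (F w)\<^sup>2)"
proof (induction p arbitrary: F)
  case 0
  then obtain c where "F = (\<lambda>w. c)" using HP_0_const by blast
  moreover have "sqrt (c ^ 4) = c\<^sup>2" by (rule real_sqrt_unique) (simp_all flip: power_mult)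
  ultimately show ?case by (simp add: L2_norm_def wiener.prob_space)
next
  case (Suc n)
  let ?s = "L2_norm (\<lambda>w. (F w)\<^sup>2)" and ?e = "\<E> (\<lambda>w. (F w)\<^sup>2)"
  note F = HP_UNIV[OF Suc.prems]
  have "real (Suc n) * ?s\<^sup>2 = 3 * \<E> (\<lambda>w. (F w)\<^sup>2 * Gm N F F w)"
    using moment_recursion[OF Suc.prems, of 2] by (simp add: L2_norm_square power_mult[symmetric])
  also have "\<E> (\<lambda>w. (F w)\<^sup>2 * Gm N F F w) = \<E> (\<lambda>w. \<Sum>i<N. (F w)\<^sup>2 * (pd i F w)\<^sup>2)"
    by (simp add: Gm_def sum_distrib_left power2_eq_square)
  also have "\<dots> = (\<Sum>i<N. \<E> (\<lambda>w. (F w)\<^sup>2 * (pd i F w)\<^sup>2))"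
    by (intro Bochner_Integration.integral_sum HP_integrable[where N = N and S = UNIV] PA_intros F) auto
  also have "\<dots> \<le> (\<Sum>i<N. ?s * (3 ^ n * \<E> (\<lambda>w. (pd i F w)\<^sup>2)))"
  proof (rule sum_mono)
    fix i assume "i \<in> {..<N}"
    then have i: "i < N" by simp
    have "\<E> (\<lambda>w. (F w)\<^sup>2 * (pd i F w)\<^sup>2) \<le> ?s * L2_norm (\<lambda>w. (pd i F w)\<^sup>2)"
      by (rule order_trans[OF abs_ge_self L2_Cauchy_Schwarz]) (intro HP_L2[where N = N and S = UNIV] PA_intros F i)+
    also have "\<dots> \<le> ?s * (3 ^ n * \<E> (\<lambda>w. (pd i F w)\<^sup>2))"
      by (intro mult_left_mono Suc.IH HP_pd_Suc[OF Suc.prems i] L2_norm_nonneg)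
    finally show "\<E> (\<lambda>w. (F w)\<^sup>2 * (pd i F w)\<^sup>2) \<le> ?s * (3 ^ n * \<E> (\<lambda>w. (pd i F w)\<^sup>2))" .
  qed
  also have "\<dots> = ?s * 3 ^ n * (real (Suc n) * ?e)"
    by (simp only: sum_distrib_left[symmetric] sum_expectation_pd_square[OF Suc.prems] mult.assoc)
  finally have "real (Suc n) * (?s * ?s) \<le> real (Suc n) * (?s * (3 ^ Suc n * ?e))"
    by (simp add: power2_eq_square algebra_simps)
  then have *: "?s * ?s \<le> ?s * (3 ^ Suc n * ?e)"
    by (rule mult_left_le_imp_le) simp
  show ?case
  proof (cases "?s = 0")
    case False
    then have "0 < ?s" using L2_norm_nonneg less_le by metis
    with * show ?thesis by (rule mult_left_le_imp_le)
  qed simp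
qed

text \<open>The additional factor d + 1 is Cauchy-Schwarz over the components of orders 0 to
  d.\<close>

lemma hypercontractive_le:
  assumes "F \<in> HP N {..d}"
  shows "L2_norm (\<lambda>w. (F w)\<^sup>2) \<le> real (d + 1) * 3 ^ d * \<E> (\<lambda>w. (F w)\<^sup>2)"
proof -
  obtain f where f: "\<And>m. f m \<in> HP N {m}" and F: "F = (\<lambda>w. \<Sum>m\<le>d. f m w)"
    using HP_decomposition[OF assms] by auto
  note fU = HP_UNIV[OF f]
  have EF: "\<E> (\<lambda>w. (F w)\<^sup>2) = (\<Sum>m\<le>d. \<E> (\<lambda>w. (f m w)\<^sup>2))"
    using expectation_components_square[OF f, where d = d and a = "\<lambda>_. 1"] by (simp add: F)
  have "L2_norm (\<lambda>w. (F w)\<^sup>2) \<le> L2_norm (\<lambda>w. real (d + 1) * (\<Sum>m\<le>d. (f m w)\<^sup>2))"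
  proof (rule L2_norm_mono)
    show "\<bar>(F w)\<^sup>2\<bar> \<le> \<bar>real (d + 1) * (\<Sum>m\<le>d. (f m w)\<^sup>2)\<bar>" for w
      using sum_squared_le_sum_of_squares[of "\<lambda>m. f m w" "{..d}"]
      by (simp add: F sum_nonneg abs_mult mult.commute)
  qed (auto simp: F intro!: HP_L2[where N = N and S = UNIV] PA_intros fU)
  also have "\<dots> \<le> real (d + 1) * (\<Sum>m\<le>d. L2_norm (\<lambda>w. (f m w)\<^sup>2))"
    unfolding L2_norm_cmult
    by (intro mult_mono L2_norm_sum HP_L2[where N = N and S = UNIV] PA_intros fU) (auto simp: L2_norm_nonneg)
  also have "\<dots> \<le> real (d + 1) * (\<Sum>m\<le>d. 3 ^ d * \<E> (\<lambda>w. (f m w)\<^sup>2))"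
  proof (intro mult_left_mono sum_mono)
    fix m assume "m \<in> {..d}"
    then have "(3::real) ^ m \<le> 3 ^ d" by (intro power_increasing) auto
    then show "L2_norm (\<lambda>w. (f m w)\<^sup>2) \<le> 3 ^ d * \<E> (\<lambda>w. (f m w)\<^sup>2)"
      by (intro order_trans[OF hypercontractive[OF f] mult_right_mono]) simp_all
  qed simp
  finally show ?thesis by (simp add: EF sum_distrib_left mult.assoc)
qed

lemma power_dyadic: "((x::real) ^ (2 ^ r))\<^sup>2 = x ^ (2 ^ Suc r)"
  by (simp add: power2_eq_square mult_2 power_add)

text \<open>Hypercontractivity for F^(2^r), a polynomial of degree at most 2^r d, doubles the
  exponent, so iteration from E F^2 reaches every dyadic moment. The constant depends only on
  \<open>d\<close> and \<open>r\<close>, not on the number of coordinates, and therefore survives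
  the limit.\<close>

lemma moment_bound_dyadic:
  "\<exists>C\<ge>0. \<forall>N F. F \<in> HP N {..d} \<longrightarrow> \<E> (\<lambda>w. F w ^ (2 ^ Suc r)) \<le> C * (\<E> (\<lambda>w. (F w)\<^sup>2)) ^ (2 ^ r)"
proof (induction r)
  case 0
  show ?case by (intro exI[of _ 1]) simp
next
  case (Suc r)
  then obtain C where C: "C \<ge> 0"
    "\<And>N F. F \<in> HP N {..d} \<Longrightarrow> \<E> (\<lambda>w. F w ^ (2 ^ Suc r)) \<le> C * (\<E> (\<lambda>w. (F w)\<^sup>2)) ^ (2 ^ r)"
    by blast
  define K where "K = real (2 ^ r * d + 1) * 3 ^ (2 ^ r * d)"
  have K: "K \<ge> 0" by (simp add: K_def)
  have "\<E> (\<lambda>w. F w ^ (2 ^ Suc (Suc r))) \<le> (K * C)\<^sup>2 * (\<E> (\<lambda>w. (F w)\<^sup>2)) ^ (2 ^ Suc r)" if F: "F \<in> HP N {..d}" for N F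
  proof -
    have "\<E> (\<lambda>w. F w ^ (2 ^ Suc (Suc r))) = (L2_norm (\<lambda>w. (F w ^ (2 ^ r))\<^sup>2))\<^sup>2"
      by (simp only: L2_norm_square power_dyadic)
    also have "\<dots> \<le> (K * \<E> (\<lambda>w. (F w ^ (2 ^ r))\<^sup>2))\<^sup>2"
      unfolding K_def by (intro power_mono hypercontractive_le[where N = N] HP_power F L2_norm_nonneg)
    also have "\<E> (\<lambda>w. (F w ^ (2 ^ r))\<^sup>2) = \<E> (\<lambda>w. F w ^ (2 ^ Suc r))"
      by (simp only: power_dyadic)
    also have "(K * \<E> (\<lambda>w. F w ^ (2 ^ Suc r)))\<^sup>2 \<le> (K * (C * (\<E> (\<lambda>w. (F w)\<^sup>2)) ^ (2 ^ r)))\<^sup>2"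
      by (intro power_mono mult_left_mono C(2)[OF F] K mult_nonneg_nonneg) simp_all
    also have "\<dots> = (K * C)\<^sup>2 * (\<E> (\<lambda>w. (F w)\<^sup>2)) ^ (2 ^ Suc r)"
      by (simp only: power_mult_distrib power_dyadic mult.assoc)
    finally show ?thesis .
  qed
  then show ?case by (intro exI[of _ "(K * C)\<^sup>2"]) auto
qed

text \<open>The weights p + q - m of the carre du champ are nonnegative, and the top component is
  killed. The estimates that follow compare such weights.\<close>

lemma product_components:
  assumes F: "F \<in> HP N {p}" and X: "X \<in> HP N {q}"
  shows "\<exists>g. (\<forall>m. g m \<in> HP N {m}) \<and> (\<forall>w. F w * X w = (\<Sum>m\<le>p+q. g m w)) \<and>
    (\<forall>w. 2 * Gm N F X w = (\<Sum>m\<le>p+q. (real (p + q) - real m) * g m w))"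
proof -
  have "(\<lambda>w. F w * X w) \<in> HP N {..p+q}"
    by (intro HP_mult_le HP_mono[OF F] HP_mono[OF X]) auto
  then obtain g where g: "\<And>m. g m \<in> HP N {m}" "(\<lambda>w. F w * X w) = (\<lambda>w. \<Sum>m\<le>p+q. g m w)"
    using HP_decomposition by blast
  have "2 * Gm N F X w = (\<Sum>m\<le>p+q. (real (p + q) - real m) * g m w)" for w
    unfolding Gm_eigen[OF F X] g(2) LL_sum_components[OF g(1)] fun_cong[OF g(2)]
    by (simp add: sum_distrib_left sum.distrib[symmetric] algebra_simps)
  then show ?thesis using g(1) fun_cong[OF g(2)] by blast
qed

text \<open>For 0 <= m <= p + q the squared weight (p + q - m)^2 is at most (p + q)(p + q - m),
  which gives the mixed expectation, and at most (p + q)^2, which gives E (FX)^2.\<close>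

lemma expectation_Gm_square_le:
  assumes F: "F \<in> HP N {p}" and X: "X \<in> HP N {q}"
  shows "4 * \<E> (\<lambda>w. (Gm N F X w)\<^sup>2) \<le> 2 * real (p + q) * \<E> (\<lambda>w. F w * X w * Gm N F X w)"
    and "4 * \<E> (\<lambda>w. (Gm N F X w)\<^sup>2) \<le> (real (p + q))\<^sup>2 * \<E> (\<lambda>w. (F w)\<^sup>2 * (X w)\<^sup>2)"
proof -
  obtain g where g: "\<And>m. g m \<in> HP N {m}"
    and FX: "\<And>w. F w * X w = (\<Sum>m\<le>p+q. g m w)"
    and Gm: "\<And>w. 2 * Gm N F X w = (\<Sum>m\<le>p+q. (real (p + q) - real m) * g m w)"
    using product_components[OF F X] by blast
  have "4 * \<E> (\<lambda>w. (Gm N F X w)\<^sup>2) = \<E> (\<lambda>w. (2 * Gm N F X w)\<^sup>2)"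
    by (simp add: power_mult_distrib)
  also have "\<dots> = (\<Sum>m\<le>p+q. (real (p + q) - real m)\<^sup>2 * \<E> (\<lambda>w. (g m w)\<^sup>2))"
    unfolding Gm by (rule expectation_components_square[OF g])
  finally have 1: "4 * \<E> (\<lambda>w. (Gm N F X w)\<^sup>2) = \<dots>" .
  have "2 * \<E> (\<lambda>w. F w * X w * Gm N F X w) = \<E> (\<lambda>w. (\<Sum>m\<le>p+q. 1 * g m w) * (\<Sum>m\<le>p+q. (real (p + q) - real m) * g m w))"
    unfolding Gm[symmetric] by (subst integral_mult_right_zero[symmetric]) (simp add: FX mult_ac)
  also have "\<dots> = (\<Sum>m\<le>p+q. (real (p + q) - real m) * \<E> (\<lambda>w. (g m w)\<^sup>2))"
    unfolding expectation_components_mult[OF g g] by (simp add: power2_eq_square)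
  finally have 2: "2 * \<E> (\<lambda>w. F w * X w * Gm N F X w) = \<dots>" .
  have "(\<Sum>m\<le>p+q. (real (p + q) - real m)\<^sup>2 * \<E> (\<lambda>w. (g m w)\<^sup>2))
     \<le> (\<Sum>m\<le>p+q. real (p + q) * ((real (p + q) - real m) * \<E> (\<lambda>w. (g m w)\<^sup>2)))"
    unfolding power2_eq_square[of "_ - _"] mult.assoc
    by (intro sum_mono mult_right_mono mult_nonneg_nonneg) auto
  then show "4 * \<E> (\<lambda>w. (Gm N F X w)\<^sup>2) \<le> 2 * real (p + q) * \<E> (\<lambda>w. F w * X w * Gm N F X w)"
    unfolding 1 sum_distrib_left[symmetric] 2[symmetric] by (simp only: mult_ac)
  have "\<E> (\<lambda>w. (F w)\<^sup>2 * (X w)\<^sup>2) = \<E> (\<lambda>w. (\<Sum>m\<le>p+q. 1 * g m w)\<^sup>2)"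
    by (simp add: FX[symmetric] power_mult_distrib)
  also have "\<dots> = (\<Sum>m\<le>p+q. \<E> (\<lambda>w. (g m w)\<^sup>2))"
    unfolding expectation_components_square[OF g] by simp
  finally have 3: "\<E> (\<lambda>w. (F w)\<^sup>2 * (X w)\<^sup>2) = \<dots>" .
  show "4 * \<E> (\<lambda>w. (Gm N F X w)\<^sup>2) \<le> (real (p + q))\<^sup>2 * \<E> (\<lambda>w. (F w)\<^sup>2 * (X w)\<^sup>2)"
    unfolding 1 3 sum_distrib_left
    by (intro sum_mono mult_right_mono power_mono) auto
qed

lemma Gm_bounded:
  assumes F: "F \<in> HP N {p}" and X: "X \<in> HP N {q}"
  shows "L2_norm (Gm N F X) \<le> real (p + q) * 3 ^ (p + q) * L2_norm F * L2_norm X"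
proof (rule power2_le_imp_le)
  note UNIV = HP_UNIV[OF F] HP_UNIV[OF X]
  have "4 * (L2_norm (Gm N F X))\<^sup>2 \<le> (real (p + q))\<^sup>2 * \<E> (\<lambda>w. (F w)\<^sup>2 * (X w)\<^sup>2)"
    using expectation_Gm_square_le(2)[OF assms] by (simp add: L2_norm_square)
  also have "\<E> (\<lambda>w. (F w)\<^sup>2 * (X w)\<^sup>2) \<le> L2_norm (\<lambda>w. (F w)\<^sup>2) * L2_norm (\<lambda>w. (X w)\<^sup>2)"
    by (rule order_trans[OF abs_ge_self L2_Cauchy_Schwarz]) (intro HP_L2[where N = N and S = UNIV] PA_intros UNIV)+
  also have "\<dots> \<le> (3 ^ p * \<E> (\<lambda>w. (F w)\<^sup>2)) * (3 ^ q * \<E> (\<lambda>w. (X w)\<^sup>2))"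
    by (intro mult_mono hypercontractive[where N = N] F X L2_norm_nonneg) simp
  also have "\<dots> = 3 ^ (p + q) * (L2_norm F * L2_norm X)\<^sup>2"
    by (simp add: L2_norm_square[symmetric] power_add power_mult_distrib)
  \<comment> \<open>Deliberately wasteful: squaring the power of 3 keeps a square root out of the
    final constant.\<close>
  also have "(3::real) ^ (p + q) \<le> (3 ^ (p + q))\<^sup>2"
    by (intro self_le_power) simp_all
  finally have "4 * (L2_norm (Gm N F X))\<^sup>2 \<le> (real (p + q) * 3 ^ (p + q) * L2_norm F * L2_norm X)\<^sup>2"
    by (simp add: mult_left_mono mult_right_mono power_mult_distrib mult_ac)
  moreover have "0 \<le> (L2_norm (Gm N F X))\<^sup>2" by simp
  ultimately show "(L2_norm (Gm N F X))\<^sup>2 \<le> (real (p + q) * 3 ^ (p + q) * L2_norm F * L2_norm X)\<^sup>2"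
    by linarith
qed (simp add: L2_norm_nonneg)

section \<open>Variance of the carre du champ on polynomials\<close>

text \<open>Polynomials of order 0 are constants and all other components have mean 0, which
  identifies \<open>g 0\<close>.\<close>

lemma square_components:
  assumes F: "F \<in> HP N {p}"
  shows "\<exists>g. (\<forall>m. g m \<in> HP N {m}) \<and> (\<forall>w. (F w)\<^sup>2 = (\<Sum>m\<le>2*p. g m w)) \<and>
    g 0 = (\<lambda>w. \<E> (\<lambda>w. (F w)\<^sup>2)) \<and>
    (\<forall>w. Gm N F F w = (\<Sum>m\<le>2*p. (real p - real m / 2) * g m w))"
proof -
  from product_components[OF F F] obtain g where g: "\<And>m. g m \<in> HP N {m}"
    "\<And>w. F w * F w = (\<Sum>m\<le>p+p. g m w)"
    "\<And>w. 2 * Gm N F F w = (\<Sum>m\<le>p+p. (real (p + p) - real m) * g m w)" by blast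
  have sq: "(F w)\<^sup>2 = (\<Sum>m\<le>2*p. g m w)" for w
    using g(2) by (simp add: power2_eq_square mult_2)
  have Gm: "Gm N F F w = (\<Sum>m\<le>2*p. (real p - real m / 2) * g m w)" for w
  proof -
    have "2 * Gm N F F w = 2 * (\<Sum>m\<le>2*p. (real p - real m / 2) * g m w)"
      unfolding g(3) sum_distrib_left mult_2[symmetric, of p] by (intro sum.cong) (auto simp: algebra_simps)
    then show ?thesis by simp
  qed
  obtain c where c: "g 0 = (\<lambda>w. c)" using HP_0_const g(1) by blast
  have "\<E> (\<lambda>w. (F w)\<^sup>2) = (\<Sum>m\<le>2*p. \<E> (g m))"
    unfolding sq by (intro Bochner_Integration.integral_sum HP_integrable[OF g(1)])
  also have "\<dots> = (\<Sum>m\<le>2*p. if m = 0 then c else 0)"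
    by (intro sum.cong) (auto simp: c wiener.prob_space HP_expectation_0[OF g(1)])
  also have "\<dots> = c" by simp
  finally show ?thesis using g(1) sq Gm c by blast
qed

lemma variance_Gm_components:
  assumes F: "F \<in> HP N {p}" and g: "\<And>m. g m \<in> HP N {m}" "g 0 = (\<lambda>w. \<E> (\<lambda>w. (F w)\<^sup>2))"
    "\<And>w. Gm N F F w = (\<Sum>m\<le>2*p. (real p - real m / 2) * g m w)"
  shows "wiener.variance (Gm N F F) = (\<Sum>m=1..2*p. (real p - real m / 2)\<^sup>2 * \<E> (\<lambda>w. (g m w)\<^sup>2))"
proof -
  have split: "{..2*p} = insert 0 {1..2*p}" by auto
  have "Gm N F F w - \<E> (Gm N F F) = (\<Sum>m\<le>2*p. (if m = 0 then 0 else real p - real m / 2) * g m w)" for w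
    unfolding expectation_Gm_self[OF F] g(3) split by (simp add: g(2))
  then have "wiener.variance (Gm N F F) = (\<Sum>m\<le>2*p. (if m = 0 then 0 else real p - real m / 2)\<^sup>2 * \<E> (\<lambda>w. (g m w)\<^sup>2))"
    by (simp only: expectation_components_square[OF g(1)])
  also have "\<dots> = (\<Sum>m=1..2*p. (real p - real m / 2)\<^sup>2 * \<E> (\<lambda>w. (g m w)\<^sup>2))"
    unfolding split by simp
  finally show ?thesis .
qed

text \<open>By the moment recursion with k = 2, the fourth moment excess is a sum of E g_m^2 with
  weights proportional to p - m/2; the variance is the sum of the same terms with weights (p -
  m/2)^2 <= p (p - m/2).\<close>

lemma variance_Gm_le_fourth_moment:
  assumes F: "F \<in> HP N {p}"
  shows "wiener.variance (Gm N F F) \<le> (real p)\<^sup>2 / 3 * (\<E> (\<lambda>w. F w ^ 4) - 3 * (\<E> (\<lambda>w. (F w)\<^sup>2))\<^sup>2)"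
proof -
  from square_components[OF F] obtain g where g: "\<And>m. g m \<in> HP N {m}"
    "\<And>w. (F w)\<^sup>2 = (\<Sum>m\<le>2*p. g m w)" "g 0 = (\<lambda>w. \<E> (\<lambda>w. (F w)\<^sup>2))"
    "\<And>w. Gm N F F w = (\<Sum>m\<le>2*p. (real p - real m / 2) * g m w)" by blast
  let ?v = "\<lambda>m. \<E> (\<lambda>w. (g m w)\<^sup>2)"
  have split: "{..2*p} = insert 0 {1..2*p}" by auto
  have "real p * \<E> (\<lambda>w. F w ^ 4) = 3 * \<E> (\<lambda>w. (F w)\<^sup>2 * Gm N F F w)"
    using moment_recursion[OF F, of 2] by simp
  also have "\<E> (\<lambda>w. (F w)\<^sup>2 * Gm N F F w) = \<E> (\<lambda>w. (\<Sum>m\<le>2*p. 1 * g m w) * (\<Sum>m\<le>2*p. (real p - real m / 2) * g m w))"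
    by (simp add: g(2,4))
  also have "\<dots> = (\<Sum>m\<le>2*p. (real p - real m / 2) * ?v m)"
    unfolding expectation_components_mult[OF g(1) g(1)] by (simp add: power2_eq_square)
  also have "\<dots> = real p * (\<E> (\<lambda>w. (F w)\<^sup>2))\<^sup>2 + (\<Sum>m=1..2*p. (real p - real m / 2) * ?v m)"
    unfolding split by (simp add: g(3) wiener.prob_space)
  finally have 1: "real p * \<E> (\<lambda>w. F w ^ 4) = 3 * (real p * (\<E> (\<lambda>w. (F w)\<^sup>2))\<^sup>2 + (\<Sum>m=1..2*p. (real p - real m / 2) * ?v m))" .
  have "wiener.variance (Gm N F F) = (\<Sum>m=1..2*p. (real p - real m / 2)\<^sup>2 * ?v m)"
    by (rule variance_Gm_components[OF F g(1,3,4)])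
  also have "\<dots> \<le> (\<Sum>m=1..2*p. real p * ((real p - real m / 2) * ?v m))"
    unfolding power2_eq_square[of "_ - _"] mult.assoc
    by (intro sum_mono mult_right_mono mult_nonneg_nonneg) auto
  also have "\<dots> = real p * (\<Sum>m=1..2*p. (real p - real m / 2) * ?v m)"
    by (simp only: sum_distrib_left)
  also have "\<dots> = real p * (real p * \<E> (\<lambda>w. F w ^ 4) / 3 - real p * (\<E> (\<lambda>w. (F w)\<^sup>2))\<^sup>2)"
  proof -
    have "(\<Sum>m=1..2*p. (real p - real m / 2) * ?v m) = real p * \<E> (\<lambda>w. F w ^ 4) / 3 - real p * (\<E> (\<lambda>w. (F w)\<^sup>2))\<^sup>2"
      unfolding 1 by (subst nonzero_mult_div_cancel_left) simp_all
    then show ?thesis by (simp only:)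
  qed
  finally show ?thesis by (simp add: power2_eq_square algebra_simps)
qed

text \<open>In components, p F^2 - Gamma[F,F] is the sum of (m/2) g_m, so it has no constant part,
  and X^2 sees only orders up to 2q. There the weight m/2 is at most p times the variance weight p -
  m/2. The factor 3^q is hypercontractivity for \<open>X\<close>.\<close>

lemma expectation_Gm_square_le_variance:
  assumes F: "F \<in> HP N {p}" and X: "X \<in> HP N {q}" and "q < p"
  shows "\<E> (\<lambda>w. (Gm N F X w)\<^sup>2) \<le> real (p + q) * real p * 3 ^ q * \<E> (\<lambda>w. (X w)\<^sup>2) * sqrt (wiener.variance (Gm N F F))"
proof -
  from square_components[OF F] obtain g where g: "\<And>m. g m \<in> HP N {m}"
    "\<And>w. (F w)\<^sup>2 = (\<Sum>m\<le>2*p. g m w)" "g 0 = (\<lambda>w. \<E> (\<lambda>w. (F w)\<^sup>2))"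
    "\<And>w. Gm N F F w = (\<Sum>m\<le>2*p. (real p - real m / 2) * g m w)" by blast
  from square_components[OF X] obtain x where x: "\<And>m. x m \<in> HP N {m}"
    "\<And>w. (X w)\<^sup>2 = (\<Sum>m\<le>2*q. x m w)" by blast
  note UNIV = HP_UNIV[OF F] HP_UNIV[OF X] HP_UNIV[OF g(1)]
  let ?v = "\<lambda>m. \<E> (\<lambda>w. (g m w)\<^sup>2)"
  \<comment> \<open>The part of p F^2 - Gamma[F,F] of order at most 2q; the higher orders are
    orthogonal to X^2.\<close>
  define W where "W w = (\<Sum>m\<le>2*q. real m / 2 * g m w)" for w
  have W: "W \<in> HP N UNIV"
    unfolding W_def[abs_def] by (intro PA_intros UNIV)
  have "real p * \<E> (\<lambda>w. (X w)\<^sup>2 * F w * F w) = \<E> (Gm N F (\<lambda>w. (X w)\<^sup>2 * F w))"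
    by (intro expectation_Gm_mult[OF F, where S = UNIV] PA_intros UNIV)
  also have "Gm N F (\<lambda>w. (X w)\<^sup>2 * F w) = (\<lambda>w. (X w)\<^sup>2 * Gm N F F w + 2 * (F w * X w * Gm N F X w))"
    unfolding power2_eq_square Gm_mult[OF HP_mult[OF X X] F] Gm_mult[OF X X] by (simp add: algebra_simps)
  also have "\<E> \<dots> = \<E> (\<lambda>w. (X w)\<^sup>2 * Gm N F F w) + \<E> (\<lambda>w. 2 * (F w * X w * Gm N F X w))"
    by (intro Bochner_Integration.integral_add HP_integrable[where N = N and S = UNIV] PA_intros UNIV)
  finally have "2 * \<E> (\<lambda>w. F w * X w * Gm N F X w) = \<E> (\<lambda>w. real p * ((X w)\<^sup>2 * F w * F w)) - \<E> (\<lambda>w. (X w)\<^sup>2 * Gm N F F w)"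
    by (simp add: mult.assoc)
  also have "\<dots> = \<E> (\<lambda>w. real p * ((X w)\<^sup>2 * F w * F w) - (X w)\<^sup>2 * Gm N F F w)"
    by (intro Bochner_Integration.integral_diff[symmetric] HP_integrable[where N = N and S = UNIV] PA_intros UNIV)
  also have "\<dots> = \<E> (\<lambda>w. (\<Sum>m\<le>2*q. 1 * x m w) * (\<Sum>m\<le>2*p. real m / 2 * g m w))"
  proof (intro Bochner_Integration.integral_cong refl)
    fix w
    have D: "real p * (F w)\<^sup>2 - Gm N F F w = (\<Sum>m\<le>2*p. real m / 2 * g m w)"
      unfolding g(2,4) by (simp add: sum_distrib_left sum_subtractf[symmetric] algebra_simps)
    show "real p * ((X w)\<^sup>2 * F w * F w) - (X w)\<^sup>2 * Gm N F F w = (\<Sum>m\<le>2*q. 1 * x m w) * (\<Sum>m\<le>2*p. real m / 2 * g m w)"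
      unfolding D[symmetric] mult_1 x(2)[symmetric] by (simp add: power2_eq_square algebra_simps)
  qed
  also have "\<dots> = (\<Sum>m\<le>2*q. real m / 2 * \<E> (\<lambda>w. x m w * g m w))"
    unfolding expectation_components_mult[OF x(1) g(1)] using \<open>q < p\<close> by (simp add: min_def)
  also have "\<dots> = \<E> (\<lambda>w. (\<Sum>m\<le>2*q. 1 * x m w) * (\<Sum>m\<le>2*q. real m / 2 * g m w))"
    unfolding expectation_components_mult[OF x(1) g(1)] by simp
  also have "\<dots> = \<E> (\<lambda>w. (X w)\<^sup>2 * W w)"
    by (simp add: x(2) W_def)
  also have "\<dots> \<le> L2_norm (\<lambda>w. (X w)\<^sup>2) * L2_norm W"
    by (rule order_trans[OF abs_ge_self L2_Cauchy_Schwarz]) (intro HP_L2[where N = N and S = UNIV] PA_intros UNIV W)+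
  also have "\<dots> \<le> (3 ^ q * \<E> (\<lambda>w. (X w)\<^sup>2)) * (real p * sqrt (wiener.variance (Gm N F F)))"
  proof (intro mult_mono hypercontractive[OF X] L2_norm_nonneg)
    have "(L2_norm W)\<^sup>2 = (\<Sum>m\<le>2*q. (real m / 2)\<^sup>2 * ?v m)"
      unfolding L2_norm_square W_def expectation_components_square[OF g(1)] ..
    also have "\<dots> = (\<Sum>m=1..2*q. (real m / 2)\<^sup>2 * ?v m)"
      by (rule sum.mono_neutral_right) auto
    also have "\<dots> \<le> (\<Sum>m=1..2*q. (real p)\<^sup>2 * ((real p - real m / 2)\<^sup>2 * ?v m))"
    proof (intro sum_mono, unfold mult.assoc[symmetric], intro mult_right_mono)
      fix m assume "m \<in> {1..2*q}"
      then have "m \<le> 2 * q" "Suc q \<le> p" using \<open>q < p\<close> by auto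
      from of_nat_mono[OF this(1), where 'a = real] of_nat_mono[OF this(2), where 'a = real]
      have "real m \<le> 2 * real q" "real q + 1 \<le> real p" by simp_all
      \<comment> \<open>For m <= 2q the hypothesis \<open>q < p\<close> keeps the variance weight p
        - m/2 at least 1.\<close>
      then have "real m / 2 \<le> real p" "1 \<le> real p - real m / 2" by linarith+
      then have "real m / 2 \<le> real p * (real p - real m / 2)"
        using mult_mono[of "real m / 2" "real p" 1 "real p - real m / 2"] by simp
      then have "(real m / 2)\<^sup>2 \<le> (real p * (real p - real m / 2))\<^sup>2" by (intro power_mono) auto
      then show "(real m / 2)\<^sup>2 \<le> (real p)\<^sup>2 * (real p - real m / 2)\<^sup>2" by (simp add: power_mult_distrib)
    qed simp
    also have "\<dots> \<le> (\<Sum>m=1..2*p. (real p)\<^sup>2 * ((real p - real m / 2)\<^sup>2 * ?v m))"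
      using \<open>q < p\<close> by (intro sum_mono2) auto
    also have "\<dots> = (real p)\<^sup>2 * wiener.variance (Gm N F F)"
      by (simp only: sum_distrib_left variance_Gm_components[OF F g(1,3,4)])
    finally have "sqrt ((L2_norm W)\<^sup>2) \<le> sqrt ((real p)\<^sup>2 * wiener.variance (Gm N F F))"
      by (rule real_sqrt_le_mono)
    then show "L2_norm W \<le> real p * sqrt (wiener.variance (Gm N F F))"
      by (simp add: real_sqrt_mult L2_norm_nonneg)
  qed simp
  finally have 1: "2 * \<E> (\<lambda>w. F w * X w * Gm N F X w)
      \<le> (3 ^ q * \<E> (\<lambda>w. (X w)\<^sup>2)) * (real p * sqrt (wiener.variance (Gm N F F)))" (is "_ \<le> ?R") .
  have "4 * \<E> (\<lambda>w. (Gm N F X w)\<^sup>2) \<le> real (p + q) * (2 * \<E> (\<lambda>w. F w * X w * Gm N F X w))"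
    using expectation_Gm_square_le(1)[OF F X] by (simp only: mult_ac)
  also have "\<dots> \<le> real (p + q) * ?R"
    by (intro mult_left_mono 1) simp
  finally have "4 * \<E> (\<lambda>w. (Gm N F X w)\<^sup>2) \<le> real (p + q) * ?R" .
  moreover have "0 \<le> \<E> (\<lambda>w. (Gm N F X w)\<^sup>2)" by simp
  ultimately have "\<E> (\<lambda>w. (Gm N F X w)\<^sup>2) \<le> real (p + q) * ?R" by linarith
  then show ?thesis by (simp add: mult_ac)
qed

section \<open>Hermite polynomials of a chaos element\<close>

lemma power_square_le_dyadic: "((x::real) ^ i)\<^sup>2 \<le> 1 + x ^ (2 ^ Suc i)"
proof -
  \<comment> \<open>Every even exponent is dominated by a dyadic one; the summand 1 takes care of
    |x| <= 1.\<close>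
  have "i * 2 \<le> 2 ^ Suc i" using less_exp[of i] by simp
  then have "\<bar>x\<bar> ^ (i * 2) \<le> 1 + \<bar>x\<bar> ^ (2 ^ Suc i)"
  proof (cases "\<bar>x\<bar> \<le> 1")
    case True
    then have "\<bar>x\<bar> ^ (i * 2) \<le> 1" by (intro power_le_one) auto
    then show ?thesis by (rule order_trans) (simp del: power_Suc)
  next
    case False
    then have "\<bar>x\<bar> ^ (i * 2) \<le> \<bar>x\<bar> ^ (2 ^ Suc i)"
      using \<open>i * 2 \<le> 2 ^ Suc i\<close> by (intro power_increasing) auto
    then show ?thesis by linarith
  qed
  moreover have "\<bar>x\<bar> ^ (i * 2) = (x ^ i)\<^sup>2"
    by (simp only: power_mult flip: power_abs) simp
  moreover have "\<bar>x\<bar> ^ (2 ^ Suc i) = x ^ (2 ^ Suc i)"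
    by (rule power_even_abs) simp
  ultimately show ?thesis by simp
qed

text \<open>The bound 2 stands for any number above the limit 1 of the second moments. The constant
  is uniform in \<open>N\<close> and \<open>F\<close>.\<close>

lemma HP_poly_bounded:
  "\<exists>C. \<forall>N F. F \<in> HP N {p} \<longrightarrow> \<E> (\<lambda>w. (F w)\<^sup>2) \<le> 2 \<longrightarrow> \<E> (\<lambda>w. (poly q (F w))\<^sup>2) \<le> C"
proof -
  obtain K where K: "\<And>r. K r \<ge> 0"
    "\<And>r N F. F \<in> HP N {..p} \<Longrightarrow> \<E> (\<lambda>w. F w ^ (2 ^ Suc r)) \<le> K r * (\<E> (\<lambda>w. (F w)\<^sup>2)) ^ (2 ^ r)"
    using moment_bound_dyadic[of p] by metis
  define C where "C = real (degree q + 1) * (\<Sum>i\<le>degree q. (coeff q i)\<^sup>2 * (1 + K i * 2 ^ (2 ^ i)))"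
  have "\<E> (\<lambda>w. (poly q (F w))\<^sup>2) \<le> C" if F: "F \<in> HP N {p}" and F2: "\<E> (\<lambda>w. (F w)\<^sup>2) \<le> 2" for N F
  proof -
    note FU = HP_UNIV[OF F]
    have "\<E> (\<lambda>w. (poly q (F w))\<^sup>2) \<le> \<E> (\<lambda>w. real (degree q + 1) * (\<Sum>i\<le>degree q. (coeff q i)\<^sup>2 * (1 + F w ^ (2 ^ Suc i))))"
    proof (intro integral_mono HP_integrable[where N = N and S = UNIV] PA_intros FU)
      fix w
      have "(poly q (F w))\<^sup>2 \<le> (\<Sum>i\<le>degree q. (coeff q i * F w ^ i)\<^sup>2) * real (card {..degree q})"
        unfolding poly_altdef by (rule sum_squared_le_sum_of_squares)
      also have "\<dots> \<le> (\<Sum>i\<le>degree q. (coeff q i)\<^sup>2 * (1 + F w ^ (2 ^ Suc i))) * real (card {..degree q})"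
        unfolding power_mult_distrib by (intro mult_right_mono sum_mono mult_left_mono power_square_le_dyadic) auto
      finally show "(poly q (F w))\<^sup>2 \<le> real (degree q + 1) * (\<Sum>i\<le>degree q. (coeff q i)\<^sup>2 * (1 + F w ^ (2 ^ Suc i)))"
        by (simp add: mult.commute)
    qed
    also have "\<dots> = real (degree q + 1) * (\<Sum>i\<le>degree q. (coeff q i)\<^sup>2 * (1 + \<E> (\<lambda>w. F w ^ (2 ^ Suc i))))"
    proof -
      have i: "integrable wiener_space (\<lambda>w. F w ^ k)" for k
        by (intro HP_integrable[where N = N and S = UNIV] PA_intros FU)
      show ?thesis by (simp add: i wiener.prob_space del: power_Suc of_nat_add)
    qed
    also have "\<dots> \<le> C"
      unfolding C_def
    proof (intro mult_left_mono sum_mono add_left_mono)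
      fix i
      have "\<E> (\<lambda>w. F w ^ (2 ^ Suc i)) \<le> K i * (\<E> (\<lambda>w. (F w)\<^sup>2)) ^ (2 ^ i)"
        by (rule K(2)) (auto intro: HP_mono[OF F])
      also have "\<dots> \<le> K i * 2 ^ (2 ^ i)"
        by (intro mult_left_mono power_mono F2 K) simp
      finally show "\<E> (\<lambda>w. F w ^ (2 ^ Suc i)) \<le> K i * 2 ^ (2 ^ i)" .
    qed simp_all
    finally show ?thesis .
  qed
  then show ?thesis by blast
qed

text \<open>The Hermite equation replaces k H_k(F) by F H_k'(F) - H_k''(F); the first of these
  terms, times p, cancels the -p F H_k'(F) of the chain rule.\<close>

lemma LL_hermite_eq:
  assumes F: "F \<in> HP N {p}"
  shows "LL N (\<lambda>w. poly (hermite k) (F w)) w + real (k * p) * poly (hermite k) (F w)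
     = poly (pderiv (pderiv (hermite k))) (F w) * (Gm N F F w - real p)"
proof -
  have "real (k * p) * poly (hermite k) (F w) = - real p * (- real k * poly (hermite k) (F w))" by simp
  also have "\<dots> = - real p * (poly (pderiv (pderiv (hermite k))) (F w) - F w * poly (pderiv (hermite k)) (F w))"
    by (simp only: hermite_ode)
  finally show ?thesis
    unfolding LL_poly[OF F] LL_eigen[OF F] by (simp add: algebra_simps)
qed

lemma variance_shift:
  assumes "Y \<in> L2_space"
  shows "\<E> (\<lambda>w. (Y w - c)\<^sup>2) = wiener.variance Y + (\<E> Y - c)\<^sup>2"
proof -
  note i = L2_integrable[OF assms] L2_space_integrable_square[OF assms]
  have "\<E> (\<lambda>w. (Y w - a)\<^sup>2) = \<E> (\<lambda>w. (Y w)\<^sup>2) - 2 * a * \<E> Y + a\<^sup>2" for a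
    using i by (simp add: power2_diff wiener.prob_space mult_ac)
  from this[of c] this[of "\<E> Y"] show ?thesis by (simp add: power2_eq_square algebra_simps)
qed

text \<open>Cauchy-Schwarz decouples H_k''(F) from Gamma[F,F] - p. The latter has degree at most 2p,
  so hypercontractivity returns its fourth moment to its second, which is the variance plus the
  squared bias p (E F^2 - 1).\<close>

lemma LL_hermite_bound:
  "\<exists>C. \<forall>N F. F \<in> HP N {p} \<longrightarrow> \<E> (\<lambda>w. (F w)\<^sup>2) \<le> 2 \<longrightarrow>
     \<E> (\<lambda>w. (LL N (\<lambda>w. poly (hermite k) (F w)) w + real (k * p) * poly (hermite k) (F w))\<^sup>2)
     \<le> C * (wiener.variance (Gm N F F) + (real p * (\<E> (\<lambda>w. (F w)\<^sup>2) - 1))\<^sup>2)"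
proof -
  let ?h = "pderiv (pderiv (hermite k))"
  obtain K where K: "\<And>N F. F \<in> HP N {p} \<Longrightarrow> \<E> (\<lambda>w. (F w)\<^sup>2) \<le> 2 \<Longrightarrow> \<E> (\<lambda>w. (poly (?h\<^sup>2) (F w))\<^sup>2) \<le> K"
    using HP_poly_bounded[of p "?h\<^sup>2"] by blast
  define C where "C = sqrt K * (real (2 * p + 1) * 3 ^ (2 * p))"
  show ?thesis
  proof (intro exI[of _ C] allI impI)
    fix N F assume F: "F \<in> HP N {p}" and F2: "\<E> (\<lambda>w. (F w)\<^sup>2) \<le> 2"
    note FU = HP_UNIV[OF F]
    from square_components[OF F] obtain g where g: "\<And>m. g m \<in> HP N {m}"
      "\<And>w. Gm N F F w = (\<Sum>m\<le>2*p. (real p - real m / 2) * g m w)" by blast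
    have Gm: "(\<lambda>w. Gm N F F w - real p) \<in> HP N {..2*p}"
      unfolding g(2) by (intro HP_diff HP_const HP_sum HP_cmult HP_mono[OF g(1)]) auto
    have k1: "L2_norm (\<lambda>w. poly (?h\<^sup>2) (F w)) \<le> sqrt K"
      unfolding L2_norm_def by (intro real_sqrt_le_mono K[OF F F2])
    have k2: "0 \<le> sqrt K" by (rule order_trans[OF L2_norm_nonneg k1])
    have "\<E> (\<lambda>w. (LL N (\<lambda>w. poly (hermite k) (F w)) w + real (k * p) * poly (hermite k) (F w))\<^sup>2)
      = \<E> (\<lambda>w. poly (?h\<^sup>2) (F w) * (Gm N F F w - real p)\<^sup>2)"
      unfolding LL_hermite_eq[OF F] by (simp add: power_mult_distrib poly_power)
    also have "\<dots> \<le> L2_norm (\<lambda>w. poly (?h\<^sup>2) (F w)) * L2_norm (\<lambda>w. (Gm N F F w - real p)\<^sup>2)"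
      by (rule order_trans[OF abs_ge_self L2_Cauchy_Schwarz]) (intro HP_L2[where N = N and S = UNIV] PA_intros FU)+
    also have "\<dots> \<le> sqrt K * (real (2 * p + 1) * 3 ^ (2 * p) * \<E> (\<lambda>w. (Gm N F F w - real p)\<^sup>2))"
      by (intro mult_mono k1 k2 hypercontractive_le[OF Gm] L2_norm_nonneg)
    also have "\<dots> = C * \<E> (\<lambda>w. (Gm N F F w - real p)\<^sup>2)" by (simp add: C_def)
    also have "\<E> (\<lambda>w. (Gm N F F w - real p)\<^sup>2) = wiener.variance (Gm N F F) + (real p * (\<E> (\<lambda>w. (F w)\<^sup>2) - 1))\<^sup>2"
      by (subst variance_shift[OF HP_L2[OF HP_Gm[OF F F]]])
         (simp add: expectation_Gm_self[OF F] algebra_simps)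
    finally show "\<E> (\<lambda>w. (LL N (\<lambda>w. poly (hermite k) (F w)) w + real (k * p) * poly (hermite k) (F w))\<^sup>2)
     \<le> C * (wiener.variance (Gm N F F) + (real p * (\<E> (\<lambda>w. (F w)\<^sup>2) - 1))\<^sup>2)" .
  qed
qed

section \<open>Directional influence of polynomials\<close>

text \<open>Multiplication by x minus differentiation, which raises H_n to H_(n+1), is the Gaussian
  adjoint of differentiation.\<close>

lemma std_normal_hermite_Suc_mult:
  "(LINT x|std_normal_distribution. poly (hermite (Suc n)) x * poly q x)
     = (LINT x|std_normal_distribution. poly (hermite n) x * poly (pderiv q) x)"
proof -
  have i: "integrable std_normal_distribution (\<lambda>x. poly a x * poly b x)" for a b
    using integrable_std_normal_poly[of "a * b"] by simp
  have j: "integrable std_normal_distribution (\<lambda>x. x * (poly a x * poly b x))" for a b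
    using integrable_std_normal_poly[of "[:0, 1:] * (a * b)"] by simp
  have "(LINT x|std_normal_distribution. poly (hermite (Suc n)) x * poly q x)
      = (LINT x|std_normal_distribution. x * (poly (hermite n) x * poly q x) - poly (pderiv (hermite n)) x * poly q x)"
    by (simp add: algebra_simps)
  also have "\<dots> = (LINT x|std_normal_distribution. x * poly (hermite n * q) x) - (LINT x|std_normal_distribution. poly (pderiv (hermite n)) x * poly q x)"
    by (simp add: i j)
  also have "\<dots> = (LINT x|std_normal_distribution. poly (pderiv (hermite n * q)) x) - (LINT x|std_normal_distribution. poly (pderiv (hermite n)) x * poly q x)"
    by (simp only: std_normal_ibp)
  also have "\<dots> = (LINT x|std_normal_distribution. poly (hermite n) x * poly (pderiv q) x)"
    by (simp add: i pderiv_mult mult.commute)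
  finally show ?thesis .
qed

lemma std_normal_hermite_square:
  "(LINT x|std_normal_distribution. (poly (hermite n) x)\<^sup>2) = fact n"
proof (induction n)
  case 0
  interpret prob_space std_normal_distribution
    by (rule prob_space_normal_density) simp
  show ?case using prob_space by simp
next
  case (Suc n)
  have "(LINT x|std_normal_distribution. (poly (hermite (Suc n)) x)\<^sup>2)
      = (LINT x|std_normal_distribution. poly (hermite n) x * poly (pderiv (hermite (Suc n))) x)"
    unfolding power2_eq_square std_normal_hermite_Suc_mult ..
  also have "pderiv (hermite (Suc n)) = smult (real (Suc n)) (hermite n)"
    using pderiv_hermite[of "Suc n"] by (simp del: hermite.simps)
  also have "(LINT x|std_normal_distribution. poly (hermite n) x * poly (smult (real (Suc n)) (hermite n)) x)
     = real (Suc n) * (LINT x|std_normal_distribution. (poly (hermite n) x)\<^sup>2)"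
    by (subst integral_mult_right_zero[symmetric]) (simp add: power2_eq_square mult_ac)
  finally show ?case using Suc by simp
qed

text \<open>Coordinate \<open>N\<close> does not occur in \<open>hp N k\<close>, so it enters as one
  more independent factor of the finite product.\<close>

lemma expectation_hp_mult_fresh:
  "\<E> (\<lambda>w. hp N k w * poly q (w N)) = \<E> (hp N k) * (LINT x|std_normal_distribution. poly q x)"
  "integrable wiener_space (\<lambda>w. hp N k w * poly q (w N))"
proof -
  let ?f = "\<lambda>i. if i < N then poly (hermite (k i)) else poly q"
  have i: "integrable std_normal_distribution (?f i)" for i
    by (simp add: integrable_std_normal_poly)
  have eq: "(\<Prod>i<Suc N. ?f i (w i)) = hp N k w * poly q (w N)" for w
    by (simp add: hp_def)
  have "\<E> (\<lambda>w. hp N k w * poly q (w N)) = (\<Prod>i<Suc N. integral\<^sup>L std_normal_distribution (?f i))"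
    unfolding eq[symmetric] by (rule expectation_wiener_prod[OF i])
  also have "\<dots> = (\<Prod>i<N. integral\<^sup>L std_normal_distribution (\<lambda>x. poly (hermite (k i)) x)) * (LINT x|std_normal_distribution. poly q x)"
    by simp
  also have "(\<Prod>i<N. integral\<^sup>L std_normal_distribution (\<lambda>x. poly (hermite (k i)) x)) = \<E> (hp N k)"
    unfolding hp_def[abs_def] by (rule expectation_wiener_prod[OF integrable_std_normal_poly, symmetric])
  finally show "\<E> (\<lambda>w. hp N k w * poly q (w N)) = \<E> (hp N k) * (LINT x|std_normal_distribution. poly q x)" .
  show "integrable wiener_space (\<lambda>w. hp N k w * poly q (w N))"
    unfolding eq[symmetric] by (rule integrable_wiener_prod[OF i])
qed

lemma expectation_mult_fresh:
  assumes "A \<in> HP N S"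
  shows "integrable wiener_space (\<lambda>w. A w * poly q (w N)) \<and>
     \<E> (\<lambda>w. A w * poly q (w N)) = \<E> A * (LINT x|std_normal_distribution. poly q x)"
  using assms
proof (induction rule: HP.induct)
  case (step k F c)
  have "(c * hp N k w + F w) * poly q (w N) = c * (hp N k w * poly q (w N)) + F w * poly q (w N)" for w
    by (simp add: algebra_simps)
  then show ?case
    using step.IH expectation_hp_mult_fresh[of N k q] HP_integrable[OF step.hyps(2)]
    by (simp only:) (simp add: integrable_hp distrib_right)
qed simp

lemma HP_mult_fresh:
  "X \<in> HP N {q} \<Longrightarrow> (\<lambda>w. X w * poly (hermite r) (w N)) \<in> HP (Suc N) {q + r}"
proof (induction rule: HP.induct)
  case zero
  show ?case using HP.zero by simp
next
  case (step k F c)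
  have "hp (Suc N) (k(N := r)) w = hp N k w * poly (hermite r) (w N)" for w
    by (simp add: hp_def)
  moreover have "(\<lambda>w. c * hp (Suc N) (k(N := r)) w + F w * poly (hermite r) (w N)) \<in> HP (Suc N) {q + r}"
    using step by (intro HP.step) auto
  ultimately show ?case by (simp add: algebra_simps)
qed

lemma HP_Suc: "F \<in> HP N S \<Longrightarrow> F \<in> HP (Suc N) S"
proof (induction rule: HP.induct)
  case (step k F c)
  \<comment> \<open>Entry \<open>N\<close> of the multi-index was arbitrary as long as only
    coordinates below \<open>N\<close> counted; it has to be reset when the range grows.\<close>
  have "hp (Suc N) (k(N := 0)) = hp N k"
    by (simp add: hp_def fun_eq_iff)
  moreover have "(\<lambda>w. c * hp (Suc N) (k(N := 0)) w + F w) \<in> HP (Suc N) S"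
    using step by (intro HP.step) auto
  ultimately show ?case by simp
qed (rule HP.zero)

lemma HP_mono_N: "N \<le> M \<Longrightarrow> F \<in> HP N S \<Longrightarrow> F \<in> HP M S"
  by (induction rule: dec_induct) (auto intro: HP_Suc)

lemma HP_fresh: "F \<in> HP N S \<Longrightarrow> F (fun_upd w N x) = F w"
  by (induction rule: HP.induct) (auto simp: hp_def)

lemma pd_fresh: "F \<in> HP N S \<Longrightarrow> pd N F = (\<lambda>w. 0)"
  by (simp add: pd_def[abs_def] HP_fresh)

lemma L2_norm_mult_fresh:
  assumes "A \<in> HP N S"
  shows "L2_norm (\<lambda>w. A w * poly (hermite r) (w N)) = L2_norm A * sqrt (fact r)"
proof -
  have "(A w * poly (hermite r) (w N))\<^sup>2 = (A w)\<^sup>2 * poly ((hermite r)\<^sup>2) (w N)" for w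
    by (simp add: power_mult_distrib)
  then have "\<E> (\<lambda>w. (A w * poly (hermite r) (w N))\<^sup>2) = \<E> (\<lambda>w. (A w)\<^sup>2) * fact r"
    using expectation_mult_fresh[OF HP_power_UNIV[OF assms, of 2], of "(hermite r)\<^sup>2"] std_normal_hermite_square[of r]
    by (simp add: poly_power)
  then show ?thesis by (simp add: L2_norm_def real_sqrt_mult)
qed

text \<open>\<open>F\<close> does not depend on coordinate \<open>N\<close>, so the only summand
  that would differentiate \<open>q\<close> vanishes.\<close>

lemma Gm_fresh:
  assumes F: "F \<in> HP N S" and X: "X \<in> HP N T"
  shows "Gm (Suc N) F (\<lambda>w. X w * poly q (w N)) = (\<lambda>w. Gm N F X w * poly q (w N))"
proof
  fix w
  have "pd i (\<lambda>w. X w * poly q (w N)) w = pd i X w * poly q (w N)" if i: "i < N" for i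
  proof -
    have "((\<lambda>x. X (fun_upd w i x) * poly q (w N)) has_field_derivative pd i X w * poly q (w N)) (at (w i))"
      by (intro DERIV_cmult_right HP_has_pd[OF X i])
    then show ?thesis
      unfolding pd_def[of i "\<lambda>w. X w * poly q (w N)"] using i by (subst DERIV_imp_deriv) auto
  qed
  then show "Gm (Suc N) F (\<lambda>w. X w * poly q (w N)) w = Gm N F X w * poly q (w N)"
    by (simp add: Gm_def pd_fresh[OF F] sum_distrib_right mult.assoc)
qed

text \<open>The test function is \<open>X\<close> times H_(q-q') of coordinate \<open>N\<close>; its
  norm factor sqrt((q-q')!) appears on both sides and cancels. This is why the hypothesis lives on
  \<open>Suc N\<close> coordinates.\<close>

lemma Gm_bound_lower_degree:
  assumes F: "F \<in> HP N {p}" and X: "X \<in> HP N {q'}" and "q' \<le> q"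
    and bound: "\<And>Z. Z \<in> HP (Suc N) {q} \<Longrightarrow> L2_norm (Gm (Suc N) F Z) \<le> \<epsilon> * L2_norm Z"
  shows "L2_norm (Gm N F X) \<le> \<epsilon> * L2_norm X"
proof -
  let ?r = "q - q'"
  have "(\<lambda>w. X w * poly (hermite ?r) (w N)) \<in> HP (Suc N) {q}"
    using HP_mult_fresh[OF X, of ?r] \<open>q' \<le> q\<close> by simp
  from bound[OF this] have "L2_norm (Gm N F X) * sqrt (fact ?r) \<le> \<epsilon> * (L2_norm X * sqrt (fact ?r))"
    unfolding Gm_fresh[OF F X] L2_norm_mult_fresh[OF HP_Gm[OF F X]] L2_norm_mult_fresh[OF X] .
  then have "L2_norm (Gm N F X) * sqrt (fact ?r) \<le> (\<epsilon> * L2_norm X) * sqrt (fact ?r)"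
    by (simp add: mult.assoc)
  then show ?thesis by (rule mult_right_le_imp_le) simp
qed

section \<open>Expectations of products of three chaos elements\<close>

lemma Gm_mult_expectation:
  assumes "U \<in> HP N UNIV" "Z \<in> HP N UNIV" "F \<in> HP N UNIV"
  shows "\<E> (\<lambda>w. Gm N U Z w * F w) = (\<Sum>i<N. \<E> (\<lambda>w. pd i U w * pd i Z w * F w))"
  unfolding Gm_def sum_distrib_right
  by (intro Bochner_Integration.integral_sum HP_integrable[where N = N and S = UNIV] PA_intros assms) auto

text \<open>Differentiating \<open>U\<close> and \<open>Z\<close> keeps the parity of a + c + p, and
  as this is odd, the factor a + c - p is never 0. Once one order has dropped to 0, the other
  differs from p and orthogonality concludes.\<close>

lemma triple_odd_zero:
  assumes F: "F \<in> HP N {p}"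
  shows "U \<in> HP N {a} \<Longrightarrow> Z \<in> HP N {c} \<Longrightarrow> odd (a + c + p) \<Longrightarrow> \<E> (\<lambda>w. U w * Z w * F w) = 0"
proof (induction a arbitrary: U Z c)
  case 0
  then obtain b where "U = (\<lambda>w. b)" using HP_0_const by blast
  moreover have "\<E> (\<lambda>w. Z w * F w) = 0"
    using 0 by (intro HP_orthogonal[OF _ F]) auto
  ultimately show ?case by (simp add: mult.assoc)
next
  case (Suc a)
  show ?case
  proof (cases c)
    case 0
    then obtain b where "Z = (\<lambda>w. b)" using HP_0_const Suc.prems by blast
    moreover have "\<E> (\<lambda>w. U w * F w) = 0"
      using Suc.prems 0 by (intro HP_orthogonal[OF _ F]) auto
    ultimately show ?thesis by (simp add: mult.assoc mult.left_commute[of _ b])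
  next
    case (Suc c')
    have U: "U \<in> HP N {Suc a}" and Z: "Z \<in> HP N {Suc c'}" using Suc.prems \<open>c = Suc c'\<close> by auto
    have "\<E> (\<lambda>w. Gm N U Z w * F w) = 0"
      unfolding Gm_mult_expectation[OF HP_UNIV[OF U] HP_UNIV[OF Z] HP_UNIV[OF F]]
    proof (intro sum.neutral ballI)
      fix i assume "i \<in> {..<N}"
      then show "\<E> (\<lambda>w. pd i U w * pd i Z w * F w) = 0"
        using Suc.prems \<open>c = Suc c'\<close> by (intro Suc.IH[of _ _ c'] HP_pd_Suc[OF U] HP_pd_Suc[OF Z]) auto
    qed
    moreover have "real (Suc a) + real (Suc c') - real p \<noteq> 0"
    proof
      assume "real (Suc a) + real (Suc c') - real p = 0"
      then have "real (Suc a + Suc c') = real p" by simp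
      then have "Suc a + c = p" unfolding of_nat_eq_iff \<open>c = Suc c'\<close> .
      then show False using Suc.prems(3) by auto
    qed
    ultimately show ?thesis
      using expectation_triple[OF U Z F] by simp
  qed
qed

text \<open>Each use of \<open>expectation_triple\<close> takes one derivative of \<open>U\<close>
  and one of \<open>Z\<close>, and Cauchy-Schwarz over the coordinates costs sqrt(a c). After
  \<open>s\<close> uses the orders add up to p; \<open>s < a\<close> and \<open>s < c\<close> keep
  both at least 1, so the smaller one is in the range of \<open>bound\<close>.\<close>

lemma triple_bound:
  assumes F: "F \<in> HP N {p}" and "\<epsilon> \<ge> 0"
    and bound: "\<And>c Z. 1 \<le> c \<Longrightarrow> c \<le> p div 2 \<Longrightarrow> Z \<in> HP N {c} \<Longrightarrow> L2_norm (Gm N F Z) \<le> \<epsilon> * L2_norm Z"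
  shows "U \<in> HP N {a} \<Longrightarrow> Z \<in> HP N {c} \<Longrightarrow> a + c = p + 2 * s \<Longrightarrow> s < a \<Longrightarrow> s < c \<Longrightarrow>
    \<bar>\<E> (\<lambda>w. U w * Z w * F w)\<bar> \<le> real ((a * c) ^ s) * \<epsilon> * (L2_norm U * L2_norm Z)"
proof (induction s arbitrary: a c U Z)
  case 0
  have base: "\<bar>\<E> (\<lambda>w. F w * Z w * U w)\<bar> \<le> \<epsilon> * (L2_norm U * L2_norm Z)"
    if U: "U \<in> HP N {a}" and Z: "Z \<in> HP N {c}" and ac: "a + c = p" "1 \<le> c" "c \<le> p div 2" for U Z a c
  proof -
    \<comment> \<open>For orders adding up to p the factor belonging to the pair \<open>U\<close>,
      \<open>Z\<close> is 0. Pairing \<open>Z\<close> with \<open>F\<close> instead gives the factor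
      2c.\<close>
    have "2 * \<E> (\<lambda>w. Gm N F Z w * U w) = (real p + real c - real a) * \<E> (\<lambda>w. F w * Z w * U w)"
      by (rule expectation_triple[OF F Z U])
    also have "real p + real c - real a = 2 * real c" using ac(1) by auto
    finally have "\<E> (\<lambda>w. Gm N F Z w * U w) = real c * \<E> (\<lambda>w. F w * Z w * U w)" by simp
    then have "real c * \<bar>\<E> (\<lambda>w. F w * Z w * U w)\<bar> = \<bar>\<E> (\<lambda>w. Gm N F Z w * U w)\<bar>"
      by (simp add: abs_mult)
    moreover have "1 * \<bar>\<E> (\<lambda>w. F w * Z w * U w)\<bar> \<le> real c * \<bar>\<E> (\<lambda>w. F w * Z w * U w)\<bar>"
      using ac(2) by (intro mult_right_mono) auto
    moreover have "\<bar>\<E> (\<lambda>w. Gm N F Z w * U w)\<bar> \<le> L2_norm (Gm N F Z) * L2_norm U"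
      by (intro L2_Cauchy_Schwarz HP_L2[OF U] HP_L2[OF HP_Gm[OF F Z]])
    moreover have "L2_norm (Gm N F Z) * L2_norm U \<le> (\<epsilon> * L2_norm Z) * L2_norm U"
      by (intro mult_right_mono bound[OF ac(2,3) Z] L2_norm_nonneg)
    ultimately show ?thesis by (simp add: mult_ac)
  qed
  show ?case
  proof (cases "c \<le> p div 2")
    case True
    then show ?thesis using base[of U a Z c] 0 by (simp add: mult_ac)
  next
    case False
    then have "a \<le> p div 2" using 0 by auto
    then show ?thesis using base[of Z c U a] 0 by (simp add: mult_ac add.commute)
  qed
next
  case (Suc s)
  obtain a' c' where a: "a = Suc a'" and c: "c = Suc c'"
    using Suc.prems(4,5) by (metis Suc_lessE)
  have U: "U \<in> HP N {Suc a'}" and Z: "Z \<in> HP N {Suc c'}" using Suc.prems a c by auto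
  have deg: "a' + c' = p + 2 * s" "s < a'" "s < c'" using Suc.prems(3-5) unfolding a c by simp_all
  let ?K = "real ((a' * c') ^ s) * \<epsilon>"
  have eq: "real (Suc s) * \<E> (\<lambda>w. U w * Z w * F w) = (\<Sum>i<N. \<E> (\<lambda>w. pd i U w * pd i Z w * F w))"
  proof -
    have "real (Suc a') + real (Suc c') - real p = 2 * real (Suc s)"
    proof -
      have "real (Suc a') + real (Suc c') = real p + 2 * real (Suc s)"
        using Suc.prems(3) unfolding a c by (metis of_nat_add of_nat_mult of_nat_numeral)
      then show ?thesis by simp
    qed
    from expectation_triple[OF U Z F, unfolded this Gm_mult_expectation[OF HP_UNIV[OF U] HP_UNIV[OF Z] HP_UNIV[OF F]]]
    show ?thesis by (simp only: mult.assoc mult_cancel_left) simp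
  qed
  have "1 * \<bar>\<E> (\<lambda>w. U w * Z w * F w)\<bar> \<le> real (Suc s) * \<bar>\<E> (\<lambda>w. U w * Z w * F w)\<bar>"
    by (intro mult_right_mono) simp_all
  also have "\<dots> = \<bar>\<Sum>i<N. \<E> (\<lambda>w. pd i U w * pd i Z w * F w)\<bar>"
    unfolding eq[symmetric] by (simp add: abs_mult)
  also have "\<dots> \<le> (\<Sum>i<N. \<bar>\<E> (\<lambda>w. pd i U w * pd i Z w * F w)\<bar>)"
    by (rule sum_abs)
  also have "\<dots> \<le> (\<Sum>i<N. ?K * (\<bar>L2_norm (pd i U)\<bar> * \<bar>L2_norm (pd i Z)\<bar>))"
  proof (rule sum_mono)
    fix i assume "i \<in> {..<N}"
    then have i: "i < N" by simp
    show "\<bar>\<E> (\<lambda>w. pd i U w * pd i Z w * F w)\<bar> \<le> ?K * (\<bar>L2_norm (pd i U)\<bar> * \<bar>L2_norm (pd i Z)\<bar>)"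
      using Suc.IH[OF HP_pd_Suc[OF U i] HP_pd_Suc[OF Z i] deg]
      by (simp only: abs_of_nonneg[OF L2_norm_nonneg])
  qed
  also have "\<dots> = ?K * (\<Sum>i<N. \<bar>L2_norm (pd i U)\<bar> * \<bar>L2_norm (pd i Z)\<bar>)"
    by (simp only: sum_distrib_left)
  also have "\<dots> \<le> ?K * (L2_set (\<lambda>i. L2_norm (pd i U)) {..<N} * L2_set (\<lambda>i. L2_norm (pd i Z)) {..<N})"
    using \<open>\<epsilon> \<ge> 0\<close> by (intro mult_left_mono L2_set_mult_ineq) auto
  also have "L2_set (\<lambda>i. L2_norm (pd i U)) {..<N} = sqrt (real a) * L2_norm U"
    using sum_expectation_pd_square[OF U] by (simp add: L2_set_def L2_norm_square L2_norm_def[of U] a real_sqrt_mult)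
  also have "L2_set (\<lambda>i. L2_norm (pd i Z)) {..<N} = sqrt (real c) * L2_norm Z"
    using sum_expectation_pd_square[OF Z] by (simp add: L2_set_def L2_norm_square L2_norm_def[of Z] c real_sqrt_mult)
  also have "?K * (sqrt (real a) * L2_norm U * (sqrt (real c) * L2_norm Z))
      = (real ((a' * c') ^ s) * sqrt (real (a * c))) * \<epsilon> * (L2_norm U * L2_norm Z)"
    by (simp add: real_sqrt_mult mult_ac)
  also have "\<dots> \<le> real ((a * c) ^ Suc s) * \<epsilon> * (L2_norm U * L2_norm Z)"
  proof (intro mult_right_mono mult_nonneg_nonneg L2_norm_nonneg \<open>\<epsilon> \<ge> 0\<close>)
    \<comment> \<open>Both \<open>a\<close> and \<open>c\<close> are at least 1, so the square root
      may be dropped.\<close>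
    have "sqrt (real (a * c)) \<le> real (a * c)"
      by (rule real_le_lsqrt) (auto simp: a c power2_eq_square simp flip: of_nat_mult)
    moreover have "real ((a' * c') ^ s) \<le> real ((a * c) ^ s)"
      unfolding of_nat_le_iff a c by (intro power_mono mult_mono) auto
    ultimately show "real ((a' * c') ^ s) * sqrt (real (a * c)) \<le> real ((a * c) ^ Suc s)"
      using mult_mono[of "real ((a' * c') ^ s)" "real ((a * c) ^ s)" "sqrt (real (a * c))" "real (a * c)"]
      by (simp add: mult_ac)
  qed
  finally show ?case by simp
qed

text \<open>\<open>triple_bound\<close> with \<open>U = F\<close> and \<open>Z = g m\<close>, since
  E (F g_m F) = E g_m^2; dividing by the norm of g_m bounds it by a multiple of that of F. The
  factor 2 p^3 collects 2p summands with variance weights at most p^2.\<close>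

lemma variance_Gm_le_influence:
  assumes F: "F \<in> HP N {p}" and "\<epsilon> \<ge> 0"
    and bound: "\<And>c Z. 1 \<le> c \<Longrightarrow> c \<le> p div 2 \<Longrightarrow> Z \<in> HP N {c} \<Longrightarrow> L2_norm (Gm N F Z) \<le> \<epsilon> * L2_norm Z"
  shows "wiener.variance (Gm N F F) \<le> 2 * real p ^ 3 * (real ((2 * p * p) ^ p) * \<epsilon>)\<^sup>2 * \<E> (\<lambda>w. (F w)\<^sup>2)"
proof -
  from square_components[OF F] obtain g where g: "\<And>m. g m \<in> HP N {m}"
    "\<And>w. (F w)\<^sup>2 = (\<Sum>m\<le>2*p. g m w)" "g 0 = (\<lambda>w. \<E> (\<lambda>w. (F w)\<^sup>2))"
    "\<And>w. Gm N F F w = (\<Sum>m\<le>2*p. (real p - real m / 2) * g m w)" by blast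
  let ?K = "real ((2 * p * p) ^ p) * \<epsilon>"
  have g_bound: "\<E> (\<lambda>w. (g m w)\<^sup>2) \<le> ?K\<^sup>2 * \<E> (\<lambda>w. (F w)\<^sup>2)" if m: "1 \<le> m" "m < 2 * p" for m
  proof -
    have "\<E> (\<lambda>w. F w * g m w * F w) = \<E> (\<lambda>w. (\<Sum>n\<le>2*p. 1 * g n w) * (\<Sum>n\<le>2*p. (if n = m then 1 else 0) * g n w))"
    proof (intro Bochner_Integration.integral_cong refl)
      fix w
      have "(\<Sum>n\<le>2*p. (if n = m then 1 else 0) * g n w) = (\<Sum>n\<le>2*p. if n = m then g m w else 0)"
        by (intro sum.cong) auto
      also have "\<dots> = g m w" using m by simp
      finally show "F w * g m w * F w = (\<Sum>n\<le>2*p. 1 * g n w) * (\<Sum>n\<le>2*p. (if n = m then 1 else 0) * g n w)"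
        using g(2)[of w] by (simp add: power2_eq_square mult_ac)
    qed
    also have "\<dots> = (\<Sum>n\<le>2*p. if n = m then \<E> (\<lambda>w. g m w * g m w) else 0)"
      unfolding expectation_components_mult[OF g(1) g(1)] by (intro sum.cong) auto
    also have "\<dots> = (L2_norm (g m))\<^sup>2"
      unfolding L2_norm_square using m by (simp add: power2_eq_square)
    finally have eq: "\<E> (\<lambda>w. F w * g m w * F w) = (L2_norm (g m))\<^sup>2" .
    have "L2_norm (g m) \<le> ?K * L2_norm F"
    proof (cases "even m")
      case False
      then have "\<E> (\<lambda>w. F w * g m w * F w) = 0"
        by (intro triple_odd_zero[OF F F g(1)]) auto
      then show ?thesis using eq \<open>\<epsilon> \<ge> 0\<close> by (simp add: L2_norm_nonneg)
    next
      case True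
      \<comment> \<open>The orders p and m add up to p + 2s, so \<open>s\<close> is also the number
        of derivatives taken in \<open>triple_bound\<close>.\<close>
      then obtain s where s: "m = 2 * s" by (elim evenE)
      have sp: "1 \<le> s" "s < p" using m s by auto
      have "(L2_norm (g m))\<^sup>2 \<le> real ((p * m) ^ s) * \<epsilon> * (L2_norm F * L2_norm (g m))"
        unfolding eq[symmetric]
      proof (rule order_trans[OF abs_ge_self triple_bound[OF F \<open>\<epsilon> \<ge> 0\<close>]])
        show "F \<in> HP N {p}" "g m \<in> HP N {m}" by (fact F g(1))+
      qed (use bound sp s in auto)
      also have "\<dots> \<le> ?K * (L2_norm F * L2_norm (g m))"
      proof (intro mult_right_mono mult_nonneg_nonneg L2_norm_nonneg \<open>\<epsilon> \<ge> 0\<close>)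
        have "(p * m) ^ s \<le> (2 * p * p) ^ s"
          using sp s by (intro power_mono) auto
        also have "\<dots> \<le> (2 * p * p) ^ p"
          using sp by (intro power_increasing) auto
        finally show "real ((p * m) ^ s) \<le> real ((2 * p * p) ^ p)" unfolding of_nat_le_iff .
      qed
      finally have *: "L2_norm (g m) * L2_norm (g m) \<le> L2_norm (g m) * (?K * L2_norm F)"
        by (simp add: power2_eq_square mult_ac)
      show ?thesis
      proof (cases "L2_norm (g m) = 0")
        case True
        then show ?thesis using \<open>\<epsilon> \<ge> 0\<close> by (simp add: L2_norm_nonneg)
      next
        case False
        then have "0 < L2_norm (g m)" using L2_norm_nonneg less_le by metis
        with * show ?thesis by (rule mult_left_le_imp_le)
      qed
    qed
    then have "(L2_norm (g m))\<^sup>2 \<le> (?K * L2_norm F)\<^sup>2" by (intro power_mono L2_norm_nonneg)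
    then show ?thesis by (simp add: L2_norm_square[symmetric] power_mult_distrib)
  qed
  have "wiener.variance (Gm N F F) = (\<Sum>m=1..2*p. (real p - real m / 2)\<^sup>2 * \<E> (\<lambda>w. (g m w)\<^sup>2))"
    by (rule variance_Gm_components[OF F g(1,3,4)])
  also have "\<dots> \<le> (\<Sum>m=1..2*p. (real p)\<^sup>2 * (?K\<^sup>2 * \<E> (\<lambda>w. (F w)\<^sup>2)))"
  proof (rule sum_mono)
    fix m assume m: "m \<in> {1..2*p}"
    show "(real p - real m / 2)\<^sup>2 * \<E> (\<lambda>w. (g m w)\<^sup>2) \<le> (real p)\<^sup>2 * (?K\<^sup>2 * \<E> (\<lambda>w. (F w)\<^sup>2))"
    proof (cases "m = 2 * p")
      case True
      then show ?thesis by simp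
    next
      case False
      then have "m < 2 * p" "1 \<le> m" using m by auto
      moreover from this have "real m \<le> 2 * real p" by linarith
      ultimately show ?thesis
        by (intro mult_mono power_mono g_bound) auto
    qed
  qed
  also have "\<dots> = 2 * real p ^ 3 * ?K\<^sup>2 * \<E> (\<lambda>w. (F w)\<^sup>2)"
    by (simp add: power2_eq_square power3_eq_cube)
  finally show ?thesis .
qed

section \<open>Completeness and convergence in all moments\<close>

lemma hermite_span_step:
  assumes "F \<in> hermite_span p" "k \<in> multi_indices p"
  shows "(\<lambda>w. a * hermite_prod k w + F w) \<in> hermite_span p"
proof -
  obtain A c where A: "finite A" "A \<subseteq> multi_indices p" "F = (\<lambda>w. \<Sum>k\<in>A. c k * hermite_prod k w)"
    using assms(1) by (auto simp: hermite_span_def)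
  \<comment> \<open>If \<open>k\<close> already lies in \<open>A\<close>, the new coefficient is
    added to the old one.\<close>
  define c' where "c' = (\<lambda>l. (if l = k then a else 0) + (if l \<in> A then c l else 0))"
  have "(\<Sum>l\<in>insert k A. c' l * hermite_prod l w) = a * hermite_prod k w + F w" for w
  proof -
    have "(\<Sum>l\<in>insert k A. c' l * hermite_prod l w)
       = (\<Sum>l\<in>insert k A. if l = k then a * hermite_prod k w else 0) + (\<Sum>l\<in>insert k A. if l \<in> A then c l * hermite_prod l w else 0)"
      by (subst sum.distrib[symmetric], intro sum.cong) (auto simp: c'_def distrib_right)
    also have "(\<Sum>l\<in>insert k A. if l = k then a * hermite_prod k w else 0) = a * hermite_prod k w"
      using A(1) by simp
    also have "(\<Sum>l\<in>insert k A. if l \<in> A then c l * hermite_prod l w else 0) = (\<Sum>l\<in>A. c l * hermite_prod l w)"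
      using A(1) by (intro sum.mono_neutral_cong_right) auto
    finally show ?thesis by (simp add: A(3))
  qed
  moreover have "finite (insert k A)" "insert k A \<subseteq> multi_indices p" using A assms(2) by auto
  ultimately show ?thesis unfolding hermite_span_def by (auto intro!: exI[of _ "insert k A"] exI[of _ c'])
qed

lemma HP_hermite_span: "F \<in> HP N {p} \<Longrightarrow> F \<in> hermite_span p"
proof (induction rule: HP.induct)
  case zero
  show ?case unfolding hermite_span_def by (auto intro!: exI[of _ "{}"])
next
  case (step k F c)
  \<comment> \<open>\<open>hermite_prod\<close> sees all entries of a multi-index while
    \<open>hp\<close> ignores those from \<open>N\<close> on, so these are cut off.\<close>
  define k' where "k' i = (if i < N then k i else 0)" for i
  have s: "{i. k' i \<noteq> 0} \<subseteq> {..<N}" by (auto simp: k'_def)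
  have "(\<Sum>i | k' i \<noteq> 0. k' i) = (\<Sum>i<N. k' i)"
    using s by (intro sum.mono_neutral_left) auto
  also have "\<dots> = p" using step.hyps(1) by (simp add: k'_def)
  finally have "k' \<in> multi_indices p"
    using finite_subset[OF s] by (simp add: multi_indices_def)
  moreover have "hermite_prod k' w = hp N k w" for w
  proof -
    have "hermite_prod k' w = (\<Prod>i<N. poly (hermite (k' i)) (w i))"
      unfolding hermite_prod_def using s by (intro prod.mono_neutral_left) auto
    then show ?thesis by (simp add: k'_def hp_def)
  qed
  ultimately show ?case using hermite_span_step[OF step.IH, of k' c] by simp
qed

lemma hermite_prod_HP:
  assumes "k \<in> multi_indices p"
  shows "\<exists>N. hermite_prod k \<in> HP N {p}"
proof -
  have "finite {i. k i \<noteq> 0}" using assms by (simp add: multi_indices_def)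
  then obtain N where N: "{i. k i \<noteq> 0} \<subseteq> {..<N}" using finite_nat_iff_bounded by blast
  have "(\<Sum>i<N. k i) = (\<Sum>i | k i \<noteq> 0. k i)"
    using N by (intro sum.mono_neutral_right) auto
  then have "(\<Sum>i<N. k i) = p" using assms by (simp add: multi_indices_def)
  moreover have "hermite_prod k = hp N k"
    unfolding hermite_prod_def[abs_def] hp_def[abs_def] using N
    by (intro ext prod.mono_neutral_left) auto
  ultimately show ?thesis using HP_hp[of k N "{p}"] by auto
qed

lemma hermite_span_HP:
  assumes "F \<in> hermite_span p"
  shows "\<exists>N. F \<in> HP N {p}"
proof -
  obtain A c where A: "finite A" "A \<subseteq> multi_indices p" "F = (\<lambda>w. \<Sum>k\<in>A. c k * hermite_prod k w)"
    using assms by (auto simp: hermite_span_def)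
  have "\<exists>N. (\<lambda>w. \<Sum>k\<in>A. c k * hermite_prod k w) \<in> HP N {p}"
    using A(1,2)
  proof (induction A rule: finite_induct)
    case empty
    show ?case by (auto intro: HP.zero)
  next
    case (insert k A)
    obtain N M where "hermite_prod k \<in> HP N {p}" "(\<lambda>w. \<Sum>k\<in>A. c k * hermite_prod k w) \<in> HP M {p}"
      using insert hermite_prod_HP[of k p] by auto
    then have "hermite_prod k \<in> HP (max N M) {p}" "(\<lambda>w. \<Sum>k\<in>A. c k * hermite_prod k w) \<in> HP (max N M) {p}"
      using HP_mono_N[of N "max N M"] HP_mono_N[of M "max N M"] by auto
    then have "(\<lambda>w. c k * hermite_prod k w + (\<Sum>k\<in>A. c k * hermite_prod k w)) \<in> HP (max N M) {p}"
      by (intro HP_add HP_cmult)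
    then show ?case using insert by auto
  qed
  then show ?thesis by (simp add: A(3))
qed

text \<open>Takes the place of dominated convergence: for the approximants only uniform bounds on
  expectations are at hand.\<close>

lemma fatou_bound:
  fixes u :: "nat \<Rightarrow> (nat \<Rightarrow> real) \<Rightarrow> real"
  assumes u: "\<And>i. integrable wiener_space (u i)" "\<And>i w. 0 \<le> u i w" "\<And>i. \<E> (u i) \<le> B"
    and v: "v \<in> borel_measurable wiener_space"
    and lim: "AE w in wiener_space. (\<lambda>i. u i w) \<longlonglongrightarrow> v w"
  shows "integrable wiener_space v \<and> \<E> v \<le> B"
proof -
  have [measurable]: "u i \<in> borel_measurable wiener_space" for i using u(1) by auto
  have vnn: "AE w in wiener_space. 0 \<le> v w"
    using lim by eventually_elim (auto intro: LIMSEQ_le_const simp: u(2))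
  have B: "0 \<le> B" using u(2) by (intro order_trans[OF Bochner_Integration.integral_nonneg u(3)[of 0]]) auto
  have "(\<integral>\<^sup>+w. ennreal (v w) \<partial>wiener_space) = (\<integral>\<^sup>+w. liminf (\<lambda>i. ennreal (u i w)) \<partial>wiener_space)"
    using lim by (intro nn_integral_cong_AE, eventually_elim) (auto intro!: lim_imp_Liminf[symmetric] tendsto_ennrealI)
  also have "\<dots> \<le> liminf (\<lambda>i. \<integral>\<^sup>+w. ennreal (u i w) \<partial>wiener_space)"
    by (intro nn_integral_liminf) auto
  also have "\<dots> \<le> liminf (\<lambda>i::nat. ennreal B)"
    by (intro Liminf_mono always_eventually allI) (simp add: nn_integral_eq_integral u ennreal_leI)
  also have "\<dots> = ennreal B" by (simp add: Liminf_const)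
  finally have le: "(\<integral>\<^sup>+w. ennreal (v w) \<partial>wiener_space) \<le> ennreal B" .
  then have i: "integrable wiener_space v"
    using v vnn by (intro integrableI_nonneg) (auto intro: le_less_trans simp: le_less_trans[OF _ ennreal_less_top])
  moreover have "ennreal (\<E> v) \<le> ennreal B"
    using le by (simp add: nn_integral_eq_integral[OF i vnn])
  ultimately show ?thesis using B by simp
qed

lemma L2_tendsto_AE_subseq:
  assumes "\<And>j. f j \<in> L2_space" "F \<in> L2_space" "(\<lambda>j. L2_norm (\<lambda>w. f j w - F w)) \<longlonglongrightarrow> 0"
  shows "\<exists>r. strict_mono r \<and> (AE w in wiener_space. (\<lambda>j. f (r j) w) \<longlonglongrightarrow> F w)"
proof -
  let ?u = "\<lambda>j w. (f j w - F w)\<^sup>2"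
  have "\<exists>r. strict_mono r \<and> (AE w in wiener_space. (\<lambda>j. ?u (r j) w) \<longlonglongrightarrow> 0)"
  proof (rule tendsto_L1_AE_subseq)
    show "integrable wiener_space (?u n)" for n
      using L2_space_integrable_square[OF L2_diff[OF assms(1,2)]] .
    show "(\<lambda>n. \<E> (\<lambda>w. norm (?u n w))) \<longlonglongrightarrow> 0"
      using tendsto_power[OF assms(3), of 2] by (simp add: L2_norm_square)
  qed
  then obtain r where r: "strict_mono r" "AE w in wiener_space. (\<lambda>j. ?u (r j) w) \<longlonglongrightarrow> 0" by auto
  from r(2) have "AE w in wiener_space. (\<lambda>j. f (r j) w) \<longlonglongrightarrow> F w"
  proof eventually_elim
    case (elim w)
    from tendsto_real_sqrt[OF elim] have "(\<lambda>j. \<bar>f (r j) w - F w\<bar>) \<longlonglongrightarrow> 0" by simp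
    then show ?case by (simp add: tendsto_rabs_zero_iff LIM_zero_iff)
  qed
  with r(1) show ?thesis by blast
qed

text \<open>Riesz-Fischer. Along a subsequence the increments are summable in L1, so it converges
  almost everywhere; Fatou then bounds the distance of the whole sequence to that limit.\<close>

lemma L2_complete:
  assumes f: "\<And>j. f j \<in> L2_space"
    and Cauchy: "\<And>\<epsilon>. \<epsilon> > 0 \<Longrightarrow> \<exists>M. \<forall>i\<ge>M. \<forall>j\<ge>M. L2_norm (\<lambda>w. f i w - f j w) < \<epsilon>"
  shows "\<exists>g\<in>L2_space. (\<lambda>j. L2_norm (\<lambda>w. f j w - g w)) \<longlonglongrightarrow> 0"
proof -
  note [measurable] = L2_space_measurable[OF f]
  obtain M where M: "\<And>k i j. i \<ge> M k \<Longrightarrow> j \<ge> M k \<Longrightarrow> L2_norm (\<lambda>w. f i w - f j w) < (1/2) ^ k"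
    using Cauchy[of "(1/2) ^ _"] by (metis half_gt_zero zero_less_one zero_less_power)
  \<comment> \<open>The thresholds \<open>M k\<close> need not be monotone; the running maximum puts
    \<open>h k\<close> and all later terms beyond \<open>M k\<close>.\<close>
  define r where "r k = Max (M ` {..k})" for k
  have r: "M k \<le> r j" if "k \<le> j" for k j
    unfolding r_def using that by (intro Max_ge) auto
  define h where "h k = f (r k)" for k
  have h: "h k \<in> L2_space" for k by (simp add: h_def f)
  note [measurable] = L2_space_measurable[OF h]
  have hd: "L2_norm (\<lambda>w. h (Suc k) w - h k w) < (1/2) ^ k" for k
    unfolding h_def by (intro M r) auto
  let ?D = "\<lambda>k w. \<bar>h (Suc k) w - h k w\<bar>"
  have D: "(\<integral>\<^sup>+w. ennreal (?D k w) \<partial>wiener_space) \<le> ennreal ((1/2) ^ k)" for k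
  proof -
    have L: "(\<lambda>w. h (Suc k) w - h k w) \<in> L2_space" by (intro L2_diff h)
    have i: "integrable wiener_space (?D k)" using L2_integrable[OF L] by simp
    have "?D k \<in> L2_space" using L by (auto intro!: L2_spaceI dest: L2_space_integrable_square)
    from L2_Cauchy_Schwarz[OF this L2_const[of 1]]
    have "\<E> (?D k) \<le> L2_norm (?D k)" by (simp add: L2_norm_def wiener.prob_space)
    also have "\<dots> = L2_norm (\<lambda>w. h (Suc k) w - h k w)" by (simp add: L2_norm_def)
    also note hd[of k, THEN less_imp_le]
    finally show ?thesis using i by (simp add: nn_integral_eq_integral ennreal_leI)
  qed
  have "(\<integral>\<^sup>+w. (\<Sum>k. ennreal (?D k w)) \<partial>wiener_space) = (\<Sum>k. \<integral>\<^sup>+w. ennreal (?D k w) \<partial>wiener_space)"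
    by (intro nn_integral_suminf) measurable
  also have "\<dots> \<le> (\<Sum>k. ennreal ((1/2) ^ k))"
    by (intro suminf_le D) auto
  also have "\<dots> = ennreal (\<Sum>k. (1/2) ^ k)"
    by (intro suminf_ennreal2) (auto intro: summable_geometric)
  also have "\<dots> < \<top>" by simp
  finally have "AE w in wiener_space. (\<Sum>k. ennreal (?D k w)) \<noteq> \<infinity>"
    by (intro nn_integral_PInf_AE) auto
  then have conv: "AE w in wiener_space. convergent (\<lambda>k. h k w)"
  proof eventually_elim
    case (elim w)
    then have "summable (\<lambda>k. ?D k w)" by (intro summable_suminf_not_top) auto
    then have "summable (\<lambda>k. h (Suc k) w - h k w)" by (rule summable_rabs_cancel)
    then have "convergent (\<lambda>n. \<Sum>k<n. h (Suc k) w - h k w)" by (simp add: summable_iff_convergent)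
    then have "convergent (\<lambda>n. h n w - h 0 w)" unfolding sum_lessThan_telescope[of "\<lambda>k. h k w"] .
    from convergent_add[OF this convergent_const[of "h 0 w"]] show ?case by simp
  qed
  define g where "g w = lim (\<lambda>k. h k w)" for w
  have [measurable]: "g \<in> borel_measurable wiener_space"
    unfolding g_def by measurable
  have lim: "AE w in wiener_space. (\<lambda>k. h k w) \<longlonglongrightarrow> g w"
    using conv by eventually_elim (simp add: g_def convergent_LIMSEQ_iff)
  have tail: "integrable wiener_space (\<lambda>w. (f j w - g w)\<^sup>2) \<and> \<E> (\<lambda>w. (f j w - g w)\<^sup>2) \<le> ((1/2) ^ k)\<^sup>2" if "j \<ge> M k" for j k
  proof (rule fatou_bound)
    fix i
    show "integrable wiener_space (\<lambda>w. (f j w - h (i + k) w)\<^sup>2)"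
      by (intro L2_space_integrable_square L2_diff f h)
    have "L2_norm (\<lambda>w. f j w - h (i + k) w) \<le> (1/2) ^ k"
      unfolding h_def by (intro less_imp_le[OF M] that r) simp
    then have "(L2_norm (\<lambda>w. f j w - h (i + k) w))\<^sup>2 \<le> ((1/2) ^ k)\<^sup>2"
      by (intro power_mono L2_norm_nonneg)
    then show "\<E> (\<lambda>w. (f j w - h (i + k) w)\<^sup>2) \<le> ((1/2) ^ k)\<^sup>2"
      by (simp only: L2_norm_square)
  next
    show "AE w in wiener_space. (\<lambda>i. (f j w - h (i + k) w)\<^sup>2) \<longlonglongrightarrow> (f j w - g w)\<^sup>2"
      using lim by eventually_elim (intro tendsto_intros LIMSEQ_ignore_initial_segment)
  qed (simp, measurable)
  have "(\<lambda>w. f (M 0) w - g w) \<in> L2_space"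
    using tail[of 0 "M 0"] by (intro L2_spaceI) auto
  from L2_diff[OF f[of "M 0"] this] have g: "g \<in> L2_space" by simp
  have "(\<lambda>j. L2_norm (\<lambda>w. f j w - g w)) \<longlonglongrightarrow> 0"
  proof (rule LIMSEQ_I)
    fix e :: real assume "0 < e"
    then obtain k where k: "(1/2) ^ k < e" using real_arch_pow_inv[of e "1/2"] by auto
    have "norm (L2_norm (\<lambda>w. f j w - g w) - 0) < e" if "j \<ge> M k" for j
    proof -
      have "(L2_norm (\<lambda>w. f j w - g w))\<^sup>2 \<le> ((1/2) ^ k)\<^sup>2"
        using tail[OF that] by (simp only: L2_norm_square)
      then have "L2_norm (\<lambda>w. f j w - g w) \<le> (1/2) ^ k" by (rule power2_le_imp_le) simp
      with k show ?thesis by (simp add: L2_norm_nonneg)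
    qed
    then show "\<exists>no. \<forall>n\<ge>no. norm (L2_norm (\<lambda>w. f n w - g w) - 0) < e" by blast
  qed
  with g show ?thesis by blast
qed


text \<open>Only dyadic exponents occur, so that Cauchy-Schwarz is the only inequality needed for products.\<close>

definition all_moments :: "((nat \<Rightarrow> real) \<Rightarrow> real) set" where
  "all_moments = {U \<in> borel_measurable wiener_space. \<forall>s. integrable wiener_space (\<lambda>w. U w ^ (2 ^ Suc s))}"

lemma all_momentsD:
  "U \<in> all_moments \<Longrightarrow> U \<in> borel_measurable wiener_space"
  "U \<in> all_moments \<Longrightarrow> integrable wiener_space (\<lambda>w. U w ^ (2 ^ Suc s))"
  by (auto simp: all_moments_def)

lemma all_moments_L2: "U \<in> all_moments \<Longrightarrow> U \<in> L2_space"
  using all_momentsD(1)[of U] all_momentsD(2)[of U 0] by (auto intro!: L2_spaceI)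

lemma all_moments_power_L2: "U \<in> all_moments \<Longrightarrow> (\<lambda>w. U w ^ (2 ^ s)) \<in> L2_space"
  using all_momentsD(2)[of U s] all_momentsD(1)[of U] by (auto intro!: L2_spaceI simp only: power_dyadic) auto

lemma HP_all_moments: "F \<in> HP N S \<Longrightarrow> F \<in> all_moments"
  unfolding all_moments_def
  using HP_integrable[OF HP_power_UNIV[of F N S]] HP_integrable[of F N S] by auto

lemma all_moments_const: "(\<lambda>w. c) \<in> all_moments"
  using HP_all_moments[OF HP_const[of UNIV c 0]] by simp

lemma power_sum_le:
  fixes a b :: real
  assumes "even n"
  shows "(a + b) ^ n \<le> 2 ^ n * (a ^ n + b ^ n)"
proof -
  have "(a + b) ^ n = \<bar>a + b\<bar> ^ n" using assms by (simp add: power_even_abs)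
  also have "\<dots> \<le> (2 * max \<bar>a\<bar> \<bar>b\<bar>) ^ n" by (intro power_mono) auto
  also have "\<dots> = 2 ^ n * (max \<bar>a\<bar> \<bar>b\<bar>) ^ n" by (simp add: power_mult_distrib)
  also have "(max \<bar>a\<bar> \<bar>b\<bar>) ^ n \<le> \<bar>a\<bar> ^ n + \<bar>b\<bar> ^ n" by (auto simp: max_def)
  also have "\<bar>a\<bar> ^ n + \<bar>b\<bar> ^ n = a ^ n + b ^ n" using assms by (simp add: power_even_abs)
  finally show ?thesis by simp
qed

lemma all_moments_add:
  assumes "U \<in> all_moments" "V \<in> all_moments"
  shows "(\<lambda>w. U w + V w) \<in> all_moments"
proof -
  note [measurable] = all_momentsD(1)[OF assms(1)] all_momentsD(1)[OF assms(2)]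
  have "integrable wiener_space (\<lambda>w. (U w + V w) ^ (2 ^ Suc s))" for s
  proof (rule Bochner_Integration.integrable_bound)
    show "integrable wiener_space (\<lambda>w. 2 ^ (2 ^ Suc s) * (U w ^ (2 ^ Suc s) + V w ^ (2 ^ Suc s)))"
      using assms by (intro integrable_mult_right Bochner_Integration.integrable_add all_momentsD)
    show "AE w in wiener_space. norm ((U w + V w) ^ (2 ^ Suc s)) \<le> norm (2 ^ (2 ^ Suc s) * (U w ^ (2 ^ Suc s) + V w ^ (2 ^ Suc s)))"
    proof (rule AE_I2)
      fix w
      have "0 \<le> (U w + V w) ^ (2 ^ Suc s)" by (rule zero_le_even_power) simp
      then show "norm ((U w + V w) ^ (2 ^ Suc s)) \<le> norm (2 ^ (2 ^ Suc s) * (U w ^ (2 ^ Suc s) + V w ^ (2 ^ Suc s)))"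
        unfolding real_norm_def
        by (subst abs_of_nonneg, assumption) (rule order_trans[OF power_sum_le abs_ge_self], simp)
    qed
  qed measurable
  then show ?thesis unfolding all_moments_def by auto
qed

lemma all_moments_mult:
  assumes "U \<in> all_moments" "V \<in> all_moments"
  shows "(\<lambda>w. U w * V w) \<in> all_moments"
proof -
  note [measurable] = all_momentsD(1)[OF assms(1)] all_momentsD(1)[OF assms(2)]
  have "integrable wiener_space (\<lambda>w. (U w * V w) ^ (2 ^ Suc s))" for s
    unfolding power_mult_distrib by (intro L2_integrable_mult all_moments_power_L2 assms)
  then show ?thesis unfolding all_moments_def by auto
qed

lemma all_moments_diff:
  "U \<in> all_moments \<Longrightarrow> V \<in> all_moments \<Longrightarrow> (\<lambda>w. U w - V w) \<in> all_moments"
  using all_moments_add[OF _ all_moments_mult[OF all_moments_const[of "-1"]], of U V] by simp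

text \<open>Convergence to 0 in every L^q with finite q, tested on dyadic exponents. Unlike
  convergence in L2 it is stable under products, from which powers and the carre du champ are
  built.\<close>

definition mnull :: "(nat \<Rightarrow> (nat \<Rightarrow> real) \<Rightarrow> real) \<Rightarrow> bool" where
  "mnull A \<longleftrightarrow> (\<forall>j. A j \<in> all_moments) \<and> (\<forall>s. (\<lambda>j. \<E> (\<lambda>w. A j w ^ (2 ^ Suc s))) \<longlonglongrightarrow> 0)"

lemma mnull_add:
  assumes "mnull A" "mnull B"
  shows "mnull (\<lambda>j w. A j w + B j w)"
  unfolding mnull_def
proof (intro conjI allI)
  have AB: "A j \<in> all_moments" "B j \<in> all_moments" for j using assms by (auto simp: mnull_def)
  then show "(\<lambda>w. A j w + B j w) \<in> all_moments" for j by (intro all_moments_add)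
  fix s
  let ?n = "2 ^ Suc s :: nat"
  have "(\<lambda>j. 2 ^ ?n * (\<E> (\<lambda>w. A j w ^ ?n) + \<E> (\<lambda>w. B j w ^ ?n))) \<longlonglongrightarrow> 2 ^ ?n * (0 + 0)"
    using assms unfolding mnull_def by (intro tendsto_intros) auto
  then have lim: "(\<lambda>j. 2 ^ ?n * (\<E> (\<lambda>w. A j w ^ ?n) + \<E> (\<lambda>w. B j w ^ ?n))) \<longlonglongrightarrow> 0" by simp
  show "(\<lambda>j. \<E> (\<lambda>w. (A j w + B j w) ^ ?n)) \<longlonglongrightarrow> 0"
  proof (rule tendsto_sandwich[OF _ _ tendsto_const lim])
    show "\<forall>\<^sub>F j in sequentially. 0 \<le> \<E> (\<lambda>w. (A j w + B j w) ^ ?n)"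
      by (intro always_eventually allI Bochner_Integration.integral_nonneg zero_le_even_power) simp
    have "\<E> (\<lambda>w. (A j w + B j w) ^ ?n) \<le> \<E> (\<lambda>w. 2 ^ ?n * (A j w ^ ?n + B j w ^ ?n))" for j
      by (intro integral_mono all_momentsD(2) all_moments_add AB integrable_mult_right
          Bochner_Integration.integrable_add power_sum_le) simp
    also have "\<dots> j = 2 ^ ?n * (\<E> (\<lambda>w. A j w ^ ?n) + \<E> (\<lambda>w. B j w ^ ?n))" for j
      by (simp only: integral_mult_right_zero Bochner_Integration.integral_add[OF all_momentsD(2)[OF AB(1)] all_momentsD(2)[OF AB(2)]])
    finally show "\<forall>\<^sub>F j in sequentially. \<E> (\<lambda>w. (A j w + B j w) ^ ?n)
        \<le> 2 ^ ?n * (\<E> (\<lambda>w. A j w ^ ?n) + \<E> (\<lambda>w. B j w ^ ?n))"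
      by (intro always_eventually allI)
  qed
qed

text \<open>Cauchy-Schwarz trades each dyadic exponent for the next one on both factors. Convergent
  moments of \<open>B\<close> are a form of boundedness that covers null sequences and constant
  sequences alike.\<close>

lemma mnull_mult_bounded:
  assumes A: "mnull A" and B: "\<And>j. B j \<in> all_moments"
    and bd: "\<And>s. \<exists>l. (\<lambda>j. \<E> (\<lambda>w. B j w ^ (2 ^ Suc s))) \<longlonglongrightarrow> l"
  shows "mnull (\<lambda>j w. A j w * B j w)"
  unfolding mnull_def
proof (intro conjI allI)
  have AB: "A j \<in> all_moments" for j using assms by (auto simp: mnull_def)
  then show "(\<lambda>w. A j w * B j w) \<in> all_moments" for j by (intro all_moments_mult B)
  fix s
  obtain l where l: "(\<lambda>j. \<E> (\<lambda>w. B j w ^ (2 ^ Suc (Suc s)))) \<longlonglongrightarrow> l" using bd by blast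
  have "(\<lambda>j. sqrt (\<E> (\<lambda>w. A j w ^ (2 ^ Suc (Suc s)))) * sqrt (\<E> (\<lambda>w. B j w ^ (2 ^ Suc (Suc s))))) \<longlonglongrightarrow> sqrt 0 * sqrt l"
    using A l unfolding mnull_def by (intro tendsto_mult tendsto_real_sqrt) blast+
  then have lim: "(\<lambda>j. sqrt (\<E> (\<lambda>w. A j w ^ (2 ^ Suc (Suc s)))) * sqrt (\<E> (\<lambda>w. B j w ^ (2 ^ Suc (Suc s))))) \<longlonglongrightarrow> 0"
    by simp
  show "(\<lambda>j. \<E> (\<lambda>w. (A j w * B j w) ^ (2 ^ Suc s))) \<longlonglongrightarrow> 0"
  proof (rule tendsto_sandwich[OF _ _ tendsto_const lim])
    show "\<forall>\<^sub>F j in sequentially. 0 \<le> \<E> (\<lambda>w. (A j w * B j w) ^ (2 ^ Suc s))"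
      by (intro always_eventually allI Bochner_Integration.integral_nonneg zero_le_even_power) simp
    have "\<E> (\<lambda>w. (A j w * B j w) ^ (2 ^ Suc s)) \<le> sqrt (\<E> (\<lambda>w. A j w ^ (2 ^ Suc (Suc s)))) * sqrt (\<E> (\<lambda>w. B j w ^ (2 ^ Suc (Suc s))))" for j
      using order_trans[OF abs_ge_self L2_Cauchy_Schwarz[OF all_moments_power_L2[OF AB[of j], of "Suc s"] all_moments_power_L2[OF B[of j], of "Suc s"]]]
      unfolding L2_norm_def power_dyadic power_mult_distrib .
    then show "\<forall>\<^sub>F j in sequentially. \<E> (\<lambda>w. (A j w * B j w) ^ (2 ^ Suc s))
       \<le> sqrt (\<E> (\<lambda>w. A j w ^ (2 ^ Suc (Suc s)))) * sqrt (\<E> (\<lambda>w. B j w ^ (2 ^ Suc (Suc s))))"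
      by (intro always_eventually allI)
  qed
qed

lemma mnull_mult: "mnull A \<Longrightarrow> mnull B \<Longrightarrow> mnull (\<lambda>j w. A j w * B j w)"
  by (rule mnull_mult_bounded) (auto simp: mnull_def)

lemma mnull_mult_const: "mnull A \<Longrightarrow> U \<in> all_moments \<Longrightarrow> mnull (\<lambda>j w. A j w * U w)"
  by (rule mnull_mult_bounded) auto

lemma mnull_zero: "mnull (\<lambda>j w. 0)"
  by (simp add: mnull_def all_moments_const power_0_left)

lemma mnull_L2: "mnull A \<Longrightarrow> (\<lambda>j. L2_norm (A j)) \<longlonglongrightarrow> 0"
proof -
  assume "mnull A"
  then have "(\<lambda>j. \<E> (\<lambda>w. A j w ^ (2 ^ Suc 0))) \<longlonglongrightarrow> 0" by (simp only: mnull_def)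
  from tendsto_real_sqrt[OF this] show ?thesis by (simp add: L2_norm_def)
qed

definition mconv :: "(nat \<Rightarrow> (nat \<Rightarrow> real) \<Rightarrow> real) \<Rightarrow> ((nat \<Rightarrow> real) \<Rightarrow> real) \<Rightarrow> bool" where
  "mconv A U \<longleftrightarrow> U \<in> all_moments \<and> mnull (\<lambda>j w. A j w - U w)"

lemma mconv_const: "U \<in> all_moments \<Longrightarrow> mconv (\<lambda>j. U) U"
  by (simp add: mconv_def mnull_zero)

lemma mconv_add: "mconv A U \<Longrightarrow> mconv B V \<Longrightarrow> mconv (\<lambda>j w. A j w + B j w) (\<lambda>w. U w + V w)"
  unfolding mconv_def using mnull_add[of "\<lambda>j w. A j w - U w" "\<lambda>j w. B j w - V w"]
  by (auto intro: all_moments_add simp: algebra_simps)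

lemma mconv_mult:
  assumes "mconv A U" "mconv B V"
  shows "mconv (\<lambda>j w. A j w * B j w) (\<lambda>w. U w * V w)"
proof -
  have A: "mnull (\<lambda>j w. A j w - U w)" and B: "mnull (\<lambda>j w. B j w - V w)"
    and U: "U \<in> all_moments" and V: "V \<in> all_moments"
    using assms by (auto simp: mconv_def)
  \<comment> \<open>This expansion of AB - UV contains only null factors and the fixed limits, so no
    bounds on \<open>A\<close> and \<open>B\<close> themselves are required.\<close>
  have "mnull (\<lambda>j w. (A j w - U w) * (B j w - V w) + (A j w - U w) * V w + (B j w - V w) * U w)"
    by (intro mnull_add mnull_mult mnull_mult_const A B U V)
  moreover have "(A j w - U w) * (B j w - V w) + (A j w - U w) * V w + (B j w - V w) * U w = A j w * B j w - U w * V w" for j w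
    by (simp add: algebra_simps)
  ultimately show ?thesis
    using U V by (simp add: mconv_def all_moments_mult)
qed

lemma mconv_poly: "mconv A U \<Longrightarrow> mconv (\<lambda>j w. poly q (A j w)) (\<lambda>w. poly q (U w))"
  by (induction q) (auto intro!: mconv_add mconv_mult mconv_const all_moments_const)

lemma mconv_power: "mconv A U \<Longrightarrow> mconv (\<lambda>j w. A j w ^ k) (\<lambda>w. U w ^ k)"
  using mconv_poly[of A U "monom 1 k"] by (simp add: poly_monom)

lemma mconv_L2: "mconv A U \<Longrightarrow> (\<lambda>j. L2_norm (\<lambda>w. A j w - U w)) \<longlonglongrightarrow> 0"
  unfolding mconv_def by (intro mnull_L2) simp

lemma mconv_all_moments: "mconv A U \<Longrightarrow> U \<in> all_moments" "mconv A U \<Longrightarrow> A j \<in> all_moments"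
  unfolding mconv_def mnull_def
  using all_moments_add[of "\<lambda>w. A j w - U w" U] by auto

lemma L2_tendsto_inner:
  assumes "\<And>j. A j \<in> L2_space" "U \<in> L2_space" "(\<lambda>j. L2_norm (\<lambda>w. A j w - U w)) \<longlonglongrightarrow> 0"
    and "\<And>j. B j \<in> L2_space" "V \<in> L2_space" "(\<lambda>j. L2_norm (\<lambda>w. B j w - V w)) \<longlonglongrightarrow> 0"
  shows "(\<lambda>j. \<E> (\<lambda>w. A j w * B j w)) \<longlonglongrightarrow> \<E> (\<lambda>w. U w * V w)"
proof -
  let ?a = "\<lambda>j. L2_norm (\<lambda>w. A j w - U w)" and ?b = "\<lambda>j. L2_norm (\<lambda>w. B j w - V w)"
  have "(\<lambda>j. ?a j * ?b j + ?a j * L2_norm V + ?b j * L2_norm U) \<longlonglongrightarrow> 0 * 0 + 0 * L2_norm V + 0 * L2_norm U"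
    by (intro tendsto_intros assms)
  then have lim: "(\<lambda>j. ?a j * ?b j + ?a j * L2_norm V + ?b j * L2_norm U) \<longlonglongrightarrow> 0" by simp
  have "(\<lambda>j. \<E> (\<lambda>w. A j w * B j w) - \<E> (\<lambda>w. U w * V w)) \<longlonglongrightarrow> 0"
  proof (rule Lim_null_comparison[OF always_eventually lim], intro allI)
    fix j
    note L = L2_diff[OF assms(1)[of j] assms(2)] L2_diff[OF assms(4)[of j] assms(5)]
    have "\<E> (\<lambda>w. A j w * B j w) - \<E> (\<lambda>w. U w * V w) = \<E> (\<lambda>w. A j w * B j w - U w * V w)"
      by (intro Bochner_Integration.integral_diff[symmetric] L2_integrable_mult assms)
    also have "\<dots> = \<E> (\<lambda>w. (A j w - U w) * (B j w - V w) + (A j w - U w) * V w + (B j w - V w) * U w)"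
      by (simp add: algebra_simps)
    also have "\<dots> = \<E> (\<lambda>w. (A j w - U w) * (B j w - V w)) + \<E> (\<lambda>w. (A j w - U w) * V w) + \<E> (\<lambda>w. (B j w - V w) * U w)"
      by (simp add: L2_integrable_mult[OF L] L2_integrable_mult[OF L(1) assms(5)] L2_integrable_mult[OF L(2) assms(2)])
    finally show "norm (\<E> (\<lambda>w. A j w * B j w) - \<E> (\<lambda>w. U w * V w)) \<le> ?a j * ?b j + ?a j * L2_norm V + ?b j * L2_norm U"
      using L2_Cauchy_Schwarz[OF L] L2_Cauchy_Schwarz[OF L(1) assms(5)] L2_Cauchy_Schwarz[OF L(2) assms(2)]
      unfolding real_norm_def by linarith
  qed
  then show ?thesis by (simp add: LIM_zero_iff)
qed

lemma L2_tendsto_norm: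
  assumes "\<And>j. A j \<in> L2_space" "U \<in> L2_space" "(\<lambda>j. L2_norm (\<lambda>w. A j w - U w)) \<longlonglongrightarrow> 0"
  shows "(\<lambda>j. L2_norm (A j)) \<longlonglongrightarrow> L2_norm U"
  using tendsto_real_sqrt[OF L2_tendsto_inner[OF assms assms]] by (simp add: L2_norm_def power2_eq_square)

lemma L2_tendsto_expectation:
  assumes "\<And>j. A j \<in> L2_space" "U \<in> L2_space" "(\<lambda>j. L2_norm (\<lambda>w. A j w - U w)) \<longlonglongrightarrow> 0"
  shows "(\<lambda>j. \<E> (A j)) \<longlonglongrightarrow> \<E> U"
  using L2_tendsto_inner[OF assms, where B = "\<lambda>j w. 1" and V = "\<lambda>w. 1"] by (simp add: L2_const)

lemma mconv_expectation: "mconv A U \<Longrightarrow> (\<lambda>j. \<E> (A j)) \<longlonglongrightarrow> \<E> U"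
  by (intro L2_tendsto_expectation mconv_L2 all_moments_L2) (auto intro: mconv_all_moments)

section \<open>Chaos expansions\<close>

lemma chaos_L2: "F \<in> chaos p \<Longrightarrow> F \<in> L2_space"
  by (simp add: chaos_def)

lemma HP_chaos: "F \<in> HP N {p} \<Longrightarrow> F \<in> chaos p"
  unfolding chaos_def using HP_hermite_span[of F N p] HP_L2[of F N "{p}"]
  by (auto intro!: bexI[of _ F])

lemma chaos_limit_mem:
  assumes "Z \<in> L2_space" "\<And>j. y j \<in> HP (N j) {m}" "(\<lambda>j. L2_norm (\<lambda>w. y j w - Z w)) \<longlonglongrightarrow> 0"
  shows "Z \<in> chaos m"
  unfolding chaos_def
proof (intro CollectI conjI allI impI assms(1))
  fix \<epsilon> :: real assume "\<epsilon> > 0"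
  from order_tendstoD(2)[OF assms(3) this] obtain j where "L2_norm (\<lambda>w. y j w - Z w) < \<epsilon>"
    by (auto simp: eventually_sequentially)
  then show "\<exists>Y\<in>hermite_span m. L2_norm (\<lambda>w. Z w - Y w) < \<epsilon>"
    using HP_hermite_span[OF assms(2)] by (auto simp: L2_norm_minus_commute[of Z])
qed

lemma chaos_approx_L2:
  assumes "F \<in> chaos p"
  shows "\<exists>N f. \<forall>j. f j \<in> HP (N j) {p} \<and> L2_norm (\<lambda>w. f j w - F w) < 1 / real (Suc j)"
proof -
  have "\<exists>N f. f \<in> HP N {p} \<and> L2_norm (\<lambda>w. f w - F w) < 1 / real (Suc j)" for j
  proof -
    have "0 < 1 / real (Suc j)" by simp
    then obtain Y where "Y \<in> hermite_span p" "L2_norm (\<lambda>w. F w - Y w) < 1 / real (Suc j)"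
      using assms unfolding chaos_def by blast
    then show ?thesis
      using hermite_span_HP[of Y p] L2_norm_minus_commute[of F Y] by auto
  qed
  then show ?thesis by metis
qed

text \<open>Differences of approximants stay in chaos \<open>p\<close>, so hypercontractivity turns
  the L2 Cauchy bound into one for every dyadic moment, with one constant although the number of
  coordinates may grow. Fatou along an almost surely convergent subsequence then replaces the later
  approximant by \<open>F\<close>.\<close>

lemma chaos_approx:
  assumes F: "F \<in> chaos p"
  shows "\<exists>N f. (\<forall>j. f j \<in> HP (N j) {p}) \<and> mconv f F"
proof -
  from chaos_approx_L2[OF F] obtain N f where f: "\<And>j. f j \<in> HP (N j) {p}"
    and fF: "\<And>j. L2_norm (\<lambda>w. f j w - F w) < 1 / real (Suc j)" by auto
  note FL = chaos_L2[OF F] and fL = HP_L2[OF f]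
  note [measurable] = L2_space_measurable[OF FL] L2_space_measurable[OF fL]
  have "(\<lambda>j. L2_norm (\<lambda>w. f j w - F w)) \<longlonglongrightarrow> 0"
    by (rule tendsto_sandwich[OF _ _ tendsto_const LIMSEQ_Suc[OF lim_inverse_n']])
       (intro always_eventually allI L2_norm_nonneg less_imp_le[OF fF])+
  from L2_tendsto_AE_subseq[OF fL FL this] obtain r where r: "strict_mono r"
    "AE w in wiener_space. (\<lambda>j. f (r j) w) \<longlonglongrightarrow> F w" by blast
  obtain C where C: "\<And>s. C s \<ge> 0"
    "\<And>s N G. G \<in> HP N {..p} \<Longrightarrow> \<E> (\<lambda>w. G w ^ (2 ^ Suc s)) \<le> C s * (\<E> (\<lambda>w. (G w)\<^sup>2)) ^ (2 ^ s)"
    using moment_bound_dyadic[of p] by metis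
  have fij: "\<E> (\<lambda>w. (f i w - f j w) ^ (2 ^ Suc s)) \<le> C s * ((2 / real (Suc j))\<^sup>2) ^ (2 ^ s)" if "i \<ge> j" for i j s
  proof -
    have H: "(\<lambda>w. f i w - f j w) \<in> HP (max (N i) (N j)) {p}"
      by (intro HP_diff HP_mono_N[OF _ f]) auto
    have "L2_norm (\<lambda>w. f i w - f j w) \<le> L2_norm (\<lambda>w. f i w - F w) + L2_norm (\<lambda>w. F w - f j w)"
      by (intro L2_norm_triangle3 fL FL)
    also have "\<dots> \<le> 1 / real (Suc i) + 1 / real (Suc j)"
      using fF[of i] fF[of j] L2_norm_minus_commute[of F "f j"] by simp
    also have "\<dots> \<le> 1 / real (Suc j) + 1 / real (Suc j)"
      using that by (intro add_right_mono divide_left_mono) auto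
    also have "\<dots> = 2 / real (Suc j)" by simp
    finally have "(L2_norm (\<lambda>w. f i w - f j w))\<^sup>2 \<le> (2 / real (Suc j))\<^sup>2"
      by (intro power_mono L2_norm_nonneg)
    then have "C s * (\<E> (\<lambda>w. (f i w - f j w)\<^sup>2)) ^ (2 ^ s) \<le> C s * ((2 / real (Suc j))\<^sup>2) ^ (2 ^ s)"
      unfolding L2_norm_square by (intro mult_left_mono power_mono C) auto
    then show ?thesis
      by (rule order_trans[OF C(2)[OF HP_mono[OF H]], rotated]) auto
  qed
  \<comment> \<open>The index is shifted by \<open>j\<close> so that \<open>r (i + j)\<close> is at
    least \<open>j\<close>, as \<open>fij\<close> demands.\<close>
  have bd: "integrable wiener_space (\<lambda>w. (F w - f j w) ^ (2 ^ Suc s)) \<and>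
     \<E> (\<lambda>w. (F w - f j w) ^ (2 ^ Suc s)) \<le> C s * ((2 / real (Suc j))\<^sup>2) ^ (2 ^ s)" for j s
  proof (rule fatou_bound)
    fix i
    show "integrable wiener_space (\<lambda>w. (f (r (i + j)) w - f j w) ^ (2 ^ Suc s))"
      by (intro all_momentsD all_moments_diff HP_all_moments[OF f])
    show "\<E> (\<lambda>w. (f (r (i + j)) w - f j w) ^ (2 ^ Suc s)) \<le> C s * ((2 / real (Suc j))\<^sup>2) ^ (2 ^ s)"
      by (rule fij) (use seq_suble[OF r(1), of "i + j"] in simp)
    show "0 \<le> (f (r (i + j)) w - f j w) ^ (2 ^ Suc s)" for w
      by (rule zero_le_even_power) simp
  next
    show "AE w in wiener_space. (\<lambda>i. (f (r (i + j)) w - f j w) ^ (2 ^ Suc s)) \<longlonglongrightarrow> (F w - f j w) ^ (2 ^ Suc s)"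
      using r(2)
    proof eventually_elim
      case (elim w)
      from LIMSEQ_ignore_initial_segment[OF elim, of j] show ?case
        by (intro tendsto_power tendsto_diff tendsto_const)
    qed
  qed measurable
  have eq: "(f j w - F w) ^ (2 ^ Suc s) = (F w - f j w) ^ (2 ^ Suc s)" for j s w
    by (subst minus_diff_eq[symmetric], subst power_minus_even) simp_all
  have fm: "(\<lambda>w. f j w - F w) \<in> all_moments" for j
    unfolding all_moments_def mem_Collect_eq eq by (intro conjI allI conjunct1[OF bd]) measurable
  have "F \<in> all_moments"
    using all_moments_diff[OF HP_all_moments[OF f[of 0]] fm[of 0]] by simp
  moreover have "mnull (\<lambda>j w. f j w - F w)"
    unfolding mnull_def
  proof (intro conjI allI fm)
    fix s
    have "(\<lambda>j. 2 / real (Suc j)) \<longlonglongrightarrow> 2 * 0"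
      using tendsto_mult[OF tendsto_const[of 2] LIMSEQ_Suc[OF lim_inverse_n']] by simp
    then have "(\<lambda>j. C s * ((2 / real (Suc j))\<^sup>2) ^ (2 ^ s)) \<longlonglongrightarrow> C s * ((2 * 0)\<^sup>2) ^ (2 ^ s)"
      by (intro tendsto_mult tendsto_power tendsto_const)
    then have lim: "(\<lambda>j. C s * ((2 / real (Suc j))\<^sup>2) ^ (2 ^ s)) \<longlonglongrightarrow> 0" by (simp add: power_0_left)
    show "(\<lambda>j. \<E> (\<lambda>w. (f j w - F w) ^ (2 ^ Suc s))) \<longlonglongrightarrow> 0"
      unfolding eq
    proof (rule tendsto_sandwich[OF _ _ tendsto_const lim])
      show "\<forall>\<^sub>F j in sequentially. 0 \<le> \<E> (\<lambda>w. (F w - f j w) ^ (2 ^ Suc s))"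
        by (intro always_eventually allI Bochner_Integration.integral_nonneg zero_le_even_power) simp
    qed (intro always_eventually allI conjunct2[OF bd])
  qed
  ultimately show ?thesis using f unfolding mconv_def by blast
qed

lemma chaos_approx2:
  assumes "F \<in> chaos p" "X \<in> chaos q"
  shows "\<exists>N f x. (\<forall>j. f j \<in> HP (N j) {p}) \<and> (\<forall>j. x j \<in> HP (N j) {q}) \<and> mconv f F \<and> mconv x X"
proof -
  obtain N f M x where fx: "\<And>j. f j \<in> HP (N j) {p}" "mconv f F" "\<And>j. x j \<in> HP (M j) {q}" "mconv x X"
    using assms chaos_approx by metis
  have "f j \<in> HP (max (N j) (M j)) {p}" "x j \<in> HP (max (N j) (M j)) {q}" for j
    by (rule HP_mono_N[OF _ fx(1)] HP_mono_N[OF _ fx(3)], simp)+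
  with fx(2,4) show ?thesis by (intro exI[of _ "\<lambda>j. max (N j) (M j)"]) blast
qed

lemma chaos_diff:
  assumes "F \<in> chaos p" "G \<in> chaos p"
  shows "(\<lambda>w. F w - G w) \<in> chaos p"
proof -
  from chaos_approx2[OF assms] obtain N f g where fg: "\<And>j. f j \<in> HP (N j) {p}" "\<And>j. g j \<in> HP (N j) {p}"
    and m: "mconv f F" "mconv g G" by auto
  have "mconv (\<lambda>j w. f j w + (-1) * g j w) (\<lambda>w. F w + (-1) * G w)"
    by (intro mconv_add mconv_mult mconv_const all_moments_const m)
  then have "(\<lambda>j. L2_norm (\<lambda>w. (f j w - g j w) - (F w - G w))) \<longlonglongrightarrow> 0"
    using mconv_L2 by force
  from chaos_limit_mem[OF L2_diff[OF assms[THEN chaos_L2]] HP_diff[OF fg] this] show ?thesis .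
qed

lemma chaos_zero: "(\<lambda>w. 0) \<in> chaos p"
  by (rule HP_chaos[OF HP.zero])

lemma chaos_orthogonal:
  assumes "F \<in> chaos p" "X \<in> chaos q" "p \<noteq> q"
  shows "\<E> (\<lambda>w. F w * X w) = 0"
proof -
  from chaos_approx2[OF assms(1,2)] obtain N f x where fx: "\<And>j. f j \<in> HP (N j) {p}" "\<And>j. x j \<in> HP (N j) {q}"
    and m: "mconv f F" "mconv x X" by auto
  from mconv_expectation[OF mconv_mult[OF m]] have "(\<lambda>j. 0) \<longlonglongrightarrow> \<E> (\<lambda>w. F w * X w)"
    by (simp add: HP_orthogonal[OF fx assms(3)])
  then show ?thesis by (simp add: LIMSEQ_const_iff)
qed

text \<open>By orthogonality a component of a difference is no larger in norm than the difference,
  so the components are Cauchy together with their sums. The decomposition of \<open>Y\<close> is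
  pointwise because \<open>chaos_le\<close> is defined by equality of functions.\<close>

lemma chaos_limit_components:
  assumes Y: "Y \<in> L2_space" and y: "\<And>j m. y j m \<in> HP (N j) {m}"
    and lim: "(\<lambda>j. L2_norm (\<lambda>w. (\<Sum>m\<le>d. y j m w) - Y w)) \<longlonglongrightarrow> 0"
  shows "\<exists>Z. (\<forall>m\<le>d. Z m \<in> chaos m \<and> (\<lambda>j. L2_norm (\<lambda>w. y j m w - Z m w)) \<longlonglongrightarrow> 0) \<and> Y = (\<lambda>w. \<Sum>m\<le>d. Z m w)"
proof -
  let ?Y = "\<lambda>j w. \<Sum>m\<le>d. y j m w"
  have yL: "y j m \<in> L2_space" for j m by (rule HP_L2[OF y])
  have YL: "?Y j \<in> L2_space" for j by (intro L2_sum yL)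
  have "\<exists>g\<in>L2_space. (\<lambda>j. L2_norm (\<lambda>w. y j m w - g w)) \<longlonglongrightarrow> 0" if m: "m \<le> d" for m
  proof (rule L2_complete[OF yL])
    fix \<epsilon> :: real assume "\<epsilon> > 0"
    then have "\<epsilon> / 2 > 0" by simp
    from order_tendstoD(2)[OF lim this] obtain M where M: "\<And>j. j \<ge> M \<Longrightarrow> L2_norm (\<lambda>w. ?Y j w - Y w) < \<epsilon> / 2"
      by (auto simp: eventually_sequentially)
    have "L2_norm (\<lambda>w. y i m w - y j m w) < \<epsilon>" if "i \<ge> M" "j \<ge> M" for i j
    proof -
      have H: "(\<lambda>w. y i n w - y j n w) \<in> HP (max (N i) (N j)) {n}" for n
        by (intro HP_diff HP_mono_N[OF _ y]) auto
      have "(L2_norm (\<lambda>w. y i m w - y j m w))\<^sup>2 \<le> (\<Sum>n\<le>d. \<E> (\<lambda>w. (y i n w - y j n w)\<^sup>2))"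
        unfolding L2_norm_square using m by (intro member_le_sum) auto
      also have "\<dots> = \<E> (\<lambda>w. (\<Sum>n\<le>d. 1 * (y i n w - y j n w))\<^sup>2)"
        unfolding expectation_components_square[OF H] by simp
      also have "\<dots> = (L2_norm (\<lambda>w. ?Y i w - ?Y j w))\<^sup>2"
        by (simp add: L2_norm_square sum_subtractf)
      finally have "L2_norm (\<lambda>w. y i m w - y j m w) \<le> L2_norm (\<lambda>w. ?Y i w - ?Y j w)"
        by (rule power2_le_imp_le) (rule L2_norm_nonneg)
      also have "\<dots> \<le> L2_norm (\<lambda>w. ?Y i w - Y w) + L2_norm (\<lambda>w. Y w - ?Y j w)"
        by (rule L2_norm_triangle3[OF YL Y YL])
      also have "\<dots> < \<epsilon> / 2 + \<epsilon> / 2"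
        using M[OF that(1)] M[OF that(2)] L2_norm_minus_commute[of Y "?Y j"] by simp
      finally show ?thesis by simp
    qed
    then show "\<exists>M. \<forall>i\<ge>M. \<forall>j\<ge>M. L2_norm (\<lambda>w. y i m w - y j m w) < \<epsilon>" by blast
  qed
  then have "\<forall>m\<in>{..d}. \<exists>g. g \<in> L2_space \<and> (\<lambda>j. L2_norm (\<lambda>w. y j m w - g w)) \<longlonglongrightarrow> 0"
    by (auto simp: Bex_def)
  from bchoice[OF this] obtain g where g: "\<And>m. m \<le> d \<Longrightarrow> g m \<in> L2_space"
    "\<And>m. m \<le> d \<Longrightarrow> (\<lambda>j. L2_norm (\<lambda>w. y j m w - g m w)) \<longlonglongrightarrow> 0" by auto
  \<comment> \<open>The component of order 0 absorbs the null set on which \<open>Y\<close> and the sum of the limits differ.\<close>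
  define Z where "Z m w = (if m = 0 then Y w - (\<Sum>n=1..d. g n w) else g m w)" for m w
  have split: "{..d} = insert 0 {1..d}" by auto
  have YZ: "Y = (\<lambda>w. \<Sum>m\<le>d. Z m w)"
    unfolding split by (simp add: Z_def)
  have ZL: "Z m \<in> L2_space" if "m \<le> d" for m
  proof (cases "m = 0")
    case True
    then show ?thesis
      unfolding Z_def[abs_def] using g(1) by (auto intro!: L2_diff[OF Y] L2_sum)
  next
    case False
    then show ?thesis unfolding Z_def[abs_def] using g(1)[OF that] by simp
  qed
  have Zlim: "(\<lambda>j. L2_norm (\<lambda>w. y j m w - Z m w)) \<longlonglongrightarrow> 0" if "m \<le> d" for m
  proof (cases "m = 0")
    case False
    then show ?thesis unfolding Z_def using g(2)[OF that] by simp
  next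
    case True
    have eq: "y j 0 w - Z 0 w = (?Y j w - Y w) - (\<Sum>n=1..d. y j n w - g n w)" for j w
      unfolding split by (simp add: Z_def sum_subtractf)
    have "(\<lambda>j. L2_norm (\<lambda>w. ?Y j w - Y w) + (\<Sum>n=1..d. L2_norm (\<lambda>w. y j n w - g n w))) \<longlonglongrightarrow> 0 + (\<Sum>n=1..d. 0)"
      using g(2) by (intro tendsto_add lim tendsto_sum) auto
    then have l: "(\<lambda>j. L2_norm (\<lambda>w. ?Y j w - Y w) + (\<Sum>n=1..d. L2_norm (\<lambda>w. y j n w - g n w))) \<longlonglongrightarrow> 0" by simp
    show ?thesis unfolding True
    proof (rule tendsto_sandwich[OF _ _ tendsto_const l])
      show "\<forall>\<^sub>F j in sequentially. 0 \<le> L2_norm (\<lambda>w. y j 0 w - Z 0 w)"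
        by (simp add: L2_norm_nonneg)
      have "L2_norm (\<lambda>w. y j 0 w - Z 0 w) \<le> L2_norm (\<lambda>w. ?Y j w - Y w) + (\<Sum>n=1..d. L2_norm (\<lambda>w. y j n w - g n w))" for j
      proof -
        have gL: "(\<lambda>w. y j n w - g n w) \<in> L2_space" if "n \<in> {1..d}" for n
          using that by (intro L2_diff yL g(1)) simp
        show ?thesis
          unfolding eq
          by (rule order_trans[OF L2_norm_triangle_diff[OF L2_diff[OF YL Y] L2_sum[OF gL]] add_left_mono[OF L2_norm_sum[OF gL]]])
      qed
      then show "\<forall>\<^sub>F j in sequentially. L2_norm (\<lambda>w. y j 0 w - Z 0 w) \<le> L2_norm (\<lambda>w. ?Y j w - Y w) + (\<Sum>n=1..d. L2_norm (\<lambda>w. y j n w - g n w))"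
        by simp
    qed
  qed
  have "Z m \<in> chaos m" if "m \<le> d" for m
    by (rule chaos_limit_mem[OF ZL[OF that] y Zlim[OF that]])
  with Zlim YZ show ?thesis by blast
qed

text \<open>Two candidates for the choice in \<open>chaos_proj\<close> differ by an element of chaos
  \<open>m\<close> that is orthogonal to chaos \<open>m\<close>, hence to itself, so they agree
  almost everywhere.\<close>

lemma chaos_proj_components:
  assumes Z: "\<And>m. m \<le> d \<Longrightarrow> Z m \<in> chaos m" and Y: "Y = (\<lambda>w. \<Sum>m\<le>d. Z m w)"
  shows "chaos_proj m Y \<in> chaos m \<and> (AE w in wiener_space. chaos_proj m Y w = (if m \<le> d then Z m w else 0))"
proof -
  define Z' where "Z' = (\<lambda>w. if m \<le> d then Z m w else 0)"
  have Z': "Z' \<in> chaos m" unfolding Z'_def using Z chaos_zero by (cases "m \<le> d") auto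
  let ?P = "\<lambda>P. P \<in> chaos m \<and> (\<forall>W\<in>chaos m. \<E> (\<lambda>w. (Y w - P w) * W w) = 0)"
  have YL: "Y \<in> L2_space" unfolding Y by (intro L2_sum chaos_L2[OF Z]) auto
  have PZ: "?P Z'"
  proof (intro conjI ballI Z')
    fix W assume W: "W \<in> chaos m"
    have "Y w - Z' w = (\<Sum>n\<in>{..d} - {m}. Z n w)" for w
      unfolding Y Z'_def by (cases "m \<le> d") (auto simp: sum_diff1 intro!: sum.cong)
    then have "\<E> (\<lambda>w. (Y w - Z' w) * W w) = \<E> (\<lambda>w. \<Sum>n\<in>{..d} - {m}. Z n w * W w)"
      by (simp add: sum_distrib_right)
    also have "\<dots> = (\<Sum>n\<in>{..d} - {m}. \<E> (\<lambda>w. Z n w * W w))"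
      by (intro Bochner_Integration.integral_sum L2_integrable_mult chaos_L2[OF Z] chaos_L2[OF W]) auto
    also have "\<dots> = 0"
      by (intro sum.neutral ballI chaos_orthogonal[OF Z W]) auto
    finally show "\<E> (\<lambda>w. (Y w - Z' w) * W w) = 0" .
  qed
  have P: "?P (chaos_proj m Y)"
    unfolding chaos_proj_def using someI[of ?P Z', OF PZ] .
  define W where "W w = chaos_proj m Y w - Z' w" for w
  have W: "W \<in> chaos m" unfolding W_def[abs_def] using P Z' by (intro chaos_diff) auto
  have L: "(\<lambda>w. Y w - chaos_proj m Y w) \<in> L2_space" "(\<lambda>w. Y w - Z' w) \<in> L2_space"
    using P Z' by (auto intro!: L2_diff YL dest: chaos_L2)
  have "\<E> (\<lambda>w. (W w)\<^sup>2) = \<E> (\<lambda>w. (Y w - Z' w) * W w - (Y w - chaos_proj m Y w) * W w)"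
    by (simp add: W_def power2_eq_square algebra_simps)
  also have "\<dots> = \<E> (\<lambda>w. (Y w - Z' w) * W w) - \<E> (\<lambda>w. (Y w - chaos_proj m Y w) * W w)"
    by (intro Bochner_Integration.integral_diff L2_integrable_mult L chaos_L2[OF W])
  also have "\<dots> = 0" using PZ P W by simp
  finally have "L2_norm W = 0" by (simp add: L2_norm_def)
  then have "AE w in wiener_space. W w = 0" using L2_norm_eq_0_iff[OF chaos_L2[OF W]] by simp
  with P show ?thesis by (simp add: W_def Z'_def)
qed

text \<open>The least degree inside \<open>OU_gen\<close> may be smaller than \<open>d\<close>;
  comparing the two decompositions shows that the projections above the least degree vanish almost
  everywhere.\<close>

lemma OU_gen_components:
  assumes Z: "\<And>m. m \<le> d \<Longrightarrow> Z m \<in> chaos m" and Y: "Y = (\<lambda>w. \<Sum>m\<le>d. Z m w)"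
  shows "OU_gen Y \<in> L2_space \<and> (AE w in wiener_space. OU_gen Y w = (\<Sum>m\<le>d. - real m * Z m w))"
proof -
  have Yd: "Y \<in> chaos_le d" unfolding chaos_le_def using assms by auto
  define e where "e = (LEAST d. Y \<in> chaos_le d)"
  have "Y \<in> chaos_le e" unfolding e_def by (rule LeastI[of "\<lambda>d. Y \<in> chaos_le d", OF Yd])
  then obtain Z' where Z': "\<And>m. m \<le> e \<Longrightarrow> Z' m \<in> chaos m" "Y = (\<lambda>w. \<Sum>m\<le>e. Z' m w)"
    unfolding chaos_le_def by auto
  have ed: "e \<le> d" unfolding e_def by (rule Least_le[of "\<lambda>d. Y \<in> chaos_le d", OF Yd])
  note p1 = chaos_proj_components[of d Z Y, OF Z Y] and p2 = chaos_proj_components[of e Z' Y, OF Z']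
  have OU: "OU_gen Y = (\<lambda>w. \<Sum>m\<le>e. - real m * chaos_proj m Y w)"
    by (simp add: OU_gen_def[abs_def] e_def)
  have "OU_gen Y \<in> L2_space"
    unfolding OU using p1 by (intro L2_sum L2_cmult chaos_L2) auto
  moreover have "AE w in wiener_space. \<forall>m. chaos_proj m Y w = (if m \<le> d then Z m w else 0)"
    using p1 by (simp add: AE_all_countable)
  moreover have "AE w in wiener_space. \<forall>m. chaos_proj m Y w = (if m \<le> e then Z' m w else 0)"
    using p2 by (simp add: AE_all_countable)
  ultimately show ?thesis
  proof (intro conjI)
    assume "AE w in wiener_space. \<forall>m. chaos_proj m Y w = (if m \<le> d then Z m w else 0)"
      "AE w in wiener_space. \<forall>m. chaos_proj m Y w = (if m \<le> e then Z' m w else 0)"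
    then show "AE w in wiener_space. OU_gen Y w = (\<Sum>m\<le>d. - real m * Z m w)"
    proof eventually_elim
      case (elim w)
      have "(\<Sum>m\<le>d. - real m * Z m w) = (\<Sum>m\<le>d. - real m * chaos_proj m Y w)"
        using elim(1) by (intro sum.cong) auto
      also have "\<dots> = (\<Sum>m\<le>e. - real m * chaos_proj m Y w)"
        using ed elim(2) by (intro sum.mono_neutral_right) auto
      finally show ?case by (simp add: OU)
    qed
  qed
qed

lemma L2_norm_diff_cong_AE:
  assumes "AE w in wiener_space. U w = V w" "U \<in> L2_space" "V \<in> L2_space" "A \<in> L2_space"
  shows "L2_norm (\<lambda>w. A w - U w) = L2_norm (\<lambda>w. A w - V w)"
  using assms L2_space_measurable[OF L2_diff[OF assms(4,2)]] L2_space_measurable[OF L2_diff[OF assms(4,3)]]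
  by (intro L2_norm_cong_AE) auto

text \<open>With the degree fixed at \<open>d\<close>, the generator acts on components by weights
  of modulus at most d, so it passes to the limit although it is unbounded on L2.\<close>

lemma chaos_limit_OU_gen:
  assumes Y: "Y \<in> L2_space" and y: "\<And>j m. y j m \<in> HP (N j) {m}"
    and lim: "(\<lambda>j. L2_norm (\<lambda>w. (\<Sum>m\<le>d. y j m w) - Y w)) \<longlonglongrightarrow> 0"
  shows "OU_gen Y \<in> L2_space"
    and "(\<lambda>j. L2_norm (\<lambda>w. LL (N j) (\<lambda>w. \<Sum>m\<le>d. y j m w) w - OU_gen Y w)) \<longlonglongrightarrow> 0"
    and "chaos_proj m Y \<in> L2_space"
    and "m \<le> d \<Longrightarrow> (\<lambda>j. L2_norm (\<lambda>w. y j m w - chaos_proj m Y w)) \<longlonglongrightarrow> 0"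
    and "d < m \<Longrightarrow> L2_norm (chaos_proj m Y) = 0"
proof -
  from chaos_limit_components[OF Y y lim] obtain Z where
    Z: "\<And>m. m \<le> d \<Longrightarrow> Z m \<in> chaos m" "\<And>m. m \<le> d \<Longrightarrow> (\<lambda>j. L2_norm (\<lambda>w. y j m w - Z m w)) \<longlonglongrightarrow> 0"
    and YZ: "Y = (\<lambda>w. \<Sum>m\<le>d. Z m w)" by blast
  note OU = OU_gen_components[of d Z Y, OF Z(1) YZ] and proj = chaos_proj_components[of d Z Y, OF Z(1) YZ]
  show "OU_gen Y \<in> L2_space" using OU by simp
  show "chaos_proj m Y \<in> L2_space" using proj[of m] chaos_L2 by blast
  have ZL: "m \<le> d \<Longrightarrow> Z m \<in> L2_space" for m using Z(1) chaos_L2 by blast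
  have yL: "y j m \<in> L2_space" for j m by (rule HP_L2[OF y])
  show "(\<lambda>j. L2_norm (\<lambda>w. y j m w - chaos_proj m Y w)) \<longlonglongrightarrow> 0" if m: "m \<le> d"
  proof -
    have "L2_norm (\<lambda>w. y j m w - chaos_proj m Y w) = L2_norm (\<lambda>w. y j m w - Z m w)" for j
      using proj[of m] m by (intro L2_norm_diff_cong_AE ZL yL) (auto intro: chaos_L2)
    then show ?thesis using Z(2)[OF m] by simp
  qed
  show "L2_norm (chaos_proj m Y) = 0" if m: "d < m"
    using proj[of m] m L2_norm_eq_0_iff[of "chaos_proj m Y"] chaos_L2[of "chaos_proj m Y" m] by simp
  have "(\<lambda>j. \<Sum>m\<le>d. real m * L2_norm (\<lambda>w. y j m w - Z m w)) \<longlonglongrightarrow> (\<Sum>m\<le>d. real m * 0)"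
    using Z(2) by (intro tendsto_sum tendsto_mult tendsto_const) auto
  then have l: "(\<lambda>j. \<Sum>m\<le>d. real m * L2_norm (\<lambda>w. y j m w - Z m w)) \<longlonglongrightarrow> 0" by simp
  show "(\<lambda>j. L2_norm (\<lambda>w. LL (N j) (\<lambda>w. \<Sum>m\<le>d. y j m w) w - OU_gen Y w)) \<longlonglongrightarrow> 0"
  proof (rule tendsto_sandwich[OF _ _ tendsto_const l])
    have "L2_norm (\<lambda>w. LL (N j) (\<lambda>w. \<Sum>m\<le>d. y j m w) w - OU_gen Y w) \<le> (\<Sum>m\<le>d. real m * L2_norm (\<lambda>w. y j m w - Z m w))" for j
    proof -
      have "L2_norm (\<lambda>w. LL (N j) (\<lambda>w. \<Sum>m\<le>d. y j m w) w - OU_gen Y w)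
        = L2_norm (\<lambda>w. (\<Sum>m\<le>d. - real m * y j m w) - (\<Sum>m\<le>d. - real m * Z m w))"
        unfolding LL_sum_components[OF y]
        using OU by (intro L2_norm_diff_cong_AE L2_sum L2_cmult yL ZL) auto
      also have "\<dots> = L2_norm (\<lambda>w. \<Sum>m\<le>d. - real m * (y j m w - Z m w))"
        by (simp only: sum_subtractf[symmetric] right_diff_distrib)
      also have "\<dots> \<le> (\<Sum>m\<le>d. L2_norm (\<lambda>w. - real m * (y j m w - Z m w)))"
        by (intro L2_norm_sum L2_cmult L2_diff yL ZL) auto
      also have "\<dots> = (\<Sum>m\<le>d. real m * L2_norm (\<lambda>w. y j m w - Z m w))"
        by (simp only: L2_norm_cmult abs_minus abs_of_nat)
      finally show ?thesis .
    qed
    then show "\<forall>\<^sub>F j in sequentially. L2_norm (\<lambda>w. LL (N j) (\<lambda>w. \<Sum>m\<le>d. y j m w) w - OU_gen Y w) \<le> (\<Sum>m\<le>d. real m * L2_norm (\<lambda>w. y j m w - Z m w))"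
      by simp
  qed (simp add: L2_norm_nonneg)
qed

section \<open>Inequalities on the chaoses\<close>

lemma L2_tendsto_lincomb:
  assumes "\<And>j. A j \<in> L2_space" "U \<in> L2_space" "(\<lambda>j. L2_norm (\<lambda>w. A j w - U w)) \<longlonglongrightarrow> 0"
    and "\<And>j. B j \<in> L2_space" "V \<in> L2_space" "(\<lambda>j. L2_norm (\<lambda>w. B j w - V w)) \<longlonglongrightarrow> 0"
  shows "(\<lambda>j. L2_norm (\<lambda>w. (a * A j w + b * B j w) - (a * U w + b * V w))) \<longlonglongrightarrow> 0"
proof -
  let ?a = "\<lambda>j. L2_norm (\<lambda>w. A j w - U w)" and ?b = "\<lambda>j. L2_norm (\<lambda>w. B j w - V w)"
  have "(\<lambda>j. \<bar>a\<bar> * ?a j + \<bar>b\<bar> * ?b j) \<longlonglongrightarrow> \<bar>a\<bar> * 0 + \<bar>b\<bar> * 0"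
    by (intro tendsto_intros assms)
  then have lim: "(\<lambda>j. \<bar>a\<bar> * ?a j + \<bar>b\<bar> * ?b j) \<longlonglongrightarrow> 0" by simp
  have "L2_norm (\<lambda>w. (a * A j w + b * B j w) - (a * U w + b * V w)) \<le> \<bar>a\<bar> * ?a j + \<bar>b\<bar> * ?b j" for j
  proof -
    have "(\<lambda>w. (a * A j w + b * B j w) - (a * U w + b * V w)) = (\<lambda>w. a * (A j w - U w) + b * (B j w - V w))"
      by (simp add: algebra_simps)
    then show ?thesis
      using L2_norm_triangle[OF L2_cmult[OF L2_diff[OF assms(1,2)], of a] L2_cmult[OF L2_diff[OF assms(4,5)], of b]]
      by (simp only: L2_norm_cmult)
  qed
  then show ?thesis
    by (intro tendsto_sandwich[OF _ _ tendsto_const lim]) (simp_all add: L2_norm_nonneg)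
qed

lemma L2_tendsto_variance:
  assumes "\<And>j. A j \<in> L2_space" "U \<in> L2_space" "(\<lambda>j. L2_norm (\<lambda>w. A j w - U w)) \<longlonglongrightarrow> 0"
  shows "(\<lambda>j. wiener.variance (A j)) \<longlonglongrightarrow> wiener.variance U"
proof -
  have v: "wiener.variance W = (L2_norm W)\<^sup>2 - (\<E> W)\<^sup>2" if "W \<in> L2_space" for W
    using wiener.variance_eq[OF L2_integrable[OF that] L2_space_integrable_square[OF that]]
    by (simp add: L2_norm_square)
  show ?thesis
    unfolding v[OF assms(1)] v[OF assms(2)]
    by (intro tendsto_diff tendsto_power L2_tendsto_norm L2_tendsto_expectation assms)
qed

lemma L2_space_cong_AE:
  assumes "U \<in> borel_measurable wiener_space" "AE w in wiener_space. U w = V w" "V \<in> L2_space"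
  shows "U \<in> L2_space"
proof (rule L2_spaceI[OF assms(1)])
  have "integrable wiener_space (\<lambda>w. (U w)\<^sup>2) \<longleftrightarrow> integrable wiener_space (\<lambda>w. (V w)\<^sup>2)"
    using assms by (intro integrable_cong_AE) auto
  then show "integrable wiener_space (\<lambda>w. (U w)\<^sup>2)"
    using L2_space_integrable_square[OF assms(3)] by simp
qed

lemma OU_gen_limit:
  assumes Y: "Y \<in> L2_space" and y: "\<And>j. y j \<in> HP (N j) {..d}"
    and lim: "(\<lambda>j. L2_norm (\<lambda>w. y j w - Y w)) \<longlonglongrightarrow> 0"
  shows "OU_gen Y \<in> L2_space" "(\<lambda>j. L2_norm (\<lambda>w. LL (N j) (y j) w - OU_gen Y w)) \<longlonglongrightarrow> 0"
proof -
  have "\<forall>j. \<exists>f. (\<forall>m. f m \<in> HP (N j) {m}) \<and> y j = (\<lambda>w. \<Sum>m\<le>d. f m w)"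
    using HP_decomposition[OF y] by blast
  from choice[OF this] obtain z where z: "\<And>j m. z j m \<in> HP (N j) {m}" and yz: "\<And>j. y j = (\<lambda>w. \<Sum>m\<le>d. z j m w)"
    by blast
  have "(\<lambda>j. L2_norm (\<lambda>w. (\<Sum>m\<le>d. z j m w) - Y w)) \<longlonglongrightarrow> 0" using lim by (simp add: yz)
  from chaos_limit_OU_gen(1,2)[OF Y z this]
  show "OU_gen Y \<in> L2_space" "(\<lambda>j. L2_norm (\<lambda>w. LL (N j) (y j) w - OU_gen Y w)) \<longlonglongrightarrow> 0"
    by (simp_all add: yz)
qed

lemma OU_gen_chaos:
  assumes "X \<in> chaos q"
  shows "OU_gen X \<in> L2_space \<and> (AE w in wiener_space. OU_gen X w = - real q * X w)"
proof -
  define Z where "Z m = (if m = q then X else (\<lambda>w. 0))" for m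
  have 1: "X w = (\<Sum>m\<le>q. Z m w)" for w
  proof -
    have "(\<Sum>m\<le>q. Z m w) = (\<Sum>m\<le>q. if m = q then X w else 0)" by (intro sum.cong) (auto simp: Z_def)
    then show ?thesis by simp
  qed
  have 2: "(\<Sum>m\<le>q. - real m * Z m w) = - real q * X w" for w
  proof -
    have "(\<Sum>m\<le>q. - real m * Z m w) = (\<Sum>m\<le>q. if m = q then - real q * X w else 0)" by (intro sum.cong) (auto simp: Z_def)
    then show ?thesis by simp
  qed
  have "Z m \<in> chaos m" for m using assms chaos_zero by (auto simp: Z_def)
  from OU_gen_components[of q Z X, OF this ext[OF 1]] show ?thesis unfolding 2 .
qed

text \<open>Almost everywhere \<open>OU_gen F\<close> is -p F and \<open>OU_gen X\<close> is -q X,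
  so the carre du champ is (L + p + q)(FX) / 2, the same formula as for \<open>Gm\<close>.
  Convergence in all moments makes the products converge in L2.\<close>

lemma carre_du_champ_limit:
  assumes F: "F \<in> chaos p" and X: "X \<in> chaos q"
    and f: "\<And>j. f j \<in> HP (N j) {p}" and x: "\<And>j. x j \<in> HP (N j) {q}" and m: "mconv f F" "mconv x X"
  shows "carre_du_champ F X \<in> L2_space"
    and "(\<lambda>j. L2_norm (\<lambda>w. Gm (N j) (f j) (x j) w - carre_du_champ F X w)) \<longlonglongrightarrow> 0"
proof -
  let ?Y = "\<lambda>w. F w * X w" and ?y = "\<lambda>j w. f j w * x j w"
  have mY: "mconv ?y ?Y" by (rule mconv_mult[OF m])
  have YL: "?Y \<in> L2_space" by (rule all_moments_L2[OF mconv_all_moments(1)[OF mY]])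
  have y: "?y j \<in> HP (N j) {..p+q}" for j
    by (intro HP_mult_le HP_mono[OF f] HP_mono[OF x]) auto
  note OU = OU_gen_limit[OF YL y mconv_L2[OF mY]]
  define T where "T w = (1/2) * OU_gen ?Y w + (real p + real q) / 2 * ?Y w" for w
  have TL: "T \<in> L2_space" unfolding T_def[abs_def] by (intro L2_add L2_cmult OU YL)
  note OX = OU_gen_chaos[OF X] and OF' = OU_gen_chaos[OF F]
  have [measurable]: "F \<in> borel_measurable wiener_space" "X \<in> borel_measurable wiener_space"
    "OU_gen ?Y \<in> borel_measurable wiener_space" "OU_gen X \<in> borel_measurable wiener_space" "OU_gen F \<in> borel_measurable wiener_space"
    using chaos_L2[OF F] chaos_L2[OF X] OU(1) OX OF' by (auto dest: L2_space_measurable)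
  have meas: "carre_du_champ F X \<in> borel_measurable wiener_space"
    unfolding carre_du_champ_def[abs_def] by measurable
  from OX OF' have AE: "AE w in wiener_space. carre_du_champ F X w = T w"
    by (auto elim!: eventually_elim2 simp: carre_du_champ_def T_def field_simps)
  show CL: "carre_du_champ F X \<in> L2_space" by (rule L2_space_cong_AE[OF meas AE TL])
  have Gm: "Gm (N j) (f j) (x j) = (\<lambda>w. (1/2) * LL (N j) (?y j) w + (real p + real q) / 2 * ?y j w)" for j
    using Gm_eigen[OF f[of j] x[of j]] by (auto simp: fun_eq_iff field_simps)
  have GL: "Gm (N j) (f j) (x j) \<in> L2_space" for j by (rule HP_L2[OF HP_Gm[OF f x]])
  have "(\<lambda>j. L2_norm (\<lambda>w. Gm (N j) (f j) (x j) w - T w)) \<longlonglongrightarrow> 0"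
    unfolding Gm T_def
    by (intro L2_tendsto_lincomb OU YL mconv_L2[OF mY] HP_L2[OF HP_LL[OF y]] HP_L2[OF y])
  then show "(\<lambda>j. L2_norm (\<lambda>w. Gm (N j) (f j) (x j) w - carre_du_champ F X w)) \<longlonglongrightarrow> 0"
    by (simp only: L2_norm_diff_cong_AE[OF AE CL TL GL])
qed

lemma variance_carre_limit:
  assumes F: "F \<in> chaos p" and f: "\<And>j. f j \<in> HP (N j) {p}" and m: "mconv f F"
  shows "(\<lambda>j. wiener.variance (Gm (N j) (f j) (f j))) \<longlonglongrightarrow> wiener.variance (carre_du_champ F F)"
  using carre_du_champ_limit[OF F F f f m m]
  by (intro L2_tendsto_variance HP_L2[OF HP_Gm[OF f f]])

lemma moment_limit: "mconv f F \<Longrightarrow> (\<lambda>j. \<E> (\<lambda>w. f j w ^ k)) \<longlonglongrightarrow> \<E> (\<lambda>w. F w ^ k)"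
  by (rule mconv_expectation[OF mconv_power])

lemma chaos_integrable_power: "F \<in> chaos p \<Longrightarrow> integrable wiener_space (\<lambda>w. F w ^ k)"
  using chaos_approx[of F p] mconv_power[of _ F k] mconv_all_moments(1) all_moments_L2 L2_integrable by blast

lemma chaos_expectation_0:
  assumes "F \<in> chaos p" "p \<ge> 1"
  shows "\<E> F = 0"
  using chaos_orthogonal[OF assms(1) HP_chaos[OF HP_const[of "{0}" 1]]] assms(2) by simp

lemma chaos_moment_bound:
  "\<exists>C\<ge>0. \<forall>F\<in>chaos p. \<E> (\<lambda>w. F w ^ (2 ^ Suc s)) \<le> C * (\<E> (\<lambda>w. (F w)\<^sup>2)) ^ (2 ^ s)"
proof -
  obtain C where C: "C \<ge> 0"
    "\<And>N F. F \<in> HP N {..p} \<Longrightarrow> \<E> (\<lambda>w. F w ^ (2 ^ Suc s)) \<le> C * (\<E> (\<lambda>w. (F w)\<^sup>2)) ^ (2 ^ s)"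
    using moment_bound_dyadic[of p s] by blast
  have "\<E> (\<lambda>w. F w ^ (2 ^ Suc s)) \<le> C * (\<E> (\<lambda>w. (F w)\<^sup>2)) ^ (2 ^ s)" if "F \<in> chaos p" for F
  proof -
    from chaos_approx[OF that] obtain N f where f: "\<And>j. f j \<in> HP (N j) {p}" and m: "mconv f F" by blast
    show ?thesis
    proof (rule LIMSEQ_le[OF moment_limit[OF m] tendsto_mult[OF tendsto_const tendsto_power[OF moment_limit[OF m]]]])
      show "\<exists>M. \<forall>j\<ge>M. \<E> (\<lambda>w. f j w ^ (2 ^ Suc s)) \<le> C * (\<E> (\<lambda>w. (f j w)\<^sup>2)) ^ (2 ^ s)"
        by (intro exI allI impI C(2)[OF HP_mono[OF f]]) simp
    qed
  qed
  with C(1) show ?thesis by blast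
qed

lemma chaos_variance_le_fourth_moment:
  assumes F: "F \<in> chaos p"
  shows "wiener.variance (carre_du_champ F F) \<le> (real p)\<^sup>2 / 3 * (\<E> (\<lambda>w. F w ^ 4) - 3 * (\<E> (\<lambda>w. (F w)\<^sup>2))\<^sup>2)"
proof -
  from chaos_approx[OF F] obtain N f where f: "\<And>j. f j \<in> HP (N j) {p}" and m: "mconv f F" by blast
  have "(\<lambda>j. (real p)\<^sup>2 / 3 * (\<E> (\<lambda>w. f j w ^ 4) - 3 * (\<E> (\<lambda>w. (f j w)\<^sup>2))\<^sup>2)) \<longlonglongrightarrow>
      (real p)\<^sup>2 / 3 * (\<E> (\<lambda>w. F w ^ 4) - 3 * (\<E> (\<lambda>w. (F w)\<^sup>2))\<^sup>2)"
    by (intro tendsto_mult tendsto_diff tendsto_const tendsto_power moment_limit m)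
  then show ?thesis
    by (rule LIMSEQ_le[OF variance_carre_limit[OF F f m]]) (intro exI allI impI variance_Gm_le_fourth_moment f)
qed

text \<open>Error form of \<open>moment_recursion\<close>: replacing Gamma[F,F] by its mean p E F^2
  costs, by Cauchy-Schwarz, the norm of F^k times the standard deviation of Gamma[F,F].\<close>

lemma chaos_moment_recursion:
  assumes F: "F \<in> chaos p"
  shows "\<bar>real p * \<E> (\<lambda>w. F w ^ (k + 2)) - real (k + 1) * (real p * \<E> (\<lambda>w. (F w)\<^sup>2)) * \<E> (\<lambda>w. F w ^ k)\<bar>
     \<le> real (k + 1) * sqrt (\<E> (\<lambda>w. F w ^ (2 * k))) * sqrt (wiener.variance (carre_du_champ F F))"
proof -
  from chaos_approx[OF F] obtain N f where f: "\<And>j. f j \<in> HP (N j) {p}" and m: "mconv f F" by blast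
  have bd: "\<bar>real p * \<E> (\<lambda>w. G w ^ (k + 2)) - real (k + 1) * (real p * \<E> (\<lambda>w. (G w)\<^sup>2)) * \<E> (\<lambda>w. G w ^ k)\<bar>
     \<le> real (k + 1) * sqrt (\<E> (\<lambda>w. G w ^ (2 * k))) * sqrt (wiener.variance (Gm N G G))" if G: "G \<in> HP N {p}" for N G
  proof -
    note GU = HP_UNIV[OF G]
    let ?e = "\<E> (Gm N G G)"
    have "\<E> (\<lambda>w. G w ^ k * (Gm N G G w - ?e)) = \<E> (\<lambda>w. G w ^ k * Gm N G G w - G w ^ k * ?e)"
      by (simp add: algebra_simps)
    also have "\<dots> = \<E> (\<lambda>w. G w ^ k * Gm N G G w) - \<E> (\<lambda>w. G w ^ k * ?e)"
      by (intro Bochner_Integration.integral_diff HP_integrable[where N = N and S = UNIV] PA_intros GU)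
    also have "\<dots> = \<E> (\<lambda>w. G w ^ k * Gm N G G w) - (real p * \<E> (\<lambda>w. (G w)\<^sup>2)) * \<E> (\<lambda>w. G w ^ k)"
      by (simp add: expectation_Gm_self[OF G])
    finally have "real p * \<E> (\<lambda>w. G w ^ (k + 2)) - real (k + 1) * (real p * \<E> (\<lambda>w. (G w)\<^sup>2)) * \<E> (\<lambda>w. G w ^ k)
       = real (k + 1) * \<E> (\<lambda>w. G w ^ k * (Gm N G G w - ?e))"
      unfolding moment_recursion[OF G] by (simp only: right_diff_distrib mult.assoc)
    then have "\<bar>real p * \<E> (\<lambda>w. G w ^ (k + 2)) - real (k + 1) * (real p * \<E> (\<lambda>w. (G w)\<^sup>2)) * \<E> (\<lambda>w. G w ^ k)\<bar>
       = real (k + 1) * \<bar>\<E> (\<lambda>w. G w ^ k * (Gm N G G w - ?e))\<bar>"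
      by (simp only: abs_mult abs_of_nat)
    also have "\<dots> \<le> real (k + 1) * (L2_norm (\<lambda>w. G w ^ k) * L2_norm (\<lambda>w. Gm N G G w - ?e))"
      by (intro mult_left_mono L2_Cauchy_Schwarz HP_L2[where N = N and S = UNIV] PA_intros GU) simp
    also have "L2_norm (\<lambda>w. G w ^ k) = sqrt (\<E> (\<lambda>w. G w ^ (2 * k)))"
      by (simp add: L2_norm_def power_mult[symmetric] mult.commute)
    finally show ?thesis by (simp add: L2_norm_def mult.assoc)
  qed
  have "(\<lambda>j. \<bar>real p * \<E> (\<lambda>w. f j w ^ (k + 2)) - real (k + 1) * (real p * \<E> (\<lambda>w. (f j w)\<^sup>2)) * \<E> (\<lambda>w. f j w ^ k)\<bar>) \<longlonglongrightarrow>
     \<bar>real p * \<E> (\<lambda>w. F w ^ (k + 2)) - real (k + 1) * (real p * \<E> (\<lambda>w. (F w)\<^sup>2)) * \<E> (\<lambda>w. F w ^ k)\<bar>"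
    by (intro tendsto_rabs tendsto_mult tendsto_diff tendsto_const moment_limit m)
  moreover have "(\<lambda>j. real (k + 1) * sqrt (\<E> (\<lambda>w. f j w ^ (2 * k))) * sqrt (wiener.variance (Gm (N j) (f j) (f j)))) \<longlonglongrightarrow>
     real (k + 1) * sqrt (\<E> (\<lambda>w. F w ^ (2 * k))) * sqrt (wiener.variance (carre_du_champ F F))"
    by (intro tendsto_mult tendsto_const tendsto_real_sqrt moment_limit m variance_carre_limit[OF F f m])
  ultimately show ?thesis
    by (rule LIMSEQ_le) (intro exI allI impI bd f)
qed

lemma hermite_OU_limit:
  assumes F: "F \<in> chaos p" and f: "\<And>j. f j \<in> HP (N j) {p}" and m: "mconv f F"
  shows "(\<lambda>w. OU_gen (\<lambda>w. poly (hermite k) (F w)) w + c * poly (hermite k) (F w)) \<in> L2_space"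
    and "(\<lambda>j. L2_norm (\<lambda>w. LL (N j) (\<lambda>w. poly (hermite k) (f j w)) w + c * poly (hermite k) (f j w)))
      \<longlonglongrightarrow> L2_norm (\<lambda>w. OU_gen (\<lambda>w. poly (hermite k) (F w)) w + c * poly (hermite k) (F w))"
proof -
  let ?Y = "\<lambda>w. poly (hermite k) (F w)" and ?y = "\<lambda>j w. poly (hermite k) (f j w)"
  have mY: "mconv ?y ?Y" by (rule mconv_poly[OF m])
  have YL: "?Y \<in> L2_space" by (rule all_moments_L2[OF mconv_all_moments(1)[OF mY]])
  have y: "?y j \<in> HP (N j) {..degree (hermite k) * p}" for j
    by (intro HP_poly HP_mono[OF f]) simp
  note OU = OU_gen_limit[OF YL y mconv_L2[OF mY]]
  let ?D = "\<lambda>j w. LL (N j) (?y j) w + c * ?y j w" and ?D' = "\<lambda>w. OU_gen ?Y w + c * ?Y w"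
  show D': "?D' \<in> L2_space" by (intro L2_add L2_cmult OU YL)
  have L: "(\<lambda>j. L2_norm (\<lambda>w. ?D j w - ?D' w)) \<longlonglongrightarrow> 0"
    using L2_tendsto_lincomb[OF HP_L2[OF HP_LL[OF y]] OU HP_L2[OF y] YL mconv_L2[OF mY], where a = 1 and b = c]
    by simp
  have "?D j \<in> L2_space" for j
    by (intro L2_add L2_cmult HP_L2[OF HP_LL[OF y]] HP_L2[OF y])
  from L2_tendsto_norm[OF this D' L] show "(\<lambda>j. L2_norm (?D j)) \<longlonglongrightarrow> L2_norm ?D'" .
qed

text \<open>The strict bound 2 on the second moment of \<open>F\<close> passes to all late
  approximants, to which \<open>LL_hermite_bound\<close> applies.\<close>

lemma chaos_hermite_bound:
  "\<exists>C. \<forall>F\<in>chaos p. \<E> (\<lambda>w. (F w)\<^sup>2) < 2 \<longrightarrow>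
     (L2_norm (\<lambda>w. OU_gen (\<lambda>w. poly (hermite k) (F w)) w + real (k * p) * poly (hermite k) (F w)))\<^sup>2
     \<le> C * (wiener.variance (carre_du_champ F F) + (real p * (\<E> (\<lambda>w. (F w)\<^sup>2) - 1))\<^sup>2)"
proof -
  obtain C where C: "\<And>N F. F \<in> HP N {p} \<Longrightarrow> \<E> (\<lambda>w. (F w)\<^sup>2) \<le> 2 \<Longrightarrow>
     \<E> (\<lambda>w. (LL N (\<lambda>w. poly (hermite k) (F w)) w + real (k * p) * poly (hermite k) (F w))\<^sup>2)
     \<le> C * (wiener.variance (Gm N F F) + (real p * (\<E> (\<lambda>w. (F w)\<^sup>2) - 1))\<^sup>2)"
    using LL_hermite_bound[of p k] by blast
  show ?thesis
  proof (intro exI[of _ C] ballI impI)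
    fix F assume F: "F \<in> chaos p" and F2: "\<E> (\<lambda>w. (F w)\<^sup>2) < 2"
    from chaos_approx[OF F] obtain N f where f: "\<And>j. f j \<in> HP (N j) {p}" and m: "mconv f F" by blast
    have ev: "\<forall>\<^sub>F j in sequentially. \<E> (\<lambda>w. (f j w)\<^sup>2) < 2"
      by (rule order_tendstoD(2)[OF moment_limit[OF m] F2])
    have r: "(\<lambda>j. C * (wiener.variance (Gm (N j) (f j) (f j)) + (real p * (\<E> (\<lambda>w. (f j w)\<^sup>2) - 1))\<^sup>2)) \<longlonglongrightarrow>
       C * (wiener.variance (carre_du_champ F F) + (real p * (\<E> (\<lambda>w. (F w)\<^sup>2) - 1))\<^sup>2)"
      by (intro tendsto_mult tendsto_add tendsto_power tendsto_diff tendsto_const moment_limit m variance_carre_limit[OF F f m])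
    show "(L2_norm (\<lambda>w. OU_gen (\<lambda>w. poly (hermite k) (F w)) w + real (k * p) * poly (hermite k) (F w)))\<^sup>2
     \<le> C * (wiener.variance (carre_du_champ F F) + (real p * (\<E> (\<lambda>w. (F w)\<^sup>2) - 1))\<^sup>2)"
    proof (rule tendsto_le[OF _ r tendsto_power[OF hermite_OU_limit(2)[OF F f m]]])
      show "\<forall>\<^sub>F j in sequentially. (L2_norm (\<lambda>w. LL (N j) (\<lambda>w. poly (hermite k) (f j w)) w + real (k * p) * poly (hermite k) (f j w)))\<^sup>2
          \<le> C * (wiener.variance (Gm (N j) (f j) (f j)) + (real p * (\<E> (\<lambda>w. (f j w)\<^sup>2) - 1))\<^sup>2)"
        using ev by eventually_elim (unfold L2_norm_square, intro C f, simp)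
    qed simp
  qed
qed

text \<open>On the component of order m the operator L + kp is multiplication by kp - m, and an
  integer q different from kp has distance at least 1 from it. So no constant is lost.\<close>

lemma chaos_proj_hermite_le:
  assumes F: "F \<in> chaos p" and q: "q \<noteq> k * p"
  shows "L2_norm (chaos_proj q (\<lambda>w. poly (hermite k) (F w)))
    \<le> L2_norm (\<lambda>w. OU_gen (\<lambda>w. poly (hermite k) (F w)) w + real (k * p) * poly (hermite k) (F w))"
proof -
  from chaos_approx[OF F] obtain N f where f: "\<And>j. f j \<in> HP (N j) {p}" and m: "mconv f F" by blast
  let ?Y = "\<lambda>w. poly (hermite k) (F w)" and ?y = "\<lambda>j w. poly (hermite k) (f j w)"
  let ?d = "degree (hermite k) * p"
  have mY: "mconv ?y ?Y" by (rule mconv_poly[OF m])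
  have YL: "?Y \<in> L2_space" by (rule all_moments_L2[OF mconv_all_moments(1)[OF mY]])
  have y: "?y j \<in> HP (N j) {..?d}" for j
    by (intro HP_poly HP_mono[OF f]) simp
  have "\<forall>j. \<exists>f. (\<forall>m. f m \<in> HP (N j) {m}) \<and> ?y j = (\<lambda>w. \<Sum>m\<le>?d. f m w)"
    using HP_decomposition[OF y] by blast
  from choice[OF this] obtain z where z: "\<And>j m. z j m \<in> HP (N j) {m}" and yz: "\<And>j. ?y j = (\<lambda>w. \<Sum>m\<le>?d. z j m w)"
    by blast
  have "(\<lambda>j. L2_norm (\<lambda>w. (\<Sum>m\<le>?d. z j m w) - ?Y w)) \<longlonglongrightarrow> 0"
    using mconv_L2[OF mY] by (simp only: fun_cong[OF yz])
  note lim = chaos_limit_OU_gen[OF YL z this]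
  show ?thesis
  proof (cases "q \<le> ?d")
    case False
    then show ?thesis using lim(5)[of q] by (simp add: L2_norm_nonneg)
  next
    case True
    show ?thesis
    proof (rule LIMSEQ_le[OF L2_tendsto_norm[OF HP_L2[OF z] lim(3) lim(4)[OF True]] hermite_OU_limit(2)[OF F f m]], intro exI allI impI)
      fix j
      have "LL (N j) (?y j) w + real (k * p) * ?y j w = (\<Sum>m\<le>?d. (real (k * p) - real m) * z j m w)" for w
        unfolding yz fun_cong[OF yz[of j]] LL_sum_components[OF z]
        by (simp add: sum_distrib_left sum.distrib[symmetric] algebra_simps)
      then have "(L2_norm (\<lambda>w. LL (N j) (?y j) w + real (k * p) * ?y j w))\<^sup>2 = (\<Sum>m\<le>?d. (real (k * p) - real m)\<^sup>2 * \<E> (\<lambda>w. (z j m w)\<^sup>2))"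
        by (simp only: L2_norm_square expectation_components_square[OF z])
      also have "\<dots> \<ge> (real (k * p) - real q)\<^sup>2 * \<E> (\<lambda>w. (z j q w)\<^sup>2)"
        using True by (intro member_le_sum[where f = "\<lambda>m. (real (k * p) - real m)\<^sup>2 * \<E> (\<lambda>w. (z j m w)\<^sup>2)"]) auto
      finally have "(real (k * p) - real q)\<^sup>2 * \<E> (\<lambda>w. (z j q w)\<^sup>2) \<le> (L2_norm (\<lambda>w. LL (N j) (?y j) w + real (k * p) * ?y j w))\<^sup>2" .
      moreover have "1 \<le> (real (k * p) - real q)\<^sup>2"
      proof -
        have "1 \<le> \<bar>int (k * p) - int q\<bar>" using q by linarith
        then have "1 \<le> \<bar>real (k * p) - real q\<bar>" by linarith
        then show ?thesis using abs_le_square_iff[of 1 "real (k * p) - real q"] by simp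
      qed
      then have "1 * \<E> (\<lambda>w. (z j q w)\<^sup>2) \<le> (real (k * p) - real q)\<^sup>2 * \<E> (\<lambda>w. (z j q w)\<^sup>2)"
        by (intro mult_right_mono) auto
      ultimately have "(L2_norm (z j q))\<^sup>2 \<le> (L2_norm (\<lambda>w. LL (N j) (?y j) w + real (k * p) * ?y j w))\<^sup>2"
        unfolding L2_norm_square[of "z j q"] by linarith
      then show "L2_norm (z j q) \<le> L2_norm (\<lambda>w. LL (N j) (?y j) w + real (k * p) * ?y j w)"
        by (rule power2_le_imp_le) (rule L2_norm_nonneg)
    qed
  qed
qed

text \<open>H_2(F) = F^2 - 1 differs from F^2 only in order 0, so its components of orders strictly
  between 0 and 2p are those that make up the variance, with weights at most p^2.\<close>

lemma chaos_variance_le_proj: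
  assumes F: "F \<in> chaos p"
  shows "wiener.variance (carre_du_champ F F) \<le> (\<Sum>m\<in>{1..<2*p}. (real p)\<^sup>2 * (L2_norm (chaos_proj m (\<lambda>w. poly (hermite 2) (F w))))\<^sup>2)"
proof -
  from chaos_approx[OF F] obtain N f where f: "\<And>j. f j \<in> HP (N j) {p}" and m: "mconv f F" by blast
  let ?Y = "\<lambda>w. poly (hermite 2) (F w)" and ?y = "\<lambda>j w. poly (hermite 2) (f j w)"
  have mY: "mconv ?y ?Y" by (rule mconv_poly[OF m])
  have YL: "?Y \<in> L2_space" by (rule all_moments_L2[OF mconv_all_moments(1)[OF mY]])
  have "\<forall>j. \<exists>g. (\<forall>m. g m \<in> HP (N j) {m}) \<and> (\<forall>w. (f j w)\<^sup>2 = (\<Sum>m\<le>2*p. g m w)) \<and>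
    g 0 = (\<lambda>w. \<E> (\<lambda>w. (f j w)\<^sup>2)) \<and> (\<forall>w. Gm (N j) (f j) (f j) w = (\<Sum>m\<le>2*p. (real p - real m / 2) * g m w))"
    using square_components[OF f] by blast
  from choice[OF this] obtain g where g: "\<And>j m. g j m \<in> HP (N j) {m}"
    "\<And>j w. (f j w)\<^sup>2 = (\<Sum>m\<le>2*p. g j m w)" "\<And>j. g j 0 = (\<lambda>w. \<E> (\<lambda>w. (f j w)\<^sup>2))"
    "\<And>j w. Gm (N j) (f j) (f j) w = (\<Sum>m\<le>2*p. (real p - real m / 2) * g j m w)" by blast
  define z where "z j m w = g j m w - (if m = 0 then 1 else 0)" for j m w
  have z: "z j m \<in> HP (N j) {m}" for j m
    unfolding z_def[abs_def] by (cases "m = 0") (auto intro!: HP_diff HP_const HP.zero g(1) simp: g(1))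
  have h2: "poly (hermite 2) x = x\<^sup>2 - 1" for x
    by (simp add: numeral_2_eq_2 pderiv_pCons power2_eq_square)
  have yz: "?y j w = (\<Sum>m\<le>2*p. z j m w)" for j w
    by (simp add: h2 g(2) z_def sum_subtractf)
  have "(\<lambda>j. L2_norm (\<lambda>w. (\<Sum>m\<le>2*p. z j m w) - ?Y w)) \<longlonglongrightarrow> 0"
    using mconv_L2[OF mY] by (simp only: yz)
  note lim = chaos_limit_OU_gen[OF YL z this]
  have r: "(\<lambda>j. \<Sum>m\<in>{1..<2*p}. (real p)\<^sup>2 * (L2_norm (z j m))\<^sup>2) \<longlonglongrightarrow>
     (\<Sum>m\<in>{1..<2*p}. (real p)\<^sup>2 * (L2_norm (chaos_proj m ?Y))\<^sup>2)"
  proof (intro tendsto_sum tendsto_mult tendsto_const tendsto_power)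
    fix m assume "m \<in> {1..<2*p}"
    then have "m \<le> 2 * p" by simp
    from L2_tendsto_norm[OF HP_L2[OF z] lim(3) lim(4)[OF this]]
    show "(\<lambda>j. L2_norm (z j m)) \<longlonglongrightarrow> L2_norm (chaos_proj m ?Y)" .
  qed
  show ?thesis
  proof (rule LIMSEQ_le[OF variance_carre_limit[OF F f m] r], intro exI allI impI)
    fix j
    have "wiener.variance (Gm (N j) (f j) (f j)) = (\<Sum>m=1..2*p. (real p - real m / 2)\<^sup>2 * \<E> (\<lambda>w. (g j m w)\<^sup>2))"
      by (rule variance_Gm_components[OF f g(1) g(3) g(4)])
    also have "\<dots> = (\<Sum>m\<in>{1..<2*p}. (real p - real m / 2)\<^sup>2 * \<E> (\<lambda>w. (g j m w)\<^sup>2))"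
      by (rule sum.mono_neutral_right) (auto simp: not_less)
    also have "\<dots> \<le> (\<Sum>m\<in>{1..<2*p}. (real p)\<^sup>2 * (L2_norm (z j m))\<^sup>2)"
    proof (rule sum_mono)
      fix m assume "m \<in> {1..<2*p}"
      then have "z j m = g j m" "real m \<le> 2 * real p" by (auto simp: z_def fun_eq_iff)
      then show "(real p - real m / 2)\<^sup>2 * \<E> (\<lambda>w. (g j m w)\<^sup>2) \<le> (real p)\<^sup>2 * (L2_norm (z j m))\<^sup>2"
        unfolding L2_norm_square by (intro mult_mono power_mono) auto
    qed
    finally show "wiener.variance (Gm (N j) (f j) (f j)) \<le> (\<Sum>m\<in>{1..<2*p}. (real p)\<^sup>2 * (L2_norm (z j m))\<^sup>2)" .
  qed
qed

lemma chaos_carre_le_variance: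
  assumes F: "F \<in> chaos p" and X: "X \<in> chaos q" and "q < p"
  shows "(L2_norm (carre_du_champ F X))\<^sup>2 \<le> real (p + q) * real p * 3 ^ q * \<E> (\<lambda>w. (X w)\<^sup>2) * sqrt (wiener.variance (carre_du_champ F F))"
proof -
  from chaos_approx2[OF F X] obtain N f x where f: "\<And>j. f j \<in> HP (N j) {p}" and x: "\<And>j. x j \<in> HP (N j) {q}"
    and m: "mconv f F" "mconv x X" by blast
  note lim = carre_du_champ_limit[OF F X f x m]
  have "(\<lambda>j. real (p + q) * real p * 3 ^ q * \<E> (\<lambda>w. (x j w)\<^sup>2) * sqrt (wiener.variance (Gm (N j) (f j) (f j)))) \<longlonglongrightarrow>
     real (p + q) * real p * 3 ^ q * \<E> (\<lambda>w. (X w)\<^sup>2) * sqrt (wiener.variance (carre_du_champ F F))"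
    by (intro tendsto_mult tendsto_const tendsto_real_sqrt moment_limit m variance_carre_limit[OF F f m(1)])
  then show ?thesis
    by (rule LIMSEQ_le[OF tendsto_power[OF L2_tendsto_norm[OF HP_L2[OF HP_Gm[OF f x]] lim]]])
       (unfold L2_norm_square, intro exI allI impI expectation_Gm_square_le_variance[OF f x \<open>q < p\<close>])
qed

section \<open>Directional influence on the chaoses\<close>

lemma Gm_lincomb:
  assumes "F \<in> HP N S" "G \<in> HP N T"
  shows "Gm N (\<lambda>w. a * F w + b * G w) X w = a * Gm N F X w + b * Gm N G X w"
proof -
  have "pd i (\<lambda>w. a * F w + b * G w) = (\<lambda>w. a * pd i F w + b * pd i G w)" if "i < N" for i
    using pd_add[OF HP_cmult[OF assms(1)] HP_cmult[OF assms(2)] that] pd_cmult[OF assms(1) that] pd_cmult[OF assms(2) that]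
    by simp
  then have "Gm N (\<lambda>w. a * F w + b * G w) X w = (\<Sum>i<N. a * (pd i F w * pd i X w) + b * (pd i G w * pd i X w))"
    unfolding Gm_def by (intro sum.cong) (auto simp: algebra_simps)
  then show ?thesis by (simp add: Gm_def sum.distrib sum_distrib_left)
qed

lemma Gm_mono_N:
  assumes "N \<le> M" "F \<in> HP N S" "X \<in> HP N T"
  shows "Gm M F X = Gm N F X"
  using assms(1)
proof (induction rule: dec_induct)
  case (step n)
  then show ?case
    using Gm_fresh[OF HP_mono_N[OF step.hyps(1) assms(2)] HP_mono_N[OF step.hyps(1) assms(3)], of 1] by simp
qed simp

text \<open>The hypothesis concerns the limit \<open>F\<close>, whereas the variance estimate runs
  on the polynomials \<open>f j\<close>. The continuity bound \<open>Gm_bounded\<close> pays for the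
  exchange with a multiple of the distance between them. \<open>M\<close> stays free because a fresh
  coordinate is added later.\<close>

lemma Gm_bound_from_influence:
  assumes F: "F \<in> chaos p" and f: "\<And>j. f j \<in> HP (N j) {p}" and m: "mconv f F"
    and bound: "\<And>X. X \<in> chaos q \<Longrightarrow> \<E> (\<lambda>w. (X w)\<^sup>2) = 1 \<Longrightarrow> L2_norm (carre_du_champ F X) \<le> R"
    and Z: "Z \<in> HP M {q}" and M: "N j \<le> M"
  shows "L2_norm (Gm M (f j) Z) \<le> (R + real (p + q) * 3 ^ (p + q) * L2_norm (\<lambda>w. f j w - F w)) * L2_norm Z"
proof (cases "L2_norm Z = 0")
  case True
  then show ?thesis
    using Gm_bounded[OF HP_mono_N[OF M f] Z] L2_norm_nonneg[of "Gm M (f j) Z"] by simp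
next
  case False
  define K where "K = real (p + q) * 3 ^ (p + q)"
  define n where "n = L2_norm Z"
  have n: "n > 0" using False L2_norm_nonneg[of Z] by (simp add: n_def)
  define Z' where "Z' w = (1 / n) * Z w" for w
  have Z': "Z' \<in> HP M {q}" unfolding Z'_def[abs_def] by (rule HP_cmult[OF Z])
  have n1: "L2_norm Z' = 1"
    unfolding Z'_def[abs_def] L2_norm_cmult using n by (simp add: n_def)
  then have E1: "\<E> (\<lambda>w. (Z' w)\<^sup>2) = 1" by (simp add: L2_norm_square[symmetric])
  \<comment> \<open>\<open>Z\<close> and \<open>f j\<close> fit into \<open>M\<close> coordinates
    but \<open>f i\<close> uses \<open>N i\<close>, so a common number is taken for each
    \<open>i\<close>.\<close>
  let ?N = "\<lambda>i. max M (N i)"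
  have fi: "f i \<in> HP (?N i) {p}" and Zi: "Z' \<in> HP (?N i) {q}" and fj: "f j \<in> HP (?N i) {p}" for i
    using HP_mono_N[OF _ f[of i], of "?N i"] HP_mono_N[OF _ Z', of "?N i"] HP_mono_N[OF _ f[of j], of "?N i"] M by auto
  note lim = carre_du_champ_limit[OF F HP_chaos[OF Z'] fi Zi m mconv_const[OF HP_all_moments[OF Z']]]
  have l1: "(\<lambda>i. L2_norm (Gm (?N i) (f i) Z')) \<longlonglongrightarrow> L2_norm (carre_du_champ F Z')"
    by (rule L2_tendsto_norm[OF HP_L2[OF HP_Gm[OF fi Zi]] lim])
  have l2: "(\<lambda>i. L2_norm (\<lambda>w. f j w - f i w)) \<longlonglongrightarrow> L2_norm (\<lambda>w. f j w - F w)"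
  proof (rule L2_tendsto_norm)
    show "(\<lambda>i. L2_norm (\<lambda>w. (f j w - f i w) - (f j w - F w))) \<longlonglongrightarrow> 0"
      using mconv_L2[OF m] by (simp add: L2_norm_minus_commute[of F])
  qed (intro L2_diff HP_L2[OF f] chaos_L2[OF F])+
  have le: "L2_norm (Gm M (f j) Z') \<le> L2_norm (Gm (?N i) (f i) Z') + K * L2_norm (\<lambda>w. f j w - f i w)" for i
  proof -
    have D: "(\<lambda>w. f j w - f i w) \<in> HP (?N i) {p}" by (rule HP_diff[OF fj fi])
    have "Gm M (f j) Z' = Gm (?N i) (f j) Z'"
      by (rule Gm_mono_N[OF _ HP_mono_N[OF M f] Z', symmetric]) simp
    also have "\<dots> = (\<lambda>w. Gm (?N i) (f i) Z' w + Gm (?N i) (\<lambda>w. f j w - f i w) Z' w)"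
      using Gm_lincomb[OF fi D, where a = 1 and b = 1 and X = Z'] by (auto simp: fun_eq_iff)
    finally have "L2_norm (Gm M (f j) Z') \<le> L2_norm (Gm (?N i) (f i) Z') + L2_norm (Gm (?N i) (\<lambda>w. f j w - f i w) Z')"
      using L2_norm_triangle[OF HP_L2[OF HP_Gm[OF fi Zi]] HP_L2[OF HP_Gm[OF D Zi]]] by simp
    also have "L2_norm (Gm (?N i) (\<lambda>w. f j w - f i w) Z') \<le> K * L2_norm (\<lambda>w. f j w - f i w)"
      using Gm_bounded[OF D Zi] by (simp add: n1 K_def)
    finally show ?thesis by simp
  qed
  have "L2_norm (Gm M (f j) Z') \<le> L2_norm (carre_du_champ F Z') + K * L2_norm (\<lambda>w. f j w - F w)"
    by (rule LIMSEQ_le_const[OF tendsto_add[OF l1 tendsto_mult[OF tendsto_const l2]]]) (intro exI allI impI le)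
  also have "\<dots> \<le> R + K * L2_norm (\<lambda>w. f j w - F w)"
    by (intro add_right_mono bound HP_chaos[OF Z'] E1)
  finally have *: "L2_norm (Gm M (f j) Z') \<le> R + K * L2_norm (\<lambda>w. f j w - F w)" .
  \<comment> \<open>Written as a trivial linear combination so that \<open>Gm_lincomb\<close> yields
    homogeneity.\<close>
  have "Z = (\<lambda>w. n * Z' w + 0 * Z' w)" using n by (simp add: Z'_def fun_eq_iff)
  then have "Gm M Z (f j) = Gm M (\<lambda>w. n * Z' w + 0 * Z' w) (f j)" by (rule arg_cong)
  then have "Gm M (f j) Z = (\<lambda>w. n * Gm M (f j) Z' w)"
    unfolding Gm_commute[of M "f j"] by (simp only: Gm_lincomb[OF Z' Z'] fun_eq_iff) simp
  then have "L2_norm (Gm M (f j) Z) = n * L2_norm (Gm M (f j) Z')"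
    using n by (simp add: L2_norm_cmult)
  also have "\<dots> \<le> n * (R + K * L2_norm (\<lambda>w. f j w - F w))"
    using n by (intro mult_left_mono *) simp
  finally show ?thesis by (simp add: n_def K_def mult.commute)
qed

text \<open>For each approximant, all orders from 1 to \<open>p div 2\<close> are bounded through
  order \<open>q\<close> by means of a fresh coordinate; the bound \<open>e j\<close> exceeds
  \<open>R\<close> by an error that tends to 0.\<close>

lemma chaos_variance_le_influence:
  assumes F: "F \<in> chaos p" and "R \<ge> 0" and q: "p div 2 \<le> q"
    and bound: "\<And>X. X \<in> chaos q \<Longrightarrow> \<E> (\<lambda>w. (X w)\<^sup>2) = 1 \<Longrightarrow> L2_norm (carre_du_champ F X) \<le> R"
  shows "wiener.variance (carre_du_champ F F) \<le> 2 * real p ^ 3 * (real ((2 * p * p) ^ p) * R)\<^sup>2 * \<E> (\<lambda>w. (F w)\<^sup>2)"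
proof -
  from chaos_approx[OF F] obtain N f where f: "\<And>j. f j \<in> HP (N j) {p}" and m: "mconv f F" by blast
  define e where "e j = R + real (p + q) * 3 ^ (p + q) * L2_norm (\<lambda>w. f j w - F w)" for j
  have e: "e j \<ge> 0" for j using \<open>R \<ge> 0\<close> by (simp add: e_def L2_norm_nonneg)
  have "e \<longlonglongrightarrow> R + real (p + q) * 3 ^ (p + q) * 0"
    unfolding e_def by (intro tendsto_intros mconv_L2[OF m])
  then have "e \<longlonglongrightarrow> R" by simp
  then have r: "(\<lambda>j. 2 * real p ^ 3 * (real ((2 * p * p) ^ p) * e j)\<^sup>2 * \<E> (\<lambda>w. (f j w)\<^sup>2)) \<longlonglongrightarrow>
     2 * real p ^ 3 * (real ((2 * p * p) ^ p) * R)\<^sup>2 * \<E> (\<lambda>w. (F w)\<^sup>2)"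
    by (intro tendsto_mult tendsto_const tendsto_power moment_limit[OF m])
  show ?thesis
  proof (rule LIMSEQ_le[OF variance_carre_limit[OF F f m] r], intro exI allI impI variance_Gm_le_influence f e)
    fix j c Z assume "1 \<le> c" "c \<le> p div 2" and Z: "Z \<in> HP (N j) {c}"
    then have "c \<le> q" using q by simp
    show "L2_norm (Gm (N j) (f j) Z) \<le> e j * L2_norm Z"
    proof (rule Gm_bound_lower_degree[OF f Z \<open>c \<le> q\<close>])
      fix W assume "W \<in> HP (Suc (N j)) {q}"
      then show "L2_norm (Gm (Suc (N j)) (f j) W) \<le> e j * L2_norm W"
        unfolding e_def by (intro Gm_bound_from_influence[OF F f m bound]) auto
    qed
  qed
qed

text \<open>Ensures that the supremum in \<open>influence\<close> is not over the empty set, where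
  \<open>ereal\<close> would give minus infinity. The witness is the constant 1 in zero coordinates
  times H_q of coordinate 0, which is fresh for it, divided by sqrt(q!).\<close>

lemma unit_chaos: "\<exists>X\<in>chaos q. \<E> (\<lambda>w. (X w)\<^sup>2) = 1"
proof -
  define X :: "(nat \<Rightarrow> real) \<Rightarrow> real" where "X w = (1 / sqrt (fact q)) * (1 * poly (hermite q) (w 0))" for w
  have "X \<in> HP (Suc 0) {0 + q}"
    unfolding X_def[abs_def] by (intro HP_cmult HP_mult_fresh HP_const) simp
  moreover have "L2_norm X = 1"
    unfolding X_def[abs_def] L2_norm_cmult using L2_norm_mult_fresh[OF HP_const[of UNIV 1 0], of q]
    by (simp add: L2_norm_def wiener.prob_space)
  ultimately show ?thesis using HP_chaos[of X "Suc 0" q] L2_norm_square[of X] by auto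
qed

text \<open>One statement for (v) and (vi): the bound of the influence by the variance needs
  \<open>q < p\<close>, the converse needs \<open>p div 2 \<le> q\<close>.\<close>

lemma influence_tendsto_iff:
  assumes F: "\<And>n. F n \<in> chaos p" and q: "q < p" "p div 2 \<le> q"
    and F2: "(\<lambda>n. \<E> (\<lambda>w. (F n w)\<^sup>2)) \<longlonglongrightarrow> 1"
  shows "(\<lambda>n. influence q (F n)) \<longlonglongrightarrow> 0 \<longleftrightarrow> (\<lambda>n. wiener.variance (carre_du_champ (F n) (F n))) \<longlonglongrightarrow> 0"
    (is "?I \<longleftrightarrow> ?V \<longlonglongrightarrow> 0")
proof
  assume V: "?V \<longlonglongrightarrow> 0"
  define b where "b n = sqrt (real (p + q) * real p * 3 ^ q * 1 * sqrt (?V n))" for n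
  have "b \<longlonglongrightarrow> sqrt (real (p + q) * real p * 3 ^ q * 1 * sqrt 0)"
    unfolding b_def by (intro tendsto_intros V)
  then have "(\<lambda>n. ereal (b n)) \<longlonglongrightarrow> ereal 0" by simp
  then have lim: "(\<lambda>n. ereal (b n)) \<longlonglongrightarrow> 0" by (simp add: zero_ereal_def)
  show ?I
  proof (rule tendsto_sandwich[OF _ _ tendsto_const lim])
    obtain X0 where X0: "X0 \<in> chaos q" "\<E> (\<lambda>w. (X0 w)\<^sup>2) = 1" using unit_chaos by blast
    have "0 \<le> influence q (F n)" for n
      unfolding influence_def by (rule SUP_upper2[of X0]) (use X0 in \<open>auto simp: L2_norm_nonneg\<close>)
    then show "\<forall>\<^sub>F n in sequentially. 0 \<le> influence q (F n)" by simp
    have "influence q (F n) \<le> ereal (b n)" for n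
      unfolding influence_def
    proof (rule SUP_least)
      fix X assume "X \<in> {X \<in> chaos q. \<E> (\<lambda>w. (X w)\<^sup>2) = 1}"
      then have X: "X \<in> chaos q" "\<E> (\<lambda>w. (X w)\<^sup>2) = 1" by auto
      from real_sqrt_le_mono[OF chaos_carre_le_variance[OF F X(1) q(1), of n, unfolded X(2)]]
      show "ereal (L2_norm (carre_du_champ (F n) X)) \<le> ereal (b n)"
        by (simp add: b_def L2_norm_nonneg)
    qed
    then show "\<forall>\<^sub>F n in sequentially. influence q (F n) \<le> ereal (b n)" by simp
  qed
next
  assume I: ?I
  define R where "R n = real_of_ereal (influence q (F n))" for n
  have R: "R \<longlonglongrightarrow> 0"
    unfolding R_def[abs_def] by (rule lim_real_of_ereal) (use I in \<open>simp add: zero_ereal_def\<close>)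
  \<comment> \<open>\<open>real_of_ereal\<close> sends infinity to 0, so finiteness has to be
    secured before \<open>R n\<close> can serve as a bound.\<close>
  have "\<forall>\<^sub>F n in sequentially. influence q (F n) < 1"
    by (rule order_tendstoD(2)[OF I]) simp
  then have ev: "\<forall>\<^sub>F n in sequentially. ?V n \<le> 2 * real p ^ 3 * (real ((2 * p * p) ^ p) * R n)\<^sup>2 * \<E> (\<lambda>w. (F n w)\<^sup>2)"
  proof eventually_elim
    case (elim n)
    obtain X0 where X0: "X0 \<in> chaos q" "\<E> (\<lambda>w. (X0 w)\<^sup>2) = 1" using unit_chaos by blast
    have nn: "0 \<le> influence q (F n)"
      unfolding influence_def by (rule SUP_upper2[of X0]) (use X0 in \<open>auto simp: L2_norm_nonneg\<close>)
    then have RI: "ereal (R n) = influence q (F n)"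
      unfolding R_def using elim by (cases "influence q (F n)") auto
    have "R n \<ge> 0" using nn unfolding RI[symmetric] by simp
    then show ?case
    proof (rule chaos_variance_le_influence[OF F _ q(2)])
      fix X assume "X \<in> chaos q" "\<E> (\<lambda>w. (X w)\<^sup>2) = 1"
      then have "ereal (L2_norm (carre_du_champ (F n) X)) \<le> influence q (F n)"
        unfolding influence_def by (intro SUP_upper) auto
      then show "L2_norm (carre_du_champ (F n) X) \<le> R n" unfolding RI[symmetric] by simp
    qed
  qed
  have "(\<lambda>n. 2 * real p ^ 3 * (real ((2 * p * p) ^ p) * R n)\<^sup>2 * \<E> (\<lambda>w. (F n w)\<^sup>2)) \<longlonglongrightarrow> 2 * real p ^ 3 * (real ((2 * p * p) ^ p) * 0)\<^sup>2 * 1"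
    by (intro tendsto_intros R F2)
  then have lim: "(\<lambda>n. 2 * real p ^ 3 * (real ((2 * p * p) ^ p) * R n)\<^sup>2 * \<E> (\<lambda>w. (F n w)\<^sup>2)) \<longlonglongrightarrow> 0" by simp
  show "?V \<longlonglongrightarrow> 0"
    by (rule tendsto_sandwich[OF _ ev tendsto_const lim]) (simp add: wiener.variance_positive)
qed

section \<open>Moments, weak convergence and the equivalences\<close>

text \<open>Where the clamp acts, |x| > K >= 1 and hence |x|^k >= K, so the error, at most |x|^k, is
  at most |x|^(2k) / K.\<close>

lemma clamp_power_diff:
  fixes x K :: real
  assumes "K \<ge> 1" "k \<ge> 1"
  shows "\<bar>x ^ k - (max (- K) (min K x)) ^ k\<bar> \<le> x ^ (2 * k) / K"
proof (cases "\<bar>x\<bar> \<le> K")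
  case True
  then have "max (- K) (min K x) = x" by auto
  then show ?thesis using assms by (simp add: zero_le_even_power)
next
  case False
  have "\<bar>x ^ k - (max (- K) (min K x)) ^ k\<bar> = \<bar>x\<bar> ^ k - K ^ k"
  proof (cases "x > 0")
    case True
    then have "max (- K) (min K x) = K" "K ^ k \<le> x ^ k" "\<bar>x\<bar> = x"
      using False assms by (auto intro: power_mono)
    then show ?thesis by simp
  next
    case neg: False
    then have "max (- K) (min K x) = - K" and "\<bar>x\<bar> = - x" using False assms by auto
    moreover have "x ^ k = (- 1) ^ k * (- x) ^ k" by (metis power_minus minus_minus)
    ultimately have "x ^ k - (max (- K) (min K x)) ^ k = (- 1) ^ k * (\<bar>x\<bar> ^ k - K ^ k)"
      by (simp only: power_minus[of K] right_diff_distrib)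
    moreover have "K ^ k \<le> \<bar>x\<bar> ^ k" using False assms by (intro power_mono) auto
    ultimately show ?thesis by (simp add: abs_mult power_abs)
  qed
  also have "\<dots> \<le> \<bar>x\<bar> ^ k * 1" using assms by simp
  also have "\<dots> \<le> \<bar>x\<bar> ^ k * (\<bar>x\<bar> ^ k / K)"
  proof (intro mult_left_mono)
    have "K \<le> \<bar>x\<bar> ^ 1" using False by simp
    also have "\<dots> \<le> \<bar>x\<bar> ^ k" using False assms by (intro power_increasing) auto
    finally show "1 \<le> \<bar>x\<bar> ^ k / K" using assms by simp
  qed simp
  also have "\<dots> = \<bar>x\<bar> ^ (2 * k) / K" by (simp add: mult_2 power_add)
  also have "\<bar>x\<bar> ^ (2 * k) = x ^ (2 * k)" by (rule power_even_abs) simp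
  finally show ?thesis .
qed

lemma clamp_moment:
  assumes "real_distribution M" "integrable M (\<lambda>x. x ^ k)" "integrable M (\<lambda>x. x ^ (2 * k))" "K \<ge> 1" "k \<ge> 1"
  shows "\<bar>(LINT x|M. x ^ k) - (LINT x|M. (max (- K) (min K x)) ^ k)\<bar> \<le> (LINT x|M. x ^ (2 * k)) / K"
proof -
  interpret real_distribution M by fact
  have i: "integrable M (\<lambda>x. (max (- K) (min K x)) ^ k)"
  proof (rule integrable_const_bound[where B = "K ^ k"])
    show "AE x in M. norm ((max (- K) (min K x)) ^ k) \<le> K ^ k"
      using assms(4) by (intro AE_I2) (auto simp: power_abs intro!: power_mono)
  qed simp
  have "(LINT x|M. x ^ k) - (LINT x|M. (max (- K) (min K x)) ^ k) = (LINT x|M. x ^ k - (max (- K) (min K x)) ^ k)"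
    by (rule Bochner_Integration.integral_diff[OF assms(2) i, symmetric])
  also have "\<bar>\<dots>\<bar> \<le> (LINT x|M. \<bar>x ^ k - (max (- K) (min K x)) ^ k\<bar>)"
    by (rule integral_abs_bound)
  also have "\<dots> \<le> (LINT x|M. x ^ (2 * k) / K)"
    using assms i by (intro integral_mono clamp_power_diff integrable_abs Bochner_Integration.integrable_diff integrable_divide) auto
  finally show ?thesis by simp
qed

text \<open>Weak convergence tests bounded continuous functions, such as the clamped power; the
  bound on the moments of order 2k makes the clamping error small uniformly in
  \<open>n\<close>.\<close>

lemma weak_conv_moment:
  assumes \<mu>: "\<And>n. real_distribution (\<mu> n)" and M: "real_distribution M" and conv: "weak_conv_m \<mu> M" and k: "k \<ge> 1"
    and i: "\<And>n j. integrable (\<mu> n) (\<lambda>x. x ^ j)" "\<And>j. integrable M (\<lambda>x. x ^ j)"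
    and B: "\<And>n. (LINT x|\<mu> n. x ^ (2 * k)) \<le> B"
  shows "(\<lambda>n. LINT x|\<mu> n. x ^ k) \<longlonglongrightarrow> (LINT x|M. x ^ k)"
proof (rule LIMSEQ_I)
  fix r :: real assume r: "r > 0"
  define B' where "B' = max B (LINT x|M. x ^ (2 * k))"
  \<comment> \<open>Large enough for both clamping errors, each at most \<open>B' / K\<close>, to
    stay below r/4.\<close>
  define K where "K = max 1 (4 * \<bar>B'\<bar> / r)"
  have K: "K \<ge> 1" by (simp add: K_def)
  have BK: "B' / K \<le> r / 4"
  proof -
    have "4 * \<bar>B'\<bar> / r \<le> K" by (simp add: K_def)
    then have "4 * \<bar>B'\<bar> \<le> K * r" using r by (simp add: field_simps)
    then have "4 * B' \<le> K * r" by (rule order_trans[rotated]) simp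
    then show ?thesis using K by (simp add: field_simps)
  qed
  let ?\<phi> = "\<lambda>x. (max (- K) (min K x)) ^ k"
  have "(\<lambda>n. integral\<^sup>L (\<mu> n) ?\<phi>) \<longlonglongrightarrow> integral\<^sup>L M ?\<phi>"
  proof (rule weak_conv_imp_integral_bdd_continuous_conv[OF \<mu> M conv])
    show "isCont ?\<phi> x" for x by (intro continuous_intros)
    show "norm (?\<phi> x) \<le> K ^ k" for x
      using K by (auto simp: power_abs intro!: power_mono)
  qed
  from LIMSEQ_D[OF this, of "r / 4"] r obtain no where
    no: "\<And>n. n \<ge> no \<Longrightarrow> norm (integral\<^sup>L (\<mu> n) ?\<phi> - integral\<^sup>L M ?\<phi>) < r / 4" by auto
  have "norm ((LINT x|\<mu> n. x ^ k) - (LINT x|M. x ^ k)) < r" if "n \<ge> no" for n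
  proof -
    have "\<bar>(LINT x|\<mu> n. x ^ k) - integral\<^sup>L (\<mu> n) ?\<phi>\<bar> \<le> B' / K"
      by (rule order_trans[OF clamp_moment[OF \<mu> i(1) i(1) K k] divide_right_mono]) (use B[of n] K in \<open>auto simp: B'_def\<close>)
    moreover have "\<bar>(LINT x|M. x ^ k) - integral\<^sup>L M ?\<phi>\<bar> \<le> B' / K"
      by (rule order_trans[OF clamp_moment[OF M i(2) i(2) K k] divide_right_mono]) (use K in \<open>auto simp: B'_def\<close>)
    ultimately show ?thesis using no[OF that] BK r unfolding real_norm_def by linarith
  qed
  then show "\<exists>no. \<forall>n\<ge>no. norm ((LINT x|\<mu> n. x ^ k) - (LINT x|M. x ^ k)) < r" by blast
qed

text \<open>Method of moments through characteristic functions. The Taylor remainder of order 2j is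
  \<open>b j\<close> times the moment of order 2j; for the Gaussian this product is 2 (t^2/2)^j /
  j!, which tends to 0. So \<open>j\<close> is chosen from the Gaussian alone and \<open>n\<close>
  afterwards.\<close>

lemma weak_conv_std_normal_by_moments:
  assumes \<mu>: "\<And>n. real_distribution (\<mu> n)" and i: "\<And>n j. integrable (\<mu> n) (\<lambda>x. x ^ j)"
    and lim: "\<And>k. (\<lambda>n. LINT x|\<mu> n. x ^ k) \<longlonglongrightarrow> (LINT x|std_normal_distribution. x ^ k)"
  shows "weak_conv_m \<mu> std_normal_distribution"
proof (rule levy_continuity[OF \<mu> real_dist_normal_dist])
  fix t :: real
  let ?g = "std_normal_distribution"
  define c where "c k = (\<i> * complex_of_real t) ^ k / fact k" for k
  \<comment> \<open>The remainder coefficient at an even order, where the absolute moment is an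
    ordinary moment.\<close>
  define b where "b j = 2 * \<bar>t\<bar> ^ (2 * j) / fact (2 * j)" for j
  have approx: "cmod (char M t - (\<Sum>k\<le>2 * j. c k * complex_of_real (LINT x|M. x ^ k))) \<le> b j * (LINT x|M. x ^ (2 * j))"
    if "real_distribution M" "\<And>k. integrable M (\<lambda>x. x ^ k)" for M j
    using real_distribution.char_approx1[OF that(1,2), where n = "2 * j" and t = t]
    by (simp add: c_def b_def power_even_abs)
  have b: "(\<lambda>j. b j * (LINT x|?g. x ^ (2 * j))) \<longlonglongrightarrow> 0"
  proof -
    have "b j * (LINT x|?g. x ^ (2 * j)) = 2 * ((t\<^sup>2 / 2) ^ j / fact j)" for j
    proof -
      have "\<bar>t\<bar> ^ (2 * j) = (t\<^sup>2) ^ j" by (simp add: power_mult)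
      then show ?thesis
        unfolding b_def std_normal_distribution_even_moments by (simp add: power_divide)
    qed
    moreover have "(\<lambda>j. (t\<^sup>2 / 2) ^ j / fact j) \<longlonglongrightarrow> 0"
      using summable_LIMSEQ_zero[OF summable_exp[of "t\<^sup>2 / 2"]] by (simp add: field_simps)
    then have "(\<lambda>j. 2 * ((t\<^sup>2 / 2) ^ j / fact j)) \<longlonglongrightarrow> 0"
      by (rule tendsto_mult_right_zero)
    ultimately show ?thesis by simp
  qed
  show "(\<lambda>n. char (\<mu> n) t) \<longlonglongrightarrow> char ?g t"
  proof (rule LIMSEQ_I)
    fix r :: real assume r: "r > 0"
    from order_tendstoD(2)[OF b, of "r / 4"] r obtain j where j: "b j * (LINT x|?g. x ^ (2 * j)) < r / 4"
      by (auto simp: eventually_sequentially)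
    let ?S = "\<lambda>M. \<Sum>k\<le>2 * j. c k * complex_of_real (LINT x|M. x ^ k)"
    have "(\<lambda>n. b j * (LINT x|\<mu> n. x ^ (2 * j))) \<longlonglongrightarrow> b j * (LINT x|?g. x ^ (2 * j))"
      by (intro tendsto_mult tendsto_const lim)
    from order_tendstoD(2)[OF this j] have e1: "\<forall>\<^sub>F n in sequentially. b j * (LINT x|\<mu> n. x ^ (2 * j)) < r / 4" .
    have "(\<lambda>n. ?S (\<mu> n)) \<longlonglongrightarrow> ?S ?g"
      by (intro tendsto_sum tendsto_mult tendsto_const tendsto_of_real lim)
    from tendstoD[OF this, of "r / 4"] r have e2: "\<forall>\<^sub>F n in sequentially. dist (?S (\<mu> n)) (?S ?g) < r / 4" by simp
    from e1 e2 have "\<forall>\<^sub>F n in sequentially. norm (char (\<mu> n) t - char ?g t) < r"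
    proof eventually_elim
      case (elim n)
      have "norm (char (\<mu> n) t - char ?g t) \<le> norm (char (\<mu> n) t - ?S (\<mu> n)) + norm (?S (\<mu> n) - ?S ?g) + norm (?S ?g - char ?g t)"
        by (rule norm_diff_triangle_le[OF norm_diff_triangle_le[OF order_refl order_refl] order_refl])
      also have "norm (char (\<mu> n) t - ?S (\<mu> n)) < r / 4"
        using approx[OF \<mu> i, of n j] elim(1) by linarith
      also have "norm (?S (\<mu> n) - ?S ?g) < r / 4" using elim(2) by (simp add: dist_norm)
      also have "norm (?S ?g - char ?g t) < r / 4"
        using approx[OF real_dist_normal_dist integrable_std_normal_distribution_moment, of j] j
        by (simp add: norm_minus_commute)
      finally show ?case using r by simp
    qed
    then show "\<exists>no. \<forall>n\<ge>no. norm (char (\<mu> n) t - char ?g t) < r"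
      by (simp add: eventually_sequentially)
  qed
qed

lemma gaussian_law_std: "gaussian_law 0 1 = std_normal_distribution"
  by (simp add: gaussian_law_def distr_id2)

lemma real_distribution_gaussian_law: "real_distribution (gaussian_law m s)"
proof -
  interpret prob_space std_normal_distribution by (rule prob_space_normal_density) simp
  show ?thesis unfolding gaussian_law_def by (rule real_distribution_distr) simp
qed

lemma gaussian_law_integral:
  "(LINT x|gaussian_law m s. x ^ k) = (LINT x|std_normal_distribution. (m + s * x) ^ k)"
  "integrable (gaussian_law m s) (\<lambda>x. x ^ k)"
proof -
  have "integrable std_normal_distribution (\<lambda>x. (m + s * x) ^ k)"
    using integrable_std_normal_poly[of "[:m, s:] ^ k"] by (simp add: poly_power mult.commute)
  then show "integrable (gaussian_law m s) (\<lambda>x. x ^ k)"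
    unfolding gaussian_law_def by (subst integrable_distr_eq) auto
  show "(LINT x|gaussian_law m s. x ^ k) = (LINT x|std_normal_distribution. (m + s * x) ^ k)"
    unfolding gaussian_law_def by (subst integral_distr) auto
qed

lemma std_normal_moments:
  "(LINT x|std_normal_distribution. x) = 0" "(LINT x|std_normal_distribution. 1) = (1::real)"
  "(LINT x|std_normal_distribution. x\<^sup>2) = 1" "(LINT x|std_normal_distribution. x ^ 4) = 3"
proof -
  interpret prob_space std_normal_distribution by (rule prob_space_normal_density) simp
  show 0: "(LINT x|std_normal_distribution. 1) = (1::real)" using prob_space by simp
  show "(LINT x|std_normal_distribution. x) = 0"
    using integral_std_normal_distribution_moment_odd[of 1] by simp
  show 2: "(LINT x|std_normal_distribution. x\<^sup>2) = 1"
    using std_normal_moment_Suc[of 0] 0 by (simp add: numeral_2_eq_2)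
  show "(LINT x|std_normal_distribution. x ^ 4) = 3"
    using std_normal_moment_Suc[of 2] 2 by (simp add: eval_nat_numeral)
qed

lemma gaussian_law_moments:
  "(LINT x|gaussian_law m s. x ^ 1) = m" "(LINT x|gaussian_law m s. x\<^sup>2) = m\<^sup>2 + s\<^sup>2"
  "(LINT x|gaussian_law 0 s. x ^ 4) = 3 * s ^ 4"
proof -
  have i: "integrable std_normal_distribution (\<lambda>x. x ^ k)" for k
    by (rule integrable_std_normal_distribution_moment)
  have i1: "integrable std_normal_distribution (\<lambda>x. x)" using i[of 1] by simp
  interpret prob_space std_normal_distribution by (rule prob_space_normal_density) simp
  show "(LINT x|gaussian_law m s. x ^ 1) = m"
    unfolding gaussian_law_integral using i1 prob_space by (simp add: std_normal_moments)
  have "(LINT x|std_normal_distribution. (m + s * x)\<^sup>2) = (LINT x|std_normal_distribution. m\<^sup>2 + 2 * m * s * x + s\<^sup>2 * x\<^sup>2)"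
    by (simp add: power2_eq_square algebra_simps)
  then show "(LINT x|gaussian_law m s. x\<^sup>2) = m\<^sup>2 + s\<^sup>2"
    unfolding gaussian_law_integral using i i1 prob_space by (simp add: std_normal_moments)
  show "(LINT x|gaussian_law 0 s. x ^ 4) = 3 * s ^ 4"
    unfolding gaussian_law_integral by (simp add: power_mult_distrib std_normal_moments)
qed

section \<open>The fourth moment criterion and the remaining equivalences\<close>

lemma chaos_moments_bounded:
  assumes F: "\<And>n. F n \<in> chaos p" and F2: "(\<lambda>n. \<E> (\<lambda>w. (F n w)\<^sup>2)) \<longlonglongrightarrow> 1"
  shows "\<exists>B. \<forall>n. \<E> (\<lambda>w. F n w ^ (2 * k)) \<le> B"
proof -
  from convergent_imp_Bseq[OF convergentI[OF F2]] obtain A where A: "A > 0" "\<And>n. \<bar>\<E> (\<lambda>w. (F n w)\<^sup>2)\<bar> \<le> A"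
    by (auto simp: Bseq_def)
  obtain C where C: "C \<ge> 0" "\<And>G. G \<in> chaos p \<Longrightarrow> \<E> (\<lambda>w. G w ^ (2 ^ Suc k)) \<le> C * (\<E> (\<lambda>w. (G w)\<^sup>2)) ^ (2 ^ k)"
    using chaos_moment_bound[of p k] by blast
  have "\<E> (\<lambda>w. F n w ^ (2 * k)) \<le> 1 + C * A ^ (2 ^ k)" for n
  proof -
    have "\<E> (\<lambda>w. F n w ^ (2 * k)) \<le> \<E> (\<lambda>w. 1 + F n w ^ (2 ^ Suc k))"
    proof (intro integral_mono chaos_integrable_power[OF F] Bochner_Integration.integrable_add)
      show "F n w ^ (2 * k) \<le> 1 + F n w ^ (2 ^ Suc k)" for w
        using power_square_le_dyadic[of "F n w" k] by (simp only: power_mult[symmetric] mult.commute)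
    qed simp
    also have "\<dots> = 1 + \<E> (\<lambda>w. F n w ^ (2 ^ Suc k))"
      by (simp add: chaos_integrable_power[OF F] wiener.prob_space del: power_Suc)
    also have "\<dots> \<le> 1 + C * A ^ (2 ^ k)"
    proof (intro add_left_mono order_trans[OF C(2)[OF F]] mult_left_mono power_mono C(1))
      show "\<E> (\<lambda>w. (F n w)\<^sup>2) \<le> A" using A(2)[of n] by simp
    qed simp
    finally show ?thesis .
  qed
  then show ?thesis by blast
qed

text \<open>In the forward direction the limit law has unknown parameters. Uniform moment bounds let
  moments pass to the limit, and mean 0 with E F_n^2 -> 1 forces m = 0 and s^2 = 1; its fourth
  moment is then 3, so the fourth moment excess vanishes.\<close>

lemma asymp_gaussian_iff_variance:
  assumes p: "p \<ge> 1" and F: "\<And>n. F n \<in> chaos p"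
    and F2: "(\<lambda>n. \<E> (\<lambda>w. (F n w)\<^sup>2)) \<longlonglongrightarrow> 1"
  shows "asymp_gaussian F \<longleftrightarrow> (\<lambda>n. wiener.variance (carre_du_champ (F n) (F n))) \<longlonglongrightarrow> 0"
    (is "_ \<longleftrightarrow> ?V \<longlonglongrightarrow> 0")
proof -
  let ?\<mu> = "\<lambda>n. distr wiener_space borel (F n)"
  have [measurable]: "F n \<in> borel_measurable wiener_space" for n
    using chaos_L2[OF F] by (rule L2_space_measurable)
  have \<mu>: "real_distribution (?\<mu> n)" for n by (rule wiener.real_distribution_distr) simp
  have \<mu>i: "integrable (?\<mu> n) (\<lambda>x. x ^ j)" for n j
    by (subst integrable_distr_eq) (auto intro: chaos_integrable_power[OF F])
  have \<mu>m: "(LINT x|?\<mu> n. x ^ j) = \<E> (\<lambda>w. F n w ^ j)" for n j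
    by (subst integral_distr) auto
  show ?thesis
  proof
    assume "asymp_gaussian F"
    then obtain m s where w: "weak_conv_m ?\<mu> (gaussian_law m s)" by (auto simp: asymp_gaussian_def)
    have mom: "(\<lambda>n. \<E> (\<lambda>w. F n w ^ k)) \<longlonglongrightarrow> (LINT x|gaussian_law m s. x ^ k)" if "k \<ge> 1" for k
    proof -
      obtain B where B: "\<And>n. \<E> (\<lambda>w. F n w ^ (2 * k)) \<le> B" using chaos_moments_bounded[OF F F2] by blast
      show ?thesis
        using weak_conv_moment[OF \<mu> real_distribution_gaussian_law w that \<mu>i gaussian_law_integral(2), of B]
        unfolding \<mu>m by (simp add: B)
    qed
    have "(\<lambda>n. \<E> (\<lambda>w. F n w ^ 1)) \<longlonglongrightarrow> m" using mom[of 1] unfolding gaussian_law_moments by simp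
    then have "(\<lambda>n. 0) \<longlonglongrightarrow> m" by (simp add: chaos_expectation_0[OF F p])
    then have m: "m = 0" by (simp add: LIMSEQ_const_iff)
    have "(\<lambda>n. \<E> (\<lambda>w. (F n w)\<^sup>2)) \<longlonglongrightarrow> s\<^sup>2" using mom[of 2] unfolding gaussian_law_moments by (simp add: m)
    from LIMSEQ_unique[OF this F2] have s: "s\<^sup>2 = 1" .
    have "s ^ 4 = (s\<^sup>2)\<^sup>2" by simp
    then have "s ^ 4 = 1" unfolding s by simp
    then have F4: "(\<lambda>n. \<E> (\<lambda>w. F n w ^ 4)) \<longlonglongrightarrow> 3" using mom[of 4] unfolding m gaussian_law_moments by simp
    have "(\<lambda>n. (real p)\<^sup>2 / 3 * (\<E> (\<lambda>w. F n w ^ 4) - 3 * (\<E> (\<lambda>w. (F n w)\<^sup>2))\<^sup>2)) \<longlonglongrightarrow> (real p)\<^sup>2 / 3 * (3 - 3 * 1\<^sup>2)"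
      by (intro tendsto_mult tendsto_diff tendsto_power tendsto_const F4 F2)
    then have lim: "(\<lambda>n. (real p)\<^sup>2 / 3 * (\<E> (\<lambda>w. F n w ^ 4) - 3 * (\<E> (\<lambda>w. (F n w)\<^sup>2))\<^sup>2)) \<longlonglongrightarrow> 0" by simp
    show "?V \<longlonglongrightarrow> 0"
      by (rule tendsto_sandwich[OF _ _ tendsto_const lim])
         (intro always_eventually allI wiener.variance_positive chaos_variance_le_fourth_moment[OF F])+
  next
    assume V: "?V \<longlonglongrightarrow> 0"
    \<comment> \<open>The recursion links k + 2 to k, hence induction in steps of two from the
      moments 0 and 1.\<close>
    have mom: "(\<lambda>n. \<E> (\<lambda>w. F n w ^ k)) \<longlonglongrightarrow> (LINT x|std_normal_distribution. x ^ k)" for k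
    proof (induction k rule: induct_nat_012)
      case 0
      then show ?case using std_normal_moments(2) by (simp add: wiener.prob_space)
    next
      case 1
      then show ?case by (simp add: chaos_expectation_0[OF F p] std_normal_moments(1))
    next
      case (ge2 k)
      let ?c = "real (k + 1) * real p" and ?g = "LINT x|std_normal_distribution. x ^ k"
      obtain B where B: "\<And>n. \<E> (\<lambda>w. F n w ^ (2 * k)) \<le> B" using chaos_moments_bounded[OF F F2] by blast
      have "(\<lambda>n. real (k + 1) * sqrt B * sqrt (?V n)) \<longlonglongrightarrow> real (k + 1) * sqrt B * sqrt 0"
        by (intro tendsto_intros V)
      then have lim: "(\<lambda>n. real (k + 1) * sqrt B * sqrt (?V n)) \<longlonglongrightarrow> 0" by simp
      have "(\<lambda>n. real p * \<E> (\<lambda>w. F n w ^ (k + 2)) - real (k + 1) * (real p * \<E> (\<lambda>w. (F n w)\<^sup>2)) * \<E> (\<lambda>w. F n w ^ k)) \<longlonglongrightarrow> 0"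
      proof (rule Lim_null_comparison[OF _ lim], intro always_eventually allI)
        fix n
        have "sqrt (\<E> (\<lambda>w. F n w ^ (2 * k))) * sqrt (?V n) \<le> sqrt B * sqrt (?V n)"
          by (intro mult_right_mono real_sqrt_le_mono B) (simp add: wiener.variance_positive)
        then have "real (k + 1) * sqrt (\<E> (\<lambda>w. F n w ^ (2 * k))) * sqrt (?V n) \<le> real (k + 1) * sqrt B * sqrt (?V n)"
          unfolding mult.assoc by (rule mult_left_mono) simp
        then show "norm (real p * \<E> (\<lambda>w. F n w ^ (k + 2)) - real (k + 1) * (real p * \<E> (\<lambda>w. (F n w)\<^sup>2)) * \<E> (\<lambda>w. F n w ^ k))
           \<le> real (k + 1) * sqrt B * sqrt (?V n)"
          unfolding real_norm_def by (rule order_trans[OF chaos_moment_recursion[OF F]])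
      qed
      moreover have "(\<lambda>n. real (k + 1) * (real p * \<E> (\<lambda>w. (F n w)\<^sup>2)) * \<E> (\<lambda>w. F n w ^ k)) \<longlonglongrightarrow> real (k + 1) * (real p * 1) * ?g"
        by (intro tendsto_mult tendsto_const F2 ge2.IH)
      ultimately have "(\<lambda>n. real p * \<E> (\<lambda>w. F n w ^ (k + 2))) \<longlonglongrightarrow> 0 + real (k + 1) * (real p * 1) * ?g"
        using tendsto_add by fastforce
      then have "(\<lambda>n. real p * \<E> (\<lambda>w. F n w ^ (k + 2))) \<longlonglongrightarrow> real p * (real (Suc k) * ?g)"
        by (simp add: mult_ac)
      then have "(\<lambda>n. 1 / real p * (real p * \<E> (\<lambda>w. F n w ^ (k + 2)))) \<longlonglongrightarrow> 1 / real p * (real p * (real (Suc k) * ?g))"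
        by (rule tendsto_mult[OF tendsto_const])
      moreover have "1 / real p * (real p * x) = x" for x using p by simp
      ultimately have "(\<lambda>n. \<E> (\<lambda>w. F n w ^ (k + 2))) \<longlonglongrightarrow> real (Suc k) * ?g"
        by (simp only:)
      then show ?case unfolding std_normal_moment_Suc by simp
    qed
    have "weak_conv_m ?\<mu> std_normal_distribution"
      by (rule weak_conv_std_normal_by_moments[OF \<mu> \<mu>i]) (simp only: \<mu>m mom)
    then show "asymp_gaussian F"
      unfolding asymp_gaussian_def by (intro exI[of _ 0] exI[of _ 1]) (simp add: gaussian_law_std)
  qed
qed

text \<open>The bound involves E F_n^2 - 1 beside the variance, and both tend to 0; the restriction
  to second moments below 2 holds eventually.\<close>

lemma variance_imp_hermite_OU:
  assumes F: "\<And>n. F n \<in> chaos p" and F2: "(\<lambda>n. \<E> (\<lambda>w. (F n w)\<^sup>2)) \<longlonglongrightarrow> 1"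
    and V: "(\<lambda>n. wiener.variance (carre_du_champ (F n) (F n))) \<longlonglongrightarrow> 0"
  shows "(\<lambda>n. L2_norm (\<lambda>w. OU_gen (\<lambda>w. poly (hermite k) (F n w)) w
                         + real (k * p) * poly (hermite k) (F n w))) \<longlonglongrightarrow> 0"
    (is "?D \<longlonglongrightarrow> 0")
proof -
  let ?V = "\<lambda>n. wiener.variance (carre_du_champ (F n) (F n))"
  obtain C where C: "\<And>G. G \<in> chaos p \<Longrightarrow> \<E> (\<lambda>w. (G w)\<^sup>2) < 2 \<Longrightarrow>
     (L2_norm (\<lambda>w. OU_gen (\<lambda>w. poly (hermite k) (G w)) w + real (k * p) * poly (hermite k) (G w)))\<^sup>2
     \<le> C * (wiener.variance (carre_du_champ G G) + (real p * (\<E> (\<lambda>w. (G w)\<^sup>2) - 1))\<^sup>2)"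
    using chaos_hermite_bound[of p k] by blast
  have "(\<lambda>n. C * (?V n + (real p * (\<E> (\<lambda>w. (F n w)\<^sup>2) - 1))\<^sup>2)) \<longlonglongrightarrow> C * (0 + (real p * (1 - 1))\<^sup>2)"
    by (intro tendsto_mult tendsto_add tendsto_power tendsto_diff tendsto_const V F2)
  then have lim: "(\<lambda>n. C * (?V n + (real p * (\<E> (\<lambda>w. (F n w)\<^sup>2) - 1))\<^sup>2)) \<longlonglongrightarrow> 0" by simp
  have "\<forall>\<^sub>F n in sequentially. \<E> (\<lambda>w. (F n w)\<^sup>2) < 2"
    by (rule order_tendstoD(2)[OF F2]) simp
  then have ev: "\<forall>\<^sub>F n in sequentially. (?D n)\<^sup>2 \<le> C * (?V n + (real p * (\<E> (\<lambda>w. (F n w)\<^sup>2) - 1))\<^sup>2)"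
    by eventually_elim (rule C[OF F])
  have "(\<lambda>n. (?D n)\<^sup>2) \<longlonglongrightarrow> 0"
    by (rule tendsto_sandwich[OF _ ev tendsto_const lim]) simp
  from tendsto_real_sqrt[OF this] show ?thesis by (simp add: L2_norm_nonneg)
qed

theorem theorem3p9:
  fixes F :: "nat \<Rightarrow> (nat \<Rightarrow> real) \<Rightarrow> real" and p :: nat
  assumes "p \<ge> 1"
    and "\<And>n. F n \<in> chaos p"
    and "(\<lambda>n. wiener.expectation (\<lambda>\<omega>. (F n \<omega>)\<^sup>2)) \<longlonglongrightarrow> 1"
  defines "i \<equiv> asymp_gaussian F"
    and "ii \<equiv> (\<lambda>n. wiener.variance (carre_du_champ (F n) (F n))) \<longlonglongrightarrow> 0"
    and "iii \<equiv> (\<forall>k\<ge>2. (\<lambda>n. L2_norm (\<lambda>\<omega>. OU_gen (\<lambda>\<omega>. poly (hermite k) (F n \<omega>)) \<omega>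
                         + real (k * p) * poly (hermite k) (F n \<omega>))) \<longlonglongrightarrow> 0)"
    and "iv \<equiv> (\<forall>k\<ge>2. \<forall>q. q \<noteq> k * p \<longrightarrow>
                 (\<lambda>n. L2_norm (chaos_proj q (\<lambda>\<omega>. poly (hermite k) (F n \<omega>)))) \<longlonglongrightarrow> 0)"
    and "v \<equiv> (\<lambda>n. influence (p - 1) (F n)) \<longlonglongrightarrow> 0"
    and "vi \<equiv> (\<lambda>n. influence (p div 2) (F n)) \<longlonglongrightarrow> 0"
  shows "(i \<longleftrightarrow> ii) \<and> (i \<longleftrightarrow> iii) \<and> (i \<longleftrightarrow> iv) \<and> (i \<longleftrightarrow> v) \<and> (i \<longleftrightarrow> vi)"
proof -
  note p = assms(1) and F = assms(2) and F2 = assms(3)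
  have 1: "i \<longleftrightarrow> ii"
    unfolding i_def ii_def by (rule asymp_gaussian_iff_variance[OF p F F2])
  have 2: "ii \<Longrightarrow> iii"
    unfolding ii_def iii_def using variance_imp_hermite_OU[OF F F2] by blast
  have 3: "iii \<Longrightarrow> iv"
    unfolding iii_def iv_def
  proof (intro allI impI)
    fix k q :: nat
    assume "\<forall>k\<ge>2. (\<lambda>n. L2_norm (\<lambda>w. OU_gen (\<lambda>w. poly (hermite k) (F n w)) w
                         + real (k * p) * poly (hermite k) (F n w))) \<longlonglongrightarrow> 0" "2 \<le> k" and q: "q \<noteq> k * p"
    then have lim: "(\<lambda>n. L2_norm (\<lambda>w. OU_gen (\<lambda>w. poly (hermite k) (F n w)) w
                         + real (k * p) * poly (hermite k) (F n w))) \<longlonglongrightarrow> 0" by blast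
    show "(\<lambda>n. L2_norm (chaos_proj q (\<lambda>w. poly (hermite k) (F n w)))) \<longlonglongrightarrow> 0"
      by (rule tendsto_sandwich[OF _ _ tendsto_const lim])
         (intro always_eventually allI L2_norm_nonneg chaos_proj_hermite_le[OF F q])+
  qed
  have 4: "iv \<Longrightarrow> ii"
    unfolding ii_def
  proof -
    assume iv
    \<comment> \<open>This is k = 2; the range of \<open>m\<close> stops short of 2p, so every order
      in it is covered by the assumption.\<close>
    then have "(\<lambda>n. L2_norm (chaos_proj m (\<lambda>w. poly (hermite 2) (F n w)))) \<longlonglongrightarrow> 0" if "m \<in> {1..<2*p}" for m
      using that unfolding iv_def by auto
    then have "(\<lambda>n. \<Sum>m\<in>{1..<2*p}. (real p)\<^sup>2 * (L2_norm (chaos_proj m (\<lambda>w. poly (hermite 2) (F n w))))\<^sup>2)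
        \<longlonglongrightarrow> (\<Sum>m\<in>{1..<2*p}. (real p)\<^sup>2 * 0\<^sup>2)"
      by (intro tendsto_sum tendsto_mult tendsto_const tendsto_power)
    then have lim: "(\<lambda>n. \<Sum>m\<in>{1..<2*p}. (real p)\<^sup>2 * (L2_norm (chaos_proj m (\<lambda>w. poly (hermite 2) (F n w))))\<^sup>2) \<longlonglongrightarrow> 0"
      by simp
    show "(\<lambda>n. wiener.variance (carre_du_champ (F n) (F n))) \<longlonglongrightarrow> 0"
      by (rule tendsto_sandwich[OF _ _ tendsto_const lim])
         (intro always_eventually allI wiener.variance_positive chaos_variance_le_proj[OF F])+
  qed
  \<comment> \<open>For p >= 1 both p - 1 and \<open>p div 2\<close> are smaller than p and at least
    \<open>p div 2\<close>.\<close>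
  have 5: "v \<longleftrightarrow> ii"
    unfolding v_def ii_def using p by (intro influence_tendsto_iff[OF F _ _ F2]) auto
  have 6: "vi \<longleftrightarrow> ii"
    unfolding vi_def ii_def using p by (intro influence_tendsto_iff[OF F _ _ F2]) auto
  from 1 2 3 4 5 6 show ?thesis by blast
qed

end
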